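(* There exists a constant $C$, independent of $h$ and $v$, such that for every $v\in PH^2(\Omega)\oplus S_h(\Omega)$, $$\|v\|_{L^2(\partial\Omega)}^2\le C\big(\|v\|_{L^2(\Omega)}+h|v|_{1,\Omega}\big)\|v\|_{1,\Omega}.$$
   Context: $\Omega\subset\mathbb R^2$ is a bounded polygonal domain divided by an interface curve $\Gamma$, with $\Gamma\cap\partial\Omega=\emptyset$, into subdomains $\Omega^-,\Omega^+$. $\beta$ equals a positive constant $\beta^\pm$ on $\Omega^\pm$; functions are complex valued. $PH^2(\Omega)=\{u: u|_{\Omega^\pm}\in H^2(\Omega^\pm),\ [u]=0,\ [\beta\nabla u\cdot\mathbf n]=0 \text{ on }\Gamma\}$, where $[\cdot]$ is the jump across $\Gamma$ and $\mathbf n$ a unit normal to $\Gamma$. Mesh. $\mathcal T_h$ is a triangular or rectangular mesh of $\Omega$ of mesh size $h$, from a shape-regular quasi-uniform family, not fitted to $\Gamma$; $\mathcal N_h$ is its set of nodes. Elements cut by $\Gamma$ are interface elements; the others are non-interface. Assumptions: $\Gamma$ does not meet an edge at more than two points unless the edge is part of $\Gamma$; if $\Gamma$ meets the boundary of an element at two points, these lie on different edges; $\Gamma$ is piecewise $C^2$ and $\Gamma\cap T$ is $C^2$ for every interface element $T$; $h$ is small enough that $\Gamma$ meets no boundary element (an element $T$ with $|\partial T\cap\partial\Omega|\neq0$). IFE space. On a non-interface element $T$, $S_h(T)$ is the space of complex linear polynomials ($T$ triangular) or complex bilinear polynomials ($T$ rectangular). On an interface element $T$ with vertices $A_j$, $j\in\mathcal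 I_T$, let $D,E$ be the points where $\Gamma$ meets $\partial T$, let $l$ be the line $DE$ with unit normal $\bar{\mathbf n}$, splitting $T$ into $T_l^-,T_l^+$. The IFE shape functions $\phi_{j,T}$ are the unique real functions with $\phi_{j,T}(A_m)=\delta_{jm}$ of the form $\phi=\phi^\pm$ on $T_l^\pm$, where, for triangular $T$, $\phi^\pm$ are linear, $\phi^-(D)=\phi^+(D)$, $\phi^-(E)=\phi^+(E)$, $\beta^+\partial_{\bar{\mathbf n}}\phi^+-\beta^-\partial_{\bar{\mathbf n}}\phi^-=0$; for rectangular $T$, $\phi^\pm=a^\pm x+b^\pm y+c^\pm+d^\pm xy$, $\phi^-(D)=\phi^+(D)$, $\phi^-(E)=\phi^+(E)$, $d^-=d^+$, $\int_{\overline{DE}}(\beta^+\partial_{\bar{\mathbf n}}\phi^+-\beta^-\partial_{\bar{\mathbf n}}\phi^-)\,ds=0$. Then $S_h(T)$ is the complex span of the $\phi_{j,T}$. Globally $S_h(\Omega)=\{v\in L^2(\Omega): v|_T\in S_h(T)\ \forall T\in\mathcal T_h,\ v \text{ continuous at each } A\in\mathcal N_h\}$. $PH^2(\Omega)\oplus S_h(\Omega)$ denotes the set of sums $w+s$ with $w\in PH^2(\Omega)$, $s\in S_h(\Omega)$. Norms (broken): $\|v\|_{1,\Omega}^2=\sum_{T\in\mathcal T_h}\|v\|_{1,T}^2$ and $|v|_{1,\Omega}^2=\sum_{T\in\mathcal T_h}|v|_{1,T}^2$. Constants may depend on $\Omega,\Gamma,\beta^\pm$ and the mesh regularity. *)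

theory Defs
  imports "HOL-Analysis.Analysis"
begin

section \<open>Sobolev spaces and traces\<close>

definition sq_integrable :: "(real^2) set \<Rightarrow> (real^2 \<Rightarrow> complex) \<Rightarrow> bool" where
  "sq_integrable U u \<longleftrightarrow>
     u \<in> borel_measurable (lebesgue_on U) \<and>
     integrable (lebesgue_on U) (\<lambda>x. (cmod (u x))\<^sup>2)"

definition L2_norm :: "(real^2) set \<Rightarrow> (real^2 \<Rightarrow> complex) \<Rightarrow> real" where
  "L2_norm U u = sqrt (LINT x|lebesgue_on U. (cmod (u x))\<^sup>2)"

text \<open>
  Test functions are taken from \<open>C\<^sub>c\<^sup>1(U)\<close>, as in Gilbarg and Trudinger; by mollification this
  gives the same first-order weak derivatives as \<open>C\<^sub>c\<^sup>\<infinity>(U)\<close>.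
  \<open>U\<close> is meant to be open and \<open>u\<close>, \<open>g\<close> locally integrable.
\<close>
definition has_weak_deriv ::
  "(real^2) set \<Rightarrow> 2 \<Rightarrow> (real^2 \<Rightarrow> complex) \<Rightarrow> (real^2 \<Rightarrow> complex) \<Rightarrow> bool" where
  "has_weak_deriv U i u g \<longleftrightarrow>
     (\<forall>(\<phi> :: real^2 \<Rightarrow> real) G K.
        compact K \<and> K \<subseteq> U \<and> (\<forall>x. x \<notin> K \<longrightarrow> \<phi> x = 0) \<and>
        (\<forall>x. GDERIV \<phi> x :> G x) \<and> continuous_on UNIV G \<longrightarrow>
        (LINT x|lebesgue_on U. (G x $ i) *\<^sub>R u x) = - (LINT x|lebesgue_on U. \<phi> x *\<^sub>R g x))"

text \<open>The \<open>L\<^sup>2\<close> weak derivative; it is unique up to null sets whenever it exists.\<close>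
definition weak_deriv :: "(real^2) set \<Rightarrow> 2 \<Rightarrow> (real^2 \<Rightarrow> complex) \<Rightarrow> real^2 \<Rightarrow> complex" where
  "weak_deriv U i u = (SOME g. sq_integrable U g \<and> has_weak_deriv U i u g)"

definition H1 :: "(real^2) set \<Rightarrow> (real^2 \<Rightarrow> complex) set" where
  "H1 U = {u. sq_integrable U u \<and> (\<forall>i. \<exists>g. sq_integrable U g \<and> has_weak_deriv U i u g)}"

definition H2 :: "(real^2) set \<Rightarrow> (real^2 \<Rightarrow> complex) set" where
  "H2 U = {u \<in> H1 U. \<forall>i. weak_deriv U i u \<in> H1 U}"

definition H1_seminorm :: "(real^2) set \<Rightarrow> (real^2 \<Rightarrow> complex) \<Rightarrow> real" where
  "H1_seminorm U u = sqrt (\<Sum>i\<in>UNIV. (L2_norm U (weak_deriv U i u))\<^sup>2)"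

definition H1_norm :: "(real^2) set \<Rightarrow> (real^2 \<Rightarrow> complex) \<Rightarrow> real" where
  "H1_norm U u = sqrt ((L2_norm U u)\<^sup>2 + (H1_seminorm U u)\<^sup>2)"

text \<open>
  The trace on the boundary, in its pointwise form: \<open>u x\<close> at a boundary point \<open>x\<close> is the limit of
  the means of \<open>u\<close> over \<open>ball x r \<inter> U\<close>, and 0 if there is no limit (the convention of Evans and
  Gariepy for the precise representative). For \<open>u\<close> in \<open>H\<^sup>1(U)\<close>, and more generally for \<open>u\<close>
  piecewise \<open>H\<^sup>1\<close> on a mesh, the limit exists and is the usual trace at almost every point of
  every part of the boundary near which \<open>U\<close> is a Lipschitz domain. The value does not depend
  on the representative of \<open>u\<close>.
\<close>
definition mean_on :: "(real^2) set \<Rightarrow> (real^2 \<Rightarrow> complex) \<Rightarrow> complex" where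
  "mean_on B u = (1 / measure lebesgue B) *\<^sub>R (LINT y|lebesgue_on B. u y)"

definition bdry_trace :: "(real^2) set \<Rightarrow> (real^2 \<Rightarrow> complex) \<Rightarrow> real^2 \<Rightarrow> complex" where
  "bdry_trace U u x =
     (if \<exists>c. ((\<lambda>r. mean_on (ball x r \<inter> U) u) \<longlongrightarrow> c) (at_right 0)
      then Lim (at_right 0) (\<lambda>r. mean_on (ball x r \<inter> U) u) else 0)"


section \<open>Polygonal domains and interfaces\<close>

text \<open>
  The set \<open>S\<close> lists the sides of \<open>\<Omega>\<close> by their end points, each side once. The condition
  \<open>interior (closure \<Omega>) = \<Omega>\<close> rules out slits, so that \<open>\<Omega>\<close> lies on exactly one side
  of each of its sides.
\<close>
definition polygonal_domain :: "(real^2) set \<Rightarrow> ((real^2) \<times> (real^2)) set \<Rightarrow> bool" where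
  "polygonal_domain \<Omega> S \<longleftrightarrow>
     open \<Omega> \<and> connected \<Omega> \<and> bounded \<Omega> \<and> \<Omega> \<noteq> {} \<and> interior (closure \<Omega>) = \<Omega> \<and>
     finite S \<and> (\<forall>(a, b)\<in>S. a \<noteq> b) \<and>
     frontier \<Omega> = (\<Union>(a, b)\<in>S. closed_segment a b) \<and>
     (\<forall>(a, b)\<in>S. \<forall>(c, d)\<in>S. (a, b) \<noteq> (c, d) \<longrightarrow> open_segment a b \<inter> closed_segment c d = {})"

text \<open>The squared \<open>L\<^sup>2\<close> norm with respect to arc length on the union of the segments in \<open>S\<close>.\<close>
definition bdry_L2_norm_sq :: "((real^2) \<times> (real^2)) set \<Rightarrow> (real^2 \<Rightarrow> complex) \<Rightarrow> ennreal" where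
  "bdry_L2_norm_sq S f =
     (\<Sum>(a, b)\<in>S. \<integral>\<^sup>+t. ennreal ((cmod (f (linepath a b t)))\<^sup>2 * dist a b) \<partial>lebesgue_on {0..1})"

definition C2_regular :: "(real \<Rightarrow> real^2) \<Rightarrow> real set \<Rightarrow> bool" where
  "C2_regular g I \<longleftrightarrow>
     (\<exists>g' g''. (\<forall>t\<in>I. (g has_vector_derivative g' t) (at t within I) \<and>
                      (g' has_vector_derivative g'' t) (at t within I) \<and> g' t \<noteq> 0) \<and>
               continuous_on I g'')"

definition piecewise_C2 :: "(real \<Rightarrow> real^2) \<Rightarrow> bool" where
  "piecewise_C2 g \<longleftrightarrow>
     (\<exists>(\<tau> :: nat \<Rightarrow> real) n. \<tau> 0 = 0 \<and> \<tau> n = 1 \<and>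
        (\<forall>i<n. \<tau> i < \<tau> (Suc i) \<and> C2_regular g {\<tau> i..\<tau> (Suc i)}))"

text \<open>
  A curve that divides \<open>\<Omega>\<close> without meeting its boundary is closed; \<open>\<gamma>\<close> parametrizes
  \<open>\<Gamma> = path_image \<gamma>\<close>.
\<close>
definition interface ::
  "(real^2) set \<Rightarrow> (real^2) set \<Rightarrow> (real^2) set \<Rightarrow> (real \<Rightarrow> real^2) \<Rightarrow> bool" where
  "interface \<Omega> \<Omega>m \<Omega>p \<gamma> \<longleftrightarrow>
     simple_path \<gamma> \<and> pathfinish \<gamma> = pathstart \<gamma> \<and> piecewise_C2 \<gamma> \<and> path_image \<gamma> \<subseteq> \<Omega> \<and>
     open \<Omega>m \<and> connected \<Omega>m \<and> \<Omega>m \<noteq> {} \<and> open \<Omega>p \<and> connected \<Omega>p \<and> \<Omega>p \<noteq> {} \<and>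
     \<Omega>m \<inter> \<Omega>p = {} \<and> \<Omega>m \<union> \<Omega>p = \<Omega> - path_image \<gamma>"

definition unit_normal :: "(real \<Rightarrow> real^2) \<Rightarrow> real \<Rightarrow> real^2" where
  "unit_normal \<gamma> t =
     (let d = vector_derivative \<gamma> (at t) in (1 / norm d) *\<^sub>R vector [d $ 2, - (d $ 1)])"

definition normal_flux ::
  "(real^2) set \<Rightarrow> (real \<Rightarrow> real^2) \<Rightarrow> (real^2 \<Rightarrow> complex) \<Rightarrow> real \<Rightarrow> complex" where
  "normal_flux U \<gamma> u t =
     (\<Sum>i\<in>UNIV. (unit_normal \<gamma> t $ i) *\<^sub>R bdry_trace U (weak_deriv U i u) (\<gamma> t))"

text \<open>
  As \<open>\<gamma>\<close> is piecewise regular, "almost everywhere on \<open>\<Gamma>\<close>" is the same for arc length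
  and for the parameter.
\<close>
definition PH2 ::
  "(real^2) set \<Rightarrow> (real^2) set \<Rightarrow> (real \<Rightarrow> real^2) \<Rightarrow> real \<Rightarrow> real \<Rightarrow> (real^2 \<Rightarrow> complex) set" where
  "PH2 \<Omega>m \<Omega>p \<gamma> \<beta>m \<beta>p =
     {u. u \<in> H2 \<Omega>m \<and> u \<in> H2 \<Omega>p \<and>
         (AE t in lebesgue_on {0..1}. bdry_trace \<Omega>p u (\<gamma> t) = bdry_trace \<Omega>m u (\<gamma> t)) \<and>
         (AE t in lebesgue_on {0..1}.
            \<beta>p *\<^sub>R normal_flux \<Omega>p \<gamma> u t = \<beta>m *\<^sub>R normal_flux \<Omega>m \<gamma> u t)}"


section \<open>Meshes\<close>

definition vertices :: "(real^2) set \<Rightarrow> (real^2) set" where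
  "vertices T = {A. A extreme_point_of T}"

definition triangle :: "(real^2) set \<Rightarrow> bool" where
  "triangle T \<longleftrightarrow> 2 simplex T"

text \<open>Rectangles have sides parallel to the axes, as fits the local space spanned by 1, x, y, xy.\<close>
definition rectangle :: "(real^2) set \<Rightarrow> bool" where
  "rectangle T \<longleftrightarrow> (\<exists>a b. a $ 1 < b $ 1 \<and> a $ 2 < b $ 2 \<and> T = cbox a b)"

definition mesh :: "(real^2) set \<Rightarrow> (real^2) set set \<Rightarrow> bool" where
  "mesh \<Omega> M \<longleftrightarrow>
     finite M \<and> ((\<forall>T\<in>M. triangle T) \<or> (\<forall>T\<in>M. rectangle T)) \<and> \<Union>M = closure \<Omega> \<and>
     (\<forall>T\<in>M. \<forall>T'\<in>M. T \<inter> T' face_of T \<and> T \<inter> T' face_of T')"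

definition mesh_size :: "(real^2) set set \<Rightarrow> real" where
  "mesh_size M = Max (diameter ` M)"

text \<open>
  Shape regularity with parameter \<open>\<sigma>\<close> and quasi-uniformity with parameter \<open>\<kappa>\<close>. A family of
  meshes is shape regular and quasi-uniform if and only if all its members satisfy this with
  common parameters.
\<close>
definition regular_mesh :: "real \<Rightarrow> real \<Rightarrow> (real^2) set set \<Rightarrow> bool" where
  "regular_mesh \<sigma> \<kappa> M \<longleftrightarrow>
     (\<forall>T\<in>M. (\<exists>x r. 0 < r \<and> cball x r \<subseteq> T \<and> diameter T \<le> \<sigma> * r) \<and>
            mesh_size M \<le> \<kappa> * diameter T)"

definition interface_element :: "(real^2) set \<Rightarrow> (real^2) set \<Rightarrow> bool" where
  "interface_element \<Gamma> T \<longleftrightarrow> interior T \<inter> \<Gamma> \<noteq> {}"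

text \<open>
  The intersection of the two boundaries is a finite union of points and segments; it has positive
  length if and only if it contains a nondegenerate segment.
\<close>
definition boundary_element :: "(real^2) set \<Rightarrow> (real^2) set \<Rightarrow> bool" where
  "boundary_element \<Omega> T \<longleftrightarrow>
     (\<exists>a b. a \<noteq> b \<and> closed_segment a b \<subseteq> frontier T \<inter> frontier \<Omega>)"

text \<open>
  The third conjunct is the presupposition that an interface element has exactly two points
  \<open>D\<close>, \<open>E\<close> where \<open>\<Gamma>\<close> meets its boundary; the local spaces below refer to them.
  The fourth says that \<open>\<Gamma> \<inter> T\<close> is of class \<open>C\<^sup>2\<close>.
\<close>
definition admissible_mesh :: "(real^2) set \<Rightarrow> (real^2) set \<Rightarrow> (real^2) set set \<Rightarrow> bool" where
  "admissible_mesh \<Omega> \<Gamma> M \<longleftrightarrow>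
     (\<forall>T\<in>M. \<forall>e. e edge_of T \<longrightarrow> e \<subseteq> \<Gamma> \<or> (finite (\<Gamma> \<inter> e) \<and> card (\<Gamma> \<inter> e) \<le> 2)) \<and>
     (\<forall>T\<in>M. \<forall>D E. D \<noteq> E \<and> \<Gamma> \<inter> frontier T = {D, E} \<longrightarrow>
        (\<exists>e e'. e edge_of T \<and> e' edge_of T \<and> e \<noteq> e' \<and> D \<in> e \<and> E \<in> e')) \<and>
     (\<forall>T\<in>M. interface_element \<Gamma> T \<longrightarrow> (\<exists>D E. D \<noteq> E \<and> \<Gamma> \<inter> frontier T = {D, E})) \<and>
     (\<forall>T\<in>M. interface_element \<Gamma> T \<longrightarrow>
        (\<exists>g. arc g \<and> path_image g = \<Gamma> \<inter> T \<and> C2_regular g {0..1})) \<and>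
     (\<forall>T\<in>M. boundary_element \<Omega> T \<longrightarrow> \<Gamma> \<inter> T = {})"

definition broken_H1_seminorm :: "(real^2) set set \<Rightarrow> (real^2 \<Rightarrow> complex) \<Rightarrow> real" where
  "broken_H1_seminorm M v = sqrt (\<Sum>T\<in>M. (H1_seminorm (interior T) v)\<^sup>2)"

definition broken_H1_norm :: "(real^2) set set \<Rightarrow> (real^2 \<Rightarrow> complex) \<Rightarrow> real" where
  "broken_H1_norm M v = sqrt (\<Sum>T\<in>M. (H1_norm (interior T) v)\<^sup>2)"


section \<open>Immersed finite element spaces\<close>

definition bilin :: "'a::real_vector \<Rightarrow> 'a \<Rightarrow> 'a \<Rightarrow> 'a \<Rightarrow> real^2 \<Rightarrow> 'a" where
  "bilin a b c d p = (p $ 1) *\<^sub>R a + (p $ 2) *\<^sub>R b + c + (p $ 1 * p $ 2) *\<^sub>R d"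

text \<open>
  \<open>D\<close>, \<open>E\<close> are the points where \<open>\<Gamma>\<close> meets the boundary of \<open>T\<close>, and \<open>n\<close> is the unit normal of the
  line \<open>DE\<close> pointing from the minus to the plus side, where the part of the boundary of \<open>T\<close> on the
  minus (plus) side is the one in \<open>\<Omega>m\<close> (\<open>\<Omega>p\<close>).
\<close>
definition cut_line ::
  "(real^2) set \<Rightarrow> (real^2) set \<Rightarrow> (real^2) set \<Rightarrow> (real^2) set \<Rightarrow> real^2 \<Rightarrow> real^2 \<Rightarrow> real^2 \<Rightarrow> bool" where
  "cut_line \<Omega>m \<Omega>p \<Gamma> T D E n \<longleftrightarrow>
     D \<noteq> E \<and> \<Gamma> \<inter> frontier T = {D, E} \<and> norm n = 1 \<and> n \<bullet> (E - D) = 0 \<and>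
     (\<forall>x \<in> frontier T \<inter> \<Omega>m. n \<bullet> (x - D) \<le> 0) \<and>
     (\<forall>x \<in> frontier T \<inter> \<Omega>p. n \<bullet> (x - D) \<ge> 0)"

definition flux_jump ::
  "real \<Rightarrow> real \<Rightarrow> real^2 \<Rightarrow> (real^2 \<Rightarrow> real) \<Rightarrow> (real^2 \<Rightarrow> real) \<Rightarrow> real^2 \<Rightarrow> real" where
  "flux_jump \<beta>m \<beta>p n \<phi>m \<phi>p x =
     \<beta>p * frechet_derivative \<phi>p (at x) n - \<beta>m * frechet_derivative \<phi>m (at x) n"

text \<open>The IFE shape function of the vertex \<open>A\<close>; its values outside \<open>T\<close> are immaterial.\<close>
definition ife_shape ::
  "(real^2) set \<Rightarrow> (real^2) set \<Rightarrow> (real^2) set \<Rightarrow> real \<Rightarrow> real \<Rightarrow>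
   (real^2) set \<Rightarrow> real^2 \<Rightarrow> (real^2 \<Rightarrow> real) \<Rightarrow> bool" where
  "ife_shape \<Omega>m \<Omega>p \<Gamma> \<beta>m \<beta>p T A \<phi> \<longleftrightarrow>
     (\<forall>B\<in>vertices T. \<phi> B = (if B = A then 1 else 0)) \<and>
     (\<exists>D E n am bm cm dm ap bp cp dp \<phi>m \<phi>p.
        cut_line \<Omega>m \<Omega>p \<Gamma> T D E n \<and>
        \<phi>m = bilin am bm cm dm \<and> \<phi>p = bilin ap bp cp dp \<and>
        (\<forall>x\<in>T. n \<bullet> (x - D) \<le> 0 \<longrightarrow> \<phi> x = \<phi>m x) \<and>
        (\<forall>x\<in>T. n \<bullet> (x - D) \<ge> 0 \<longrightarrow> \<phi> x = \<phi>p x) \<and>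
        \<phi>m D = \<phi>p D \<and> \<phi>m E = \<phi>p E \<and>
        (if triangle T then dm = 0 \<and> dp = 0 \<and> (\<forall>x. flux_jump \<beta>m \<beta>p n \<phi>m \<phi>p x = 0)
         else dm = dp \<and>
              integral {0..1} (\<lambda>t. flux_jump \<beta>m \<beta>p n \<phi>m \<phi>p (linepath D E t) * dist D E) = 0))"

definition complex_span :: "(real^2 \<Rightarrow> real) set \<Rightarrow> (real^2 \<Rightarrow> complex) set" where
  "complex_span B =
     {p. \<exists>F c. finite F \<and> F \<subseteq> B \<and> p = (\<lambda>x. \<Sum>\<phi>\<in>F. c \<phi> * complex_of_real (\<phi> x))}"

text \<open>Elements of the local space matter only through their restriction to \<open>T\<close>.\<close>
definition local_space ::
  "(real^2) set \<Rightarrow> (real^2) set \<Rightarrow> (real^2) set \<Rightarrow> real \<Rightarrow> real \<Rightarrow>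
   (real^2) set \<Rightarrow> (real^2 \<Rightarrow> complex) set" where
  "local_space \<Omega>m \<Omega>p \<Gamma> \<beta>m \<beta>p T =
     (if interface_element \<Gamma> T
      then complex_span {\<phi>. \<exists>A\<in>vertices T. ife_shape \<Omega>m \<Omega>p \<Gamma> \<beta>m \<beta>p T A \<phi>}
      else if triangle T then {p. \<exists>a b c. p = bilin a b c 0}
      else {p. \<exists>a b c d. p = bilin a b c d})"

text \<open>
  Here \<open>p T\<close> is the (everywhere defined) representative of \<open>v\<close> on \<open>T\<close>, through which the continuity
  of \<open>v\<close> at the nodes is expressed.
\<close>
definition ife_space ::
  "(real^2) set \<Rightarrow> (real^2) set \<Rightarrow> (real^2) set \<Rightarrow> (real^2) set \<Rightarrow> real \<Rightarrow> real \<Rightarrow>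
   (real^2) set set \<Rightarrow> (real^2 \<Rightarrow> complex) set" where
  "ife_space \<Omega> \<Omega>m \<Omega>p \<Gamma> \<beta>m \<beta>p M =
     {v. sq_integrable \<Omega> v \<and>
         (\<exists>p. (\<forall>T\<in>M. p T \<in> local_space \<Omega>m \<Omega>p \<Gamma> \<beta>m \<beta>p T \<and>
                      (AE x in lebesgue_on T. v x = p T x)) \<and>
              (\<forall>A \<in> (\<Union>T\<in>M. vertices T). \<forall>T\<in>M. \<forall>T'\<in>M. A \<in> T \<and> A \<in> T' \<longrightarrow> p T A = p T' A))}"

text \<open>The set of sums \<open>w + s\<close>; the sum need not be direct.\<close>
definition sum_space ::
  "(real^2 \<Rightarrow> complex) set \<Rightarrow> (real^2 \<Rightarrow> complex) set \<Rightarrow> (real^2 \<Rightarrow> complex) set" where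
  "sum_space V W = {v. \<exists>w\<in>V. \<exists>s\<in>W. v = (\<lambda>x. w x + s x)}"

end

theory Submission
  imports Defs
begin

text \<open>
  Neither the transmission conditions on the interface nor the jumps of the finite element
  functions across interface edges play a role. The interface has positive distance to the
  boundary of \<open>\<Omega>\<close>. If the mesh is fine, all elements near the boundary are non-interface elements, so
  that near the boundary the functions are of class \<open>H\<^sup>1\<close>, and a fixed triangle over each side can be
  used. If the mesh is coarse, the boundary elements are themselves free of the interface, and by
  regularity their inradii are bounded below. In both cases there is a convex open set \<open>U\<close>
  over a piece of a side on which \<open>v\<close> is weakly differentiable, and which contains a ball of fixed radius.

  For a direction \<open>e\<close> from the side towards the centre of this ball, \<open>v (z + \<tau> e) - v z\<close> is the
  integral of the weak derivative along the segment. Squaring and averaging over \<open>\<tau> \<in> [0, l]\<close> bounds the integral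
  of \<open>\<bar>v\<bar>\<^sup>2\<close> over a collar of width \<open>r\<close> by \<open>r\<close> times \<open>\<parallel>v\<parallel>\<^sup>2 / l + l \<bar>v\<bar>\<^sub>1\<^sup>2\<close>. As the trace is a limit of means
  over half discs, Fatou's lemma gives the same bound, without the factor \<open>r\<close>, for the trace; finally \<open>l\<close> is optimised.
\<close>


section \<open>Test functions and the fundamental lemma\<close>

text \<open>The core estimate is C (V / l + l E) for every \<open>l\<close> in (0, 1], where V and E
  are the squared broken \<open>L2\<close> norm and energy and C depends neither on the mesh nor on
  \<open>l\<close>. An elementwise argument on fine meshes would put the reciprocal of the mesh size
  in front of V; hence an open set \<open>U\<close> of fixed size, which may cross many elements.
  The price is that the function must be weakly differentiable across edges. Continuity at the nodes
  yields this: on a common face of two elements the difference of the two polynomials is affine and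
  vanishes at the extreme points. On coarse meshes \<open>U\<close> is the interior of one element,
  and summing over elements costs no factor, as each contributes only its own energy. No
  approximation by smooth functions is used: the difference formula for a weak derivative comes from
  testing with a test function averaged along a segment. All functions are replaced by Borel
  representatives on the whole plane, so that translations and Fubini's theorem apply. The final
  \<open>l\<close> is the square root of V / E, cut off at 1.\<close>

definition test_fn :: "(real^2) set \<Rightarrow> (real^2 \<Rightarrow> real) \<Rightarrow> (real^2 \<Rightarrow> real^2) \<Rightarrow> bool" where
  "test_fn U \<phi> G \<longleftrightarrow> (\<exists>K. compact K \<and> K \<subseteq> U \<and> (\<forall>x. x \<notin> K \<longrightarrow> \<phi> x = 0)) \<and>
     (\<forall>x. GDERIV \<phi> x :> G x) \<and> continuous_on UNIV G"

lemma test_fn_mono: "test_fn U \<phi> G \<Longrightarrow> U \<subseteq> V \<Longrightarrow> test_fn V \<phi> G"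
  unfolding test_fn_def by blast

lemma test_fn_continuous: "test_fn U \<phi> G \<Longrightarrow> continuous_on UNIV \<phi>"
  unfolding test_fn_def gderiv_def
  by (meson continuous_at_imp_continuous_on has_derivative_continuous)

lemma compact_support_bounded:
  fixes f :: "'a::euclidean_space \<Rightarrow> 'b::real_normed_vector"
  assumes "compact K" "continuous_on UNIV f" "\<And>x. x \<notin> K \<Longrightarrow> f x = 0"
  obtains B where "B > 0" "\<And>x. norm (f x) \<le> B"
proof -
  have "compact (f ` K)" using assms by (meson compact_continuous_image continuous_on_subset top_greatest)
  then obtain B where B: "B > 0" "\<And>x. x \<in> K \<Longrightarrow> norm (f x) \<le> B"
    using compact_imp_bounded bounded_pos by (metis (no_types, lifting) imageI)
  have "norm (f x) \<le> B" for x using B assms(3)[of x] by (cases "x \<in> K") auto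
  then show ?thesis using B that by blast
qed

lemma test_fn_grad_zero:
  assumes "test_fn U \<phi> G" "compact K" "\<And>x. x \<notin> K \<Longrightarrow> \<phi> x = 0" "x \<notin> K"
  shows "G x = 0"
proof -
  have "open (-K)" using assms(2) compact_imp_closed by blast
  have "(\<phi> has_derivative (\<lambda>h. h \<bullet> G x)) (at x)" using assms unfolding test_fn_def gderiv_def by blast
  moreover have "(\<phi> has_derivative (\<lambda>h. 0)) (at x)"
    by (rule has_derivative_transform_within_open[where f="\<lambda>_. 0" and s="-K"])
      (use assms \<open>open (-K)\<close> in auto)
  ultimately have "(\<lambda>h. h \<bullet> G x) = (\<lambda>h. 0)" by (rule has_derivative_unique)
  then show ?thesis by (metis inner_eq_zero_iff)
qed

text \<open>Squaring removes the kink of the positive part at 0; this is why the bumps below are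
  built from the square.\<close>

lemma pos_part_sq_deriv: "((\<lambda>s::real. (max 0 s)\<^sup>2) has_real_derivative 2 * max 0 s) (at s)"
proof -
  consider "s > 0" | "s < 0" | "s = 0" by linarith
  then show ?thesis
  proof cases
    case 1
    have "((\<lambda>s::real. s\<^sup>2) has_real_derivative 2 * s) (at s)" by (auto intro!: derivative_eq_intros)
    then have "((\<lambda>s::real. (max 0 s)\<^sup>2) has_real_derivative 2 * s) (at s)"
      by (rule has_field_derivative_transform_within_open[where S="{0<..}"]) (use 1 in auto)
    then show ?thesis using 1 by simp
  next
    case 2
    have "((\<lambda>s::real. 0::real) has_real_derivative 0) (at s)" by simp
    then have "((\<lambda>s::real. (max 0 s)\<^sup>2) has_real_derivative 0) (at s)"
      by (rule has_field_derivative_transform_within_open[where S="{..<0}"]) (use 2 in auto)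
    then show ?thesis using 2 by simp
  next
    case 3
    \<comment> \<open>The difference quotient at 0 is bounded by the absolute value of
      \<open>y\<close>.\<close>
    have "((\<lambda>y::real. \<bar>y\<bar>) \<longlongrightarrow> 0) (at 0)" by (auto intro!: tendsto_eq_intros)
    then have "((\<lambda>y::real. (max 0 y)\<^sup>2 / y) \<longlongrightarrow> 0) (at 0)"
      by (rule Lim_null_comparison[rotated])
        (auto intro!: always_eventually simp: max_def power2_eq_square)
    then show ?thesis using 3 by (simp add: has_field_derivative_iff)
  qed
qed

text \<open>As \<open>n\<close> grows, these \<open>C\<^sup>1\<close> bumps increase to the indicator of \<open>(a, b)\<close>.\<close>
definition bump :: "nat \<Rightarrow> real \<Rightarrow> real \<Rightarrow> real \<Rightarrow> real" where
  "bump n a b t = 1 - 1 / (1 + real n * (max 0 ((t - a) * (b - t)))\<^sup>2)"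

definition bump' :: "nat \<Rightarrow> real \<Rightarrow> real \<Rightarrow> real \<Rightarrow> real" where
  "bump' n a b t = real n * (2 * max 0 ((t - a) * (b - t)) * (a + b - 2 * t))
     / (1 + real n * (max 0 ((t - a) * (b - t)))\<^sup>2)\<^sup>2"

lemma bump_denom_pos: "1 + real n * (max 0 s)\<^sup>2 > 0"
  by (smt (verit) mult_nonneg_nonneg of_nat_0_le_iff zero_le_power2)

lemma bump_deriv: "(bump n a b has_real_derivative bump' n a b t) (at t)"
proof -
  have q: "((\<lambda>t. (t - a) * (b - t)) has_real_derivative (a + b - 2 * t)) (at t)"
    by (auto intro!: derivative_eq_intros)
  have m: "((\<lambda>t. (max 0 ((t - a) * (b - t)))\<^sup>2) has_real_derivative
      2 * max 0 ((t - a) * (b - t)) * (a + b - 2 * t)) (at t)"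
    by (rule DERIV_chain2[OF pos_part_sq_deriv q])
  have nz: "1 + real n * (max 0 ((t - a) * (b - t)))\<^sup>2 \<noteq> 0" using bump_denom_pos by (metis less_irrefl)
  show ?thesis unfolding bump_def bump'_def
    by (rule derivative_eq_intros m refl nz | simp add: nz)+ (simp add: power2_eq_square)
qed

lemma bump_cont: "continuous_on UNIV (bump n a b)"
  by (meson DERIV_continuous continuous_at_imp_continuous_on bump_deriv)

lemma bump'_cont: "continuous_on UNIV (bump' n a b)"
proof -
  have nz: "1 + real n * (max 0 s)\<^sup>2 \<noteq> 0" for s using bump_denom_pos by (metis less_irrefl)
  show ?thesis unfolding bump'_def by (intro continuous_intros) (simp add: nz)
qed

lemma bump_bounds: "0 \<le> bump n a b t" "bump n a b t \<le> 1"
  using bump_denom_pos[of n "(t - a) * (b - t)"] unfolding bump_def by (auto simp: field_simps)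

lemma bump_outside: "t \<notin> {a<..<b} \<Longrightarrow> a < b \<Longrightarrow> bump n a b t = 0"
proof -
  assume "t \<notin> {a<..<b}" "a < b"
  then have "(t - a) * (b - t) \<le> 0" by (auto simp: mult_le_0_iff not_less)
  then show ?thesis unfolding bump_def by (simp add: max_def)
qed

lemma bump_lim: "a < b \<Longrightarrow> (\<lambda>n. bump n a b t) \<longlonglongrightarrow> indicator {a<..<b} t"
proof (cases "t \<in> {a<..<b}")
  case True
  define c where "c = (max 0 ((t - a) * (b - t)))\<^sup>2"
  have c: "c > 0" using True unfolding c_def by (auto simp: max_def)
  have "filterlim (\<lambda>n. 1 + real n * c) at_top sequentially"
    by (rule filterlim_tendsto_add_at_top[OF tendsto_const])
      (rule filterlim_at_top_mult_tendsto_pos[OF tendsto_const c filterlim_real_sequentially])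
  then have "(\<lambda>n. 1 - 1 / (1 + real n * c)) \<longlonglongrightarrow> 1 - 0"
    by (intro tendsto_diff tendsto_const tendsto_divide_0[OF tendsto_const] filterlim_at_top_imp_at_infinity)
  then show ?thesis using True unfolding bump_def c_def by simp
next
  case False
  moreover assume "a < b"
  ultimately show ?thesis by (simp add: bump_outside)
qed

text \<open>The product vanishes off the open box, and the closed box serves as the compact set
  required by \<open>test_fn\<close>. The gradient is the product rule in coordinates.\<close>

lemma box_bump_test_fn:
  fixes a b :: "real^2"
  assumes "a $ 1 < b $ 1" "a $ 2 < b $ 2" "cbox a b \<subseteq> U"
  shows "test_fn U (\<lambda>x. bump n (a $ 1) (b $ 1) (x $ 1) * bump n (a $ 2) (b $ 2) (x $ 2))
    (\<lambda>x. vector [bump' n (a $ 1) (b $ 1) (x $ 1) * bump n (a $ 2) (b $ 2) (x $ 2),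
                 bump n (a $ 1) (b $ 1) (x $ 1) * bump' n (a $ 2) (b $ 2) (x $ 2)])"
  unfolding test_fn_def
proof (intro conjI allI exI[of _ "cbox a b"] impI)
  show "bump n (a $ 1) (b $ 1) (x $ 1) * bump n (a $ 2) (b $ 2) (x $ 2) = 0"
    if "x \<notin> cbox a b" for x
  proof -
    from that have "x $ 1 \<notin> {a$1<..<b$1} \<or> x $ 2 \<notin> {a$2<..<b$2}"
      by (auto simp: mem_box_cart forall_2 intro: less_imp_le)
    then show ?thesis using assms by (auto simp del: greaterThanLessThan_iff simp: bump_outside)
  qed
  fix x :: "real^2"
  have d: "((\<lambda>x::real^2. bump n (a $ i) (b $ i) (x $ i)) has_derivative
      (\<lambda>h. h $ i * bump' n (a $ i) (b $ i) (x $ i))) (at x)" for i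
  proof -
    have "((\<lambda>x::real^2. x $ i) has_derivative (\<lambda>h. h $ i)) (at x)"
      by (simp add: bounded_linear_imp_has_derivative bounded_linear_vec_nth)
    from DERIV_compose_FDERIV[OF bump_deriv this] show ?thesis .
  qed
  show "GDERIV (\<lambda>x. bump n (a $ 1) (b $ 1) (x $ 1) * bump n (a $ 2) (b $ 2) (x $ 2)) x :>
    vector [bump' n (a $ 1) (b $ 1) (x $ 1) * bump n (a $ 2) (b $ 2) (x $ 2),
            bump n (a $ 1) (b $ 1) (x $ 1) * bump' n (a $ 2) (b $ 2) (x $ 2)]"
    unfolding gderiv_def
    by (rule has_derivative_eq_rhs[OF has_derivative_mult[OF d d]])
      (auto simp: fun_eq_iff inner_vec_def sum_2 algebra_simps)
next
  have c: "continuous_on UNIV (\<lambda>x::real^2. bump n (a $ i) (b $ i) (x $ i))"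
     "continuous_on UNIV (\<lambda>x::real^2. bump' n (a $ i) (b $ i) (x $ i))" for i
    by (auto intro!: continuous_on_compose2[OF bump_cont] continuous_on_compose2[OF bump'_cont]
        continuous_intros)
  have "continuous_on UNIV (\<lambda>x::real^2. \<chi> i::2.
      if i = 1 then bump' n (a $ 1) (b $ 1) (x $ 1) * bump n (a $ 2) (b $ 2) (x $ 2)
      else bump n (a $ 1) (b $ 1) (x $ 1) * bump' n (a $ 2) (b $ 2) (x $ 2))"
  proof (rule continuous_on_vec_lambda)
    fix i :: 2
    show "continuous_on UNIV (\<lambda>x::real^2.
      if i = 1 then bump' n (a $ 1) (b $ 1) (x $ 1) * bump n (a $ 2) (b $ 2) (x $ 2)
      else bump n (a $ 1) (b $ 1) (x $ 1) * bump' n (a $ 2) (b $ 2) (x $ 2))"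
      by (cases "i = 1") (simp_all add: continuous_on_mult c)
  qed
  moreover have "vector [p, q] = (\<chi> i::2. if i = 1 then p else q)" for p q :: real
    by (simp add: vec_eq_iff forall_2)
  ultimately show "continuous_on UNIV (\<lambda>x::real^2.
      vector [bump' n (a $ 1) (b $ 1) (x $ 1) * bump n (a $ 2) (b $ 2) (x $ 2),
            bump n (a $ 1) (b $ 1) (x $ 1) * bump' n (a $ 2) (b $ 2) (x $ 2)] :: real^2)"
    by simp
qed (use assms in auto)

text \<open>Testing with the product bumps and letting them increase to the indicator of a box
  shows, by dominated convergence, that \<open>g\<close> has integral 0 over every box inside
  \<open>U\<close>. Lebesgue's differentiation theorem then gives the pointwise statement.\<close>

lemma fundamental_lemma:
  fixes g :: "real^2 \<Rightarrow> complex"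
  assumes U: "open U" and g: "integrable lborel g"
    and test: "\<And>\<phi> G. test_fn U \<phi> G \<Longrightarrow> (LINT x|lborel. \<phi> x *\<^sub>R g x) = 0"
  shows "AE x in lborel. x \<in> U \<longrightarrow> g x = 0"
proof -
  have gm[measurable]: "g \<in> borel_measurable borel" using g by simp
  have box0: "integral (cbox a b) g = 0"
    if ab: "a $ 1 < b $ 1" "a $ 2 < b $ 2" "cbox a b \<subseteq> U" for a b :: "real^2"
  proof -
    define \<phi> where "\<phi> n x = bump n (a $ 1) (b $ 1) (x $ 1) * bump n (a $ 2) (b $ 2) (x $ 2)"
      for n and x :: "real^2"
    have cont: "continuous_on UNIV (\<phi> n)" for n
      unfolding \<phi>_def by (rule test_fn_continuous[OF box_bump_test_fn[OF ab]])
    have [measurable]: "\<phi> n \<in> borel_measurable borel" for n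
      by (rule borel_measurable_continuous_onI[OF cont])
    have lim: "(\<lambda>n. \<phi> n x) \<longlonglongrightarrow> indicator (box a b) x" for x
    proof -
      have "indicator (box a b) x = (indicator {a$1<..<b$1} (x$1) * indicator {a$2<..<b$2} (x$2) :: real)"
        by (auto simp: indicator_def mem_box_cart forall_2)
      then show ?thesis unfolding \<phi>_def using ab by (auto intro!: tendsto_mult bump_lim)
    qed
    have "(\<lambda>n. LINT x|lborel. \<phi> n x *\<^sub>R g x) \<longlonglongrightarrow> (LINT x|lborel. indicator (box a b) x *\<^sub>R g x)"
    proof (rule integral_dominated_convergence[where w="\<lambda>x. norm (g x)"])
      show "AE x in lborel. norm (\<phi> n x *\<^sub>R g x) \<le> norm (g x)" for n
        unfolding \<phi>_def using bump_bounds
        by (auto intro!: AE_I2 mult_left_le_one_le mult_le_one simp: abs_mult)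
    qed (use g lim in \<open>auto intro!: tendsto_scaleR AE_I2\<close>)
    moreover have "(LINT x|lborel. \<phi> n x *\<^sub>R g x) = 0" for n
      unfolding \<phi>_def by (rule test[OF box_bump_test_fn[OF ab]])
    ultimately have "(LINT x:box a b|lborel. g x) = 0"
      by (simp add: LIMSEQ_const_iff set_lebesgue_integral_def)
    then have "integral (box a b) g = 0"
      using g by (subst (asm) set_borel_integral_eq_integral(2))
        (auto simp: set_integrable_def intro!: integrable_mult_indicator)
    then show ?thesis by (simp add: integral_open_interval)
  qed
  have "g integrable_on cbox a b" for a b
    using g integrable_on_lborel integrable_on_subcbox by blast
  \<comment> \<open>Lebesgue's differentiation theorem for cubes with lower corner \<open>x\<close>:
    off the null set \<open>N\<close>, the averages over these cubes tend to
    \<open>g x\<close>.\<close>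
  then obtain N where N: "negligible N" and
    dens: "\<And>x e. \<lbrakk>x \<notin> N; 0 < e\<rbrakk> \<Longrightarrow>
               \<exists>d>0. \<forall>h. 0 < h \<and> h < d \<longrightarrow>
                         norm(integral (cbox x (x + h *\<^sub>R One)) g /\<^sub>R h ^ DIM(real^2) - g x) < e"
    by (metis integrable_ccontinuous_explicit)
  have "g x = 0" if xU: "x \<in> U" and xN: "x \<notin> N" for x
  proof (rule ccontr)
    assume "g x \<noteq> 0"
    then obtain d where d: "d > 0" "\<And>h. 0 < h \<Longrightarrow> h < d \<Longrightarrow>
        norm(integral (cbox x (x + h *\<^sub>R One)) g /\<^sub>R h ^ DIM(real^2) - g x) < norm (g x)"
      using dens[OF xN, of "norm (g x)"] by auto
    obtain r where r: "r > 0" "cball x r \<subseteq> U" using U xU open_contains_cball by blast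
    \<comment> \<open>A cube of side \<open>h\<close> stays within distance 2 h of its corner, by
      comparison with the 1-norm. With \<open>h\<close> at most r / 2 it lies in \<open>U\<close>,
      so its integral is 0.\<close>
    define h where "h = min (d/2) (r/2)"
    have h: "0 < h" "h < d" "h \<le> r/2" using d r by (auto simp: h_def)
    have One_nth: "(One::real^2) $ i = 1" for i by (simp add: cart_eq_inner_axis axis_in_Basis_iff inner_sum_left_Basis) 
    have add: "(x + h *\<^sub>R One) $ i = x $ i + h" for i
      by (metis One_nth mult.right_neutral real_scaleR_def vector_add_component vector_scaleR_component)
    have "cbox x (x + h *\<^sub>R One) \<subseteq> cball x r"
    proof
      fix y assume "y \<in> cbox x (x + h *\<^sub>R One)"
      then have "x $ i \<le> y $ i \<and> y $ i \<le> x $ i + h" for i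
        unfolding mem_box_cart by (metis add)
      then have y: "\<bar>y $ i - x $ i\<bar> \<le> h" for i by (smt (verit))
      have "norm (y - x) \<le> (\<Sum>i\<in>UNIV. \<bar>(y - x) $ i\<bar>)" by (rule norm_le_l1_cart)
      also have "\<dots> \<le> 2 * h" using y[of 1] y[of 2] by (simp add: sum_2)
      finally show "y \<in> cball x r" using h by (simp add: dist_norm norm_minus_commute)
    qed
    with r have "integral (cbox x (x + h *\<^sub>R One)) g = 0"
      using h by (intro box0) (simp_all only: add less_add_same_cancel1 simp_thms order.trans)
    moreover have "norm (integral (cbox x (x + h *\<^sub>R One)) g /\<^sub>R h ^ DIM(real^2) - g x) < norm (g x)"
      by (rule d(2)[OF h(1,2)])
    ultimately show False by (simp only: scaleR_zero_right diff_0 norm_minus_cancel less_irrefl)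
  qed
  moreover have "AE x in lebesgue. x \<notin> N"
    using N by (intro AE_not_in) (simp add: negligible_iff_null_sets)
  then have "AE x in lborel. x \<notin> N" by (simp add: AE_completion_iff)
  ultimately show ?thesis by auto
qed


section \<open>Weak derivatives along a direction\<close>

text \<open>Weak derivative in an arbitrary direction \<open>e\<close>, for functions on the whole
  plane that are integrable with respect to Borel measure. The set \<open>U\<close> enters only
  through the test functions; values outside are arbitrary, which leaves room for extension by zero
  and for translation.\<close>

definition weak_diff :: "(real^2) set \<Rightarrow> real^2 \<Rightarrow> (real^2 \<Rightarrow> complex) \<Rightarrow> (real^2 \<Rightarrow> complex) \<Rightarrow> bool" where
  "weak_diff U e u g \<longleftrightarrow> integrable lborel u \<and> integrable lborel g \<and>
     (\<forall>\<phi> G. test_fn U \<phi> G \<longrightarrow>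
        (LINT x|lborel. (e \<bullet> G x) *\<^sub>R u x) = - (LINT x|lborel. \<phi> x *\<^sub>R g x))"

text \<open>The parameter interval of a segment as a finite Borel measure, so that Fubini's theorem
  applies to its product with \<open>lborel\<close>.\<close>

abbreviation unit_leb :: "real measure" where
  "unit_leb \<equiv> restrict_space lborel {0..1}"

lemma finite_measure_unit_leb: "finite_measure unit_leb"
  by (rule finite_measureI) (simp add: emeasure_restrict_space)

lemma unit_leb_one: "measure unit_leb {0..1} = 1"
  by (simp add: measure_restrict_space)

lemma integrable_lborel_shift:
  fixes h :: "'a::euclidean_space \<Rightarrow> 'b::{banach, second_countable_topology}"
  assumes "integrable lborel h"
  shows "integrable lborel (\<lambda>y. h (y + e))"
proof -
  have "integrable (distr lborel borel ((+) e)) h" using assms by (simp add: lborel_distr_plus)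
  then have "integrable lborel (\<lambda>y. h (e + y))" by (subst (asm) integrable_distr_eq) (use assms in auto)
  then show ?thesis by (simp add: add.commute)
qed

lemma integral_lborel_shift:
  fixes h :: "'a::euclidean_space \<Rightarrow> 'b::{banach, second_countable_topology}"
  assumes [measurable]: "h \<in> borel_measurable borel"
  shows "(LINT y|lborel. h (y + e)) = (LINT y|lborel. h y)"
proof -
  have "(LINT y|lborel. h y) = (LINT y|distr lborel borel ((+) e). h y)" by (simp add: lborel_distr_plus)
  also have "\<dots> = (LINT y|lborel. h (e + y))" by (rule integral_distr) auto
  finally show ?thesis by (simp add: add.commute)
qed

lemma measurable_line_shift:
  fixes h :: "'a::euclidean_space \<Rightarrow> 'b::topological_space"
  assumes [measurable]: "h \<in> borel_measurable borel"
  shows "(\<lambda>(\<sigma>, y). h (y + \<sigma> *\<^sub>R e)) \<in> borel_measurable (unit_leb \<Otimes>\<^sub>M lborel)"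
proof -
  have [measurable]: "(\<lambda>\<sigma>. \<sigma>) \<in> measurable unit_leb borel"
    by (rule measurable_restrict_space1) simp
  show ?thesis by measurable
qed

text \<open>By translation invariance the inner integral of the norm does not depend on \<sigma>,
  and the parameter interval has finite measure.\<close>

lemma integrable_line_shift:
  fixes h :: "'a::euclidean_space \<Rightarrow> 'b::{banach, second_countable_topology}"
  assumes h: "integrable lborel h"
  shows "integrable (unit_leb \<Otimes>\<^sub>M lborel) (\<lambda>(\<sigma>, y). h (y + \<sigma> *\<^sub>R e))"
proof -
  interpret N: finite_measure unit_leb by (rule finite_measure_unit_leb)
  interpret pair_sigma_finite unit_leb "lborel :: 'a measure" ..
  have [measurable]: "h \<in> borel_measurable borel" using h by simp
  show ?thesis
  proof (rule Fubini_integrable)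
    show "(\<lambda>(\<sigma>, y). h (y + \<sigma> *\<^sub>R e)) \<in> borel_measurable (unit_leb \<Otimes>\<^sub>M lborel)"
      by (rule measurable_line_shift) simp
    have "(LINT y|lborel. norm (h (y + \<sigma> *\<^sub>R e))) = (LINT y|lborel. norm (h y))" for \<sigma>
      by (rule integral_lborel_shift) simp
    then show "integrable unit_leb (\<lambda>x. LINT y|lborel. norm (case (x, y) of (\<sigma>, y) \<Rightarrow> h (y + \<sigma> *\<^sub>R e)))"
      by simp
    show "AE x in unit_leb. integrable lborel (\<lambda>y. case (x, y) of (\<sigma>, y) \<Rightarrow> h (y + \<sigma> *\<^sub>R e))"
      using integrable_lborel_shift[OF h] by simp
  qed
qed

text \<open>Bridge between the Bochner integral, for which Fubini's theorem is stated, and the gauge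
  integral of the fundamental theorem of calculus.\<close>

lemma integral_unit_leb:
  fixes f :: "real \<Rightarrow> 'b::euclidean_space"
  assumes "integrable unit_leb f"
  shows "integral\<^sup>L unit_leb f = integral {0..1} f"
proof -
  have "set_integrable lborel {0..1} f"
    using assms by (simp add: integrable_restrict_space set_integrable_def)
  from set_borel_integral_eq_integral(2)[OF this] show ?thesis
    by (simp add: integral_restrict_space set_lebesgue_integral_def)
qed

lemma AE_integrable_line:
  fixes h :: "'a::euclidean_space \<Rightarrow> 'b::{banach, second_countable_topology}"
  assumes "integrable lborel h"
  shows "AE y in lborel. integrable unit_leb (\<lambda>\<sigma>. h (y + \<sigma> *\<^sub>R e))"
proof -
  interpret N: finite_measure unit_leb by (rule finite_measure_unit_leb)
  interpret pair_sigma_finite unit_leb "lborel :: 'a measure" ..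
  show ?thesis using AE_integrable_snd[OF integrable_line_shift[OF assms, of e]] by simp
qed

text \<open>By Fubini the integral of \<open>D\<close> is that of \<open>\<psi> (y + e) - \<psi> y\<close>, which vanishes by translation.\<close>
lemma integral_line_derivative:
  fixes \<psi> D :: "'a::euclidean_space \<Rightarrow> complex"
  assumes \<psi>: "integrable lborel \<psi>" and D: "integrable lborel D"
    and line: "\<And>y. ((\<lambda>\<sigma>. D (y + \<sigma> *\<^sub>R e)) has_integral \<psi> (y + e) - \<psi> y) {0..1}"
  shows "(LINT y|lborel. D y) = 0"
proof -
  interpret N: finite_measure unit_leb by (rule finite_measure_unit_leb)
  interpret pair_sigma_finite unit_leb "lborel :: 'a measure" ..
  have [measurable]: "\<psi> \<in> borel_measurable borel" "D \<in> borel_measurable borel" using \<psi> D by simp_all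
  have "(LINT y|lborel. LINT \<sigma>|unit_leb. D (y + \<sigma> *\<^sub>R e)) = (LINT y|lborel. \<psi> (y + e) - \<psi> y)"
  proof (rule integral_cong_AE)
    show "(\<lambda>y. LINT \<sigma>|unit_leb. D (y + \<sigma> *\<^sub>R e)) \<in> borel_measurable lborel"
    proof -
      have "(\<lambda>(\<sigma>, y). D (y + \<sigma> *\<^sub>R e)) \<in> borel_measurable (unit_leb \<Otimes>\<^sub>M lborel)"
        by (rule measurable_line_shift) simp
      then have "(\<lambda>(y, \<sigma>). D (y + \<sigma> *\<^sub>R e)) \<in> borel_measurable (lborel \<Otimes>\<^sub>M unit_leb)"
        by (subst measurable_pair_swap_iff) simp
      then show ?thesis by (rule N.borel_measurable_lebesgue_integral)
    qed
    show "AE y in lborel. (LINT \<sigma>|unit_leb. D (y + \<sigma> *\<^sub>R e)) = \<psi> (y + e) - \<psi> y"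
      using AE_integrable_line[OF D, of e]
      by eventually_elim (simp add: integral_unit_leb integral_unique[OF line])
  qed simp
  also have "\<dots> = (LINT y|lborel. \<psi> (y + e)) - (LINT y|lborel. \<psi> y)"
    using \<psi> by (intro Bochner_Integration.integral_diff integrable_lborel_shift)
  also have "\<dots> = 0" by (simp add: integral_lborel_shift)
  finally have "0 = (LINT y|lborel. LINT \<sigma>|unit_leb. D (y + \<sigma> *\<^sub>R e))" by simp
  also have "\<dots> = (LINT \<sigma>|unit_leb. LINT y|lborel. D (y + \<sigma> *\<^sub>R e))"
    using Fubini_integral[OF integrable_line_shift[OF D, of e]] by simp
  also have "\<dots> = (LINT y|lborel. D y)"
    by (simp add: integral_lborel_shift unit_leb_one)
  finally show ?thesis by simp
qed

lemma has_derivative_along_line: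
  assumes "GDERIV \<phi> (y + \<sigma> *\<^sub>R e) :> G"
  shows "((\<lambda>\<sigma>. \<phi> (y + \<sigma> *\<^sub>R e)) has_vector_derivative e \<bullet> G) (at \<sigma>)"
proof -
  have "((\<lambda>\<sigma>. y + \<sigma> *\<^sub>R e) has_derivative (\<lambda>h. h *\<^sub>R e)) (at \<sigma>)"
    by (auto intro!: derivative_eq_intros)
  from has_derivative_compose[OF this assms[unfolded gderiv_def]] show ?thesis
    by (simp add: has_vector_derivative_def)
qed

text \<open>Averaging a test function along a segment turns differentiation into a difference.\<close>
lemma averaged_test_fn:
  assumes t: "test_fn V \<phi> G" and seg: "\<And>z. z \<in> V \<Longrightarrow> closed_segment z (z + e) \<subseteq> U"
  defines "\<psi> \<equiv> \<lambda>y. integral {0..1} (\<lambda>\<sigma>. \<phi> (y - \<sigma> *\<^sub>R e))"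
    and "H \<equiv> \<lambda>y. integral {0..1} (\<lambda>\<sigma>. G (y - \<sigma> *\<^sub>R e))"
  shows "test_fn U \<psi> H" and "e \<bullet> H y = \<phi> y - \<phi> (y - e)"
proof -
  obtain K where K: "compact K" "K \<subseteq> V" "\<And>x. x \<notin> K \<Longrightarrow> \<phi> x = 0"
    and G: "\<And>x. GDERIV \<phi> x :> G x" "continuous_on UNIV G"
    using t unfolding test_fn_def by blast
  have c\<phi>: "continuous_on UNIV \<phi>" by (rule test_fn_continuous[OF t])
  \<comment> \<open>The set swept out by \<open>K\<close> along \<open>e\<close>: the image of a
    compact product, and inside \<open>U\<close> because the segments starting in \<open>V\<close>
    are.\<close>
  define K' where "K' = (\<lambda>(z, \<sigma>). z + \<sigma> *\<^sub>R e) ` (K \<times> {0..1})"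
  have K'c: "compact K'" unfolding K'_def
    by (intro compact_continuous_image compact_Times K compact_Icc)
      (auto simp: case_prod_unfold intro!: continuous_intros)
  have K'U: "K' \<subseteq> U"
  proof -
    have "z + \<sigma> *\<^sub>R e \<in> U" if "z \<in> K" "\<sigma> \<in> {0..1}" for z \<sigma>
    proof -
      have "z + \<sigma> *\<^sub>R e = (1 - \<sigma>) *\<^sub>R z + \<sigma> *\<^sub>R (z + e)" by (simp add: algebra_simps)
      then have "z + \<sigma> *\<^sub>R e \<in> closed_segment z (z + e)" using that(2) by (auto simp: in_segment)
      then show ?thesis using seg[of z] that K by auto
    qed
    then show ?thesis by (auto simp: K'_def)
  qed
  have z0: "\<psi> y = 0" if "y \<notin> K'" for y
  proof -
    have "\<phi> (y - \<sigma> *\<^sub>R e) = 0" if s: "\<sigma> \<in> {0..1}" for \<sigma>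
    proof (rule K(3), rule notI)
      assume "y - \<sigma> *\<^sub>R e \<in> K"
      then have "(\<lambda>(z, \<sigma>). z + \<sigma> *\<^sub>R e) (y - \<sigma> *\<^sub>R e, \<sigma>) \<in> K'" unfolding K'_def using s by blast
      then show False using \<open>y \<notin> K'\<close> by simp
    qed
    then have "\<psi> y = integral {0..1} (\<lambda>\<sigma>::real. 0::real)" unfolding \<psi>_def by (intro integral_cong) auto
    then show ?thesis by simp
  qed
  have cG: "continuous_on ((UNIV::(real^2) set) \<times> cbox 0 1) (\<lambda>(y, \<sigma>::real). G (y - \<sigma> *\<^sub>R e))"
    by (auto simp: case_prod_unfold intro!: continuous_on_compose2[OF G(2)] continuous_intros)
  have iG: "(\<lambda>\<sigma>. G (y - \<sigma> *\<^sub>R e)) integrable_on {0..1}" for y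
    by (intro integrable_continuous_real continuous_on_compose2[OF G(2)] continuous_intros) auto
  have "GDERIV \<psi> y :> H y" for y
  proof -
    \<comment> \<open>Differentiation under the integral sign takes the derivative as an element of
      the space of bounded linear maps, so the gradient is turned into the functional "inner product
      with it".\<close>
    have bl: "bounded_linear (blinfun_inner_left :: real^2 \<Rightarrow> _)" by (rule bounded_linear_blinfun_inner_left)
    have "((\<lambda>y. integral (cbox 0 1) (\<lambda>\<sigma>. \<phi> (y - \<sigma> *\<^sub>R e))) has_derivative
      integral (cbox 0 1) (\<lambda>\<sigma>. blinfun_inner_left (G (y - \<sigma> *\<^sub>R e)))) (at y within UNIV)"
    proof (rule leibniz_rule)
      fix x t
      have "((\<lambda>y. y - t *\<^sub>R e) has_derivative (\<lambda>h. h)) (at x)" by (auto intro!: derivative_eq_intros)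
      from has_derivative_compose[OF this, of \<phi>] G(1)[of "x - t *\<^sub>R e"]
      show "((\<lambda>y. \<phi> (y - t *\<^sub>R e)) has_derivative blinfun_apply (blinfun_inner_left (G (x - t *\<^sub>R e)))) (at x)"
        by (simp add: gderiv_def blinfun_inner_left.rep_eq)
    next
      fix x show "(\<lambda>\<sigma>. \<phi> (x - \<sigma> *\<^sub>R e)) integrable_on cbox 0 1"
        by (intro integrable_continuous continuous_on_compose2[OF c\<phi>] continuous_intros) auto
    next
      show "continuous_on ((UNIV::(real^2) set) \<times> cbox 0 1) (\<lambda>(x, t). blinfun_inner_left (G (x - t *\<^sub>R e)))"
        using bounded_linear.continuous_on[OF bl cG] by (simp add: case_prod_unfold)
    qed auto
    moreover have "blinfun_apply (integral (cbox 0 1) (\<lambda>\<sigma>. blinfun_inner_left (G (y - \<sigma> *\<^sub>R e)))) = (\<lambda>h. h \<bullet> H y)"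
    proof -
      have "integral {0..1} (blinfun_inner_left \<circ> (\<lambda>\<sigma>. G (y - \<sigma> *\<^sub>R e))) = blinfun_inner_left (H y)"
        unfolding H_def by (rule integral_linear[OF iG bl])
      then show ?thesis by (simp add: o_def blinfun_inner_left.rep_eq)
    qed
    ultimately show ?thesis by (simp add: gderiv_def \<psi>_def)
  qed
  moreover have "continuous_on UNIV H" unfolding H_def
    using integral_continuous_on_param[OF cG] by simp
  ultimately show "test_fn U \<psi> H" using K'c K'U z0 unfolding test_fn_def by blast
  \<comment> \<open>The fundamental theorem of calculus for the restriction of \<phi> to the segment
    from \<open>y\<close> to \<open>y - e\<close>.\<close>
  have "((\<lambda>\<sigma>. - (e \<bullet> G (y - \<sigma> *\<^sub>R e))) has_integral \<phi> (y - 1 *\<^sub>R e) - \<phi> (y - 0 *\<^sub>R e)) {0..1}"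
  proof (rule fundamental_theorem_of_calculus)
    fix \<sigma> :: real
    show "((\<lambda>\<sigma>. \<phi> (y - \<sigma> *\<^sub>R e)) has_vector_derivative - (e \<bullet> G (y - \<sigma> *\<^sub>R e))) (at \<sigma> within {0..1})"
      using has_derivative_along_line[of \<phi> y \<sigma> "-e"] G(1)[of "y - \<sigma> *\<^sub>R e"]
      by (auto intro: has_vector_derivative_at_within)
  qed simp
  from integral_unique[OF this]
  have "- integral {0..1} (\<lambda>\<sigma>. e \<bullet> G (y - \<sigma> *\<^sub>R e)) = \<phi> (y - e) - \<phi> y" by simp
  moreover have "integral {0..1} ((\<lambda>g. e \<bullet> g) \<circ> (\<lambda>\<sigma>. G (y - \<sigma> *\<^sub>R e))) = e \<bullet> H y"
    unfolding H_def by (rule integral_linear[OF iG]) (rule bounded_linear_inner_right)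
  ultimately show "e \<bullet> H y = \<phi> y - \<phi> (y - e)" by (simp add: o_def)
qed

text \<open>Testing \<open>u\<close> with the average \<psi> of \<phi> along \<open>e\<close>
  produces \<phi> times \<open>u x - u (x + e)\<close> on one side, since
  \<open>e \<bullet> H\<close> is a difference of values of \<phi>. On the other side Fubini's
  theorem moves the averaging from \<phi> to \<open>g\<close>. The fundamental lemma
  concludes.\<close>

lemma weak_diff_difference:
  assumes w: "weak_diff U e u g" and U: "open U" "convex U"
  shows "AE z in lborel. z \<in> U \<and> z + e \<in> U \<longrightarrow>
    u (z + e) - u z = (LINT \<sigma>|unit_leb. g (z + \<sigma> *\<^sub>R e))"
proof -
  interpret N: finite_measure unit_leb by (rule finite_measure_unit_leb)
  interpret pair_sigma_finite unit_leb "lborel :: (real^2) measure" ..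
  have u: "integrable lborel u" and g: "integrable lborel g"
    and test: "\<And>\<phi> G. test_fn U \<phi> G \<Longrightarrow> (LINT x|lborel. (e \<bullet> G x) *\<^sub>R u x) = - (LINT x|lborel. \<phi> x *\<^sub>R g x)"
    using w unfolding weak_diff_def by blast+
  have [measurable]: "u \<in> borel_measurable borel" "g \<in> borel_measurable borel" using u g by simp_all
  \<comment> \<open>By convexity the whole segment from \<open>z\<close> to \<open>z + e\<close>
    lies in \<open>U\<close> for \<open>z\<close> in \<open>V\<close>; this is what the averaged
    test function requires.\<close>
  define V where "V = U \<inter> (\<lambda>z. z + e) -` U"
  have V: "open V" unfolding V_def using U(1)
    by (intro open_Int open_vimage) (auto intro!: continuous_intros)
  define A where "A = (\<lambda>z. LINT \<sigma>|unit_leb. g (z + \<sigma> *\<^sub>R e))"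
  have A: "integrable lborel A"
    unfolding A_def using integrable_snd[OF integrable_line_shift[OF g, of e]] by simp
  define d where "d z = u (z + e) - u z - A z" for z
  have d: "integrable lborel d" unfolding d_def
    by (intro Bochner_Integration.integrable_diff integrable_lborel_shift u A)
  have "AE z in lborel. z \<in> V \<longrightarrow> d z = 0"
  proof (rule fundamental_lemma[OF V d])
    fix \<phi> G assume t: "test_fn V \<phi> G"
    obtain K where K: "compact K" "\<And>x. x \<notin> K \<Longrightarrow> \<phi> x = 0"
      using t unfolding test_fn_def by blast
    have c\<phi>: "continuous_on UNIV \<phi>" by (rule test_fn_continuous[OF t])
    then have [measurable]: "\<phi> \<in> borel_measurable borel" by (rule borel_measurable_continuous_onI)
    obtain B where B: "\<And>x. norm (\<phi> x) \<le> B" using compact_support_bounded[OF K(1) c\<phi> K(2)] by blast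
    have mult: "integrable lborel (\<lambda>x. \<phi> (x + k) *\<^sub>R h x)" if h: "integrable lborel h" for h :: "real^2 \<Rightarrow> complex" and k
    proof (rule Bochner_Integration.integrable_bound)
      show "integrable lborel (\<lambda>x. B *\<^sub>R norm (h x))" using h by (intro integrable_scaleR_right integrable_norm)
      show "AE x in lborel. norm (\<phi> (x + k) *\<^sub>R h x) \<le> norm (B *\<^sub>R norm (h x))"
        using B by (intro AE_I2) (auto simp: abs_mult
          intro!: mult_right_mono order_trans[OF B[simplified] abs_ge_self])
    qed (use h in measurable)
    define \<psi> where "\<psi> = (\<lambda>y. integral {0..1} (\<lambda>\<sigma>. \<phi> (y - \<sigma> *\<^sub>R e)))"
    define H where "H = (\<lambda>y. integral {0..1} (\<lambda>\<sigma>. G (y - \<sigma> *\<^sub>R e)))"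
    have seg: "closed_segment z (z + e) \<subseteq> U" if "z \<in> V" for z
      using that U(2) unfolding V_def by (auto simp: closed_segment_subset)
    have tH: "test_fn U \<psi> H" "\<And>y. e \<bullet> H y = \<phi> y - \<phi> (y - e)"
      unfolding \<psi>_def H_def using averaged_test_fn[OF t seg] by auto
    have "(LINT x|lborel. (e \<bullet> H x) *\<^sub>R u x) = (LINT x|lborel. \<phi> x *\<^sub>R u x) - (LINT x|lborel. \<phi> (x - e) *\<^sub>R u x)"
      using mult[OF u, of 0] mult[OF u, of "-e"]
      by (simp add: tH scaleR_diff_left Bochner_Integration.integral_diff)
    also have "(LINT x|lborel. \<phi> (x - e) *\<^sub>R u x) = (LINT x|lborel. \<phi> x *\<^sub>R u (x + e))"
      using integral_lborel_shift[of "\<lambda>x. \<phi> (x - e) *\<^sub>R u x" e] by simp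
    finally have L: "(LINT x|lborel. (e \<bullet> H x) *\<^sub>R u x) =
      (LINT x|lborel. \<phi> x *\<^sub>R u x) - (LINT x|lborel. \<phi> x *\<^sub>R u (x + e))" .
    have i\<phi>: "integrable unit_leb (\<lambda>\<sigma>. \<phi> (y - \<sigma> *\<^sub>R e))" for y
    proof -
      have "set_integrable lborel {0..1} (\<lambda>\<sigma>. \<phi> (y - \<sigma> *\<^sub>R e))"
        by (intro borel_integrable_atLeastAtMost') (auto intro!: continuous_on_compose2[OF c\<phi>] continuous_intros)
      then show ?thesis by (simp add: integrable_restrict_space set_integrable_def)
    qed
    have int\<psi>: "\<psi> y = (LINT \<sigma>|unit_leb. \<phi> (y - \<sigma> *\<^sub>R e))" for y
      by (simp add: integral_unit_leb i\<phi> \<psi>_def)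
    have [measurable]: "(\<lambda>\<sigma>. \<sigma>) \<in> measurable unit_leb borel"
      by (rule measurable_restrict_space1) simp
    have I1: "integrable (unit_leb \<Otimes>\<^sub>M lborel) (\<lambda>(\<sigma>, y). \<phi> (y - \<sigma> *\<^sub>R e) *\<^sub>R g y)"
    proof (rule Bochner_Integration.integrable_bound)
      show "integrable (unit_leb \<Otimes>\<^sub>M lborel) (\<lambda>x. B *\<^sub>R norm (case x of (\<sigma>, y) \<Rightarrow> g (y + \<sigma> *\<^sub>R 0)))"
        by (intro integrable_scaleR_right integrable_norm integrable_line_shift g)
      show "AE x in unit_leb \<Otimes>\<^sub>M lborel. norm (case x of (\<sigma>, y) \<Rightarrow> \<phi> (y - \<sigma> *\<^sub>R e) *\<^sub>R g y)
        \<le> norm (B *\<^sub>R norm (case x of (\<sigma>, y) \<Rightarrow> g (y + \<sigma> *\<^sub>R 0)))"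
        using B by (intro AE_I2) (auto simp: abs_mult
          intro!: mult_right_mono order_trans[OF B[simplified] abs_ge_self])
    qed measurable
    have I2: "integrable (unit_leb \<Otimes>\<^sub>M lborel) (\<lambda>(\<sigma>, y). \<phi> y *\<^sub>R g (y + \<sigma> *\<^sub>R e))"
    proof (rule Bochner_Integration.integrable_bound)
      show "integrable (unit_leb \<Otimes>\<^sub>M lborel) (\<lambda>x. B *\<^sub>R norm (case x of (\<sigma>, y) \<Rightarrow> g (y + \<sigma> *\<^sub>R e)))"
        by (intro integrable_scaleR_right integrable_norm integrable_line_shift g)
      show "AE x in unit_leb \<Otimes>\<^sub>M lborel. norm (case x of (\<sigma>, y) \<Rightarrow> \<phi> y *\<^sub>R g (y + \<sigma> *\<^sub>R e))
        \<le> norm (B *\<^sub>R norm (case x of (\<sigma>, y) \<Rightarrow> g (y + \<sigma> *\<^sub>R e)))"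
        using B by (intro AE_I2) (auto simp: abs_mult
          intro!: mult_right_mono order_trans[OF B[simplified] abs_ge_self])
    qed measurable
    \<comment> \<open>The averaging passes from \<phi> to \<open>g\<close>: Fubini, a translation by
      \<sigma> times \<open>e\<close>, and Fubini back.\<close>
    have "(LINT y|lborel. \<psi> y *\<^sub>R g y) = (LINT y|lborel. LINT \<sigma>|unit_leb. \<phi> (y - \<sigma> *\<^sub>R e) *\<^sub>R g y)"
      unfolding int\<psi> by (simp add: i\<phi>)
    also have "\<dots> = (LINT \<sigma>|unit_leb. LINT y|lborel. \<phi> (y - \<sigma> *\<^sub>R e) *\<^sub>R g y)"
      by (rule Fubini_integral[OF I1])
    also have "\<dots> = (LINT \<sigma>|unit_leb. LINT y|lborel. \<phi> y *\<^sub>R g (y + \<sigma> *\<^sub>R e))"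
    proof (rule Bochner_Integration.integral_cong[OF refl])
      fix \<sigma> show "(LINT y|lborel. \<phi> (y - \<sigma> *\<^sub>R e) *\<^sub>R g y) = (LINT y|lborel. \<phi> y *\<^sub>R g (y + \<sigma> *\<^sub>R e))"
        using integral_lborel_shift[of "\<lambda>x. \<phi> (x - \<sigma> *\<^sub>R e) *\<^sub>R g x" "\<sigma> *\<^sub>R e"] by simp
    qed
    also have "\<dots> = (LINT y|lborel. LINT \<sigma>|unit_leb. \<phi> y *\<^sub>R g (y + \<sigma> *\<^sub>R e))"
      by (rule Fubini_integral[OF I2, symmetric])
    also have "\<dots> = (LINT y|lborel. \<phi> y *\<^sub>R A y)" unfolding A_def by simp
    finally have R: "(LINT y|lborel. \<psi> y *\<^sub>R g y) = (LINT y|lborel. \<phi> y *\<^sub>R A y)" .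
    have "(LINT x|lborel. \<phi> x *\<^sub>R d x) =
      (LINT x|lborel. \<phi> x *\<^sub>R u (x + e)) - (LINT x|lborel. \<phi> x *\<^sub>R u x) - (LINT x|lborel. \<phi> x *\<^sub>R A x)"
      using mult[OF u, of 0] mult[OF A, of 0] mult[OF integrable_lborel_shift[OF u, of e], of 0]
      by (simp add: d_def scaleR_diff_right Bochner_Integration.integral_diff)
    also have "\<dots> = 0" using test[OF tH(1)] unfolding L R by (simp add: algebra_simps)
    finally show "(LINT x|lborel. \<phi> x *\<^sub>R d x) = 0" .
  qed
  then show ?thesis by eventually_elim (auto simp: V_def d_def A_def)
qed


section \<open>Integrals over thin strips\<close>

abbreviation esq :: "complex \<Rightarrow> ennreal" where
  "esq z \<equiv> ennreal ((cmod z)\<^sup>2)"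

text \<open>Cauchy-Schwarz against the constant 1. If \<open>f\<close> is not integrable, its
  Bochner integral is 0 by convention and the bound is trivial.\<close>

lemma norm_integral_sq_le:
  fixes f :: "'a \<Rightarrow> 'b::{banach, second_countable_topology}"
  assumes [measurable]: "f \<in> borel_measurable M"
  shows "ennreal ((norm (integral\<^sup>L M f))\<^sup>2) \<le> emeasure M (space M) * (\<integral>\<^sup>+x. ennreal ((norm (f x))\<^sup>2) \<partial>M)"
proof -
  have "ennreal (norm (integral\<^sup>L M f)) \<le> (\<integral>\<^sup>+x. ennreal (norm (f x)) \<partial>M)"
    by (cases "integrable M f") (auto simp: integral_norm_bound_ennreal not_integrable_integral_eq)
  then have "(ennreal (norm (integral\<^sup>L M f)))\<^sup>2 \<le> (\<integral>\<^sup>+x. ennreal (norm (f x)) * 1 \<partial>M)\<^sup>2"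
    by (simp add: power_mono)
  also have "\<dots> \<le> (\<integral>\<^sup>+x. (ennreal (norm (f x)))\<^sup>2 \<partial>M) * (\<integral>\<^sup>+x. 1\<^sup>2 \<partial>M)"
    by (rule Cauchy_Schwarz_nn_integral) auto
  finally show ?thesis by (simp add: ennreal_power mult.commute)
qed

lemma emeasure_small_diameter:
  fixes A :: "real set"
  assumes "A \<in> sets borel" "0 \<le> d" "\<And>s t. s \<in> A \<Longrightarrow> t \<in> A \<Longrightarrow> \<bar>s - t\<bar> \<le> d"
  shows "emeasure lborel A \<le> ennreal (2 * d)"
proof (cases "A = {}")
  case False
  then obtain s where s: "s \<in> A" by blast
  have "A \<subseteq> {s - d..s + d}" using assms(3)[OF s] by (force simp: abs_le_iff)
  then have "emeasure lborel A \<le> emeasure lborel {s - d..s + d}" by (rule emeasure_mono) simp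
  also have "\<dots> = ennreal (2 * d)" using assms(2) by simp
  finally show ?thesis .
qed simp

lemma weak_diff_scale:
  assumes "weak_diff U e u g"
  shows "weak_diff U (\<tau> *\<^sub>R e) u (\<lambda>x. \<tau> *\<^sub>R g x)"
proof -
  have "(LINT x|lborel. (\<tau> *\<^sub>R e \<bullet> G x) *\<^sub>R u x) = - (LINT x|lborel. \<phi> x *\<^sub>R \<tau> *\<^sub>R g x)"
    if "test_fn U \<phi> G" for \<phi> G
  proof -
    have "(LINT x|lborel. (\<tau> *\<^sub>R e \<bullet> G x) *\<^sub>R u x) = (LINT x|lborel. \<tau> *\<^sub>R (e \<bullet> G x) *\<^sub>R u x)" by simp
    also have "\<dots> = \<tau> *\<^sub>R (LINT x|lborel. (e \<bullet> G x) *\<^sub>R u x)" by (rule integral_scaleR_right)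
    also have "\<dots> = - (\<tau> *\<^sub>R (LINT x|lborel. \<phi> x *\<^sub>R g x))" using assms that by (simp add: weak_diff_def)
    also have "\<dots> = - (LINT x|lborel. \<tau> *\<^sub>R \<phi> x *\<^sub>R g x)" by (simp only: integral_scaleR_right)
    finally show ?thesis by (simp add: mult.commute)
  qed
  then show ?thesis using assms by (auto simp: weak_diff_def)
qed

text \<open>The difference formula in direction \<tau> e has derivative \<tau> g, whence the factor
  \<tau> squared after Cauchy-Schwarz on the unit interval; the two factors 2 come from the square
  of a sum.\<close>

lemma weak_diff_sq_bound:
  assumes w: "weak_diff U e u g" and U: "open U" "convex U"
  shows "AE z in lborel. z \<in> U \<and> z + \<tau> *\<^sub>R e \<in> U \<longrightarrow>
    esq (u z) \<le> 2 * esq (u (z + \<tau> *\<^sub>R e)) +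
      2 * (ennreal (\<tau>\<^sup>2) * (\<integral>\<^sup>+\<sigma>. esq (g (z + (\<sigma> * \<tau>) *\<^sub>R e)) \<partial>unit_leb))"
proof -
  have "integrable lborel g" using w unfolding weak_diff_def by blast
  then have [measurable]: "g \<in> borel_measurable borel" by simp
  have [measurable]: "(\<lambda>\<sigma>. \<sigma>) \<in> measurable unit_leb borel"
    by (rule measurable_restrict_space1) simp
  show ?thesis
    using weak_diff_difference[OF weak_diff_scale[OF w, of \<tau>] U]
  proof eventually_elim
    case (elim z)
    show ?case
    proof
      assume z: "z \<in> U \<and> z + \<tau> *\<^sub>R e \<in> U"
      define I where "I = (LINT \<sigma>|unit_leb. \<tau> *\<^sub>R g (z + \<sigma> *\<^sub>R \<tau> *\<^sub>R e))"
      have "u z = u (z + \<tau> *\<^sub>R e) - I" using elim z by (simp add: I_def algebra_simps)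
      then have "cmod (u z) \<le> cmod (u (z + \<tau> *\<^sub>R e)) + cmod I" by (metis norm_triangle_ineq4)
      then have "(cmod (u z))\<^sup>2 \<le> (cmod (u (z + \<tau> *\<^sub>R e)) + cmod I)\<^sup>2" by (rule power_mono) simp
      also have "\<dots> \<le> 2 * (cmod (u (z + \<tau> *\<^sub>R e)))\<^sup>2 + 2 * (cmod I)\<^sup>2"
        using sum_squares_bound[of "cmod (u (z + \<tau> *\<^sub>R e))" "cmod I"] by (simp add: power2_sum)
      finally have "esq (u z) \<le> ennreal (2 * (cmod (u (z + \<tau> *\<^sub>R e)))\<^sup>2 + 2 * (cmod I)\<^sup>2)"
        by (rule ennreal_leI)
      also have "\<dots> = 2 * esq (u (z + \<tau> *\<^sub>R e)) + 2 * esq I"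
        by (simp add: ennreal_plus ennreal_mult)
      also have "esq I \<le> emeasure unit_leb (space unit_leb) *
          (\<integral>\<^sup>+\<sigma>. esq (\<tau> *\<^sub>R g (z + \<sigma> *\<^sub>R \<tau> *\<^sub>R e)) \<partial>unit_leb)"
        unfolding I_def by (rule norm_integral_sq_le) measurable
      also have "emeasure unit_leb (space unit_leb) = 1" by (simp add: emeasure_restrict_space)
      also have "(\<integral>\<^sup>+\<sigma>. esq (\<tau> *\<^sub>R g (z + \<sigma> *\<^sub>R \<tau> *\<^sub>R e)) \<partial>unit_leb) =
          (\<integral>\<^sup>+\<sigma>. ennreal (\<tau>\<^sup>2) * esq (g (z + (\<sigma> * \<tau>) *\<^sub>R e)) \<partial>unit_leb)"
        by (simp add: power_mult_distrib ennreal_mult)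
      also have "\<dots> = ennreal (\<tau>\<^sup>2) * (\<integral>\<^sup>+\<sigma>. esq (g (z + (\<sigma> * \<tau>) *\<^sub>R e)) \<partial>unit_leb)"
        by (rule nn_integral_cmult) measurable
      finally show "esq (u z) \<le> 2 * esq (u (z + \<tau> *\<^sub>R e)) +
        2 * (ennreal (\<tau>\<^sup>2) * (\<integral>\<^sup>+\<sigma>. esq (g (z + (\<sigma> * \<tau>) *\<^sub>R e)) \<partial>unit_leb))"
        by (simp add: add_left_mono mult_left_mono)
    qed
  qed
qed

text \<open>The substitution s = \<sigma> \<tau> turns the average into 1 / \<tau> times the
  integral over \<open>{0..\<tau>}\<close>. One factor \<tau> is left and is bounded by
  \<open>l\<close>, and the interval is enlarged to \<open>{0..l}\<close>, so the bound no longer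
  depends on \<tau>.\<close>

lemma line_average_le:
  fixes q :: "'a::euclidean_space \<Rightarrow> ennreal"
  assumes [measurable]: "q \<in> borel_measurable borel" and "0 \<le> \<tau>" "\<tau> \<le> l"
  shows "ennreal (\<tau>\<^sup>2) * (\<integral>\<^sup>+\<sigma>. q (z + (\<sigma> * \<tau>) *\<^sub>R e) \<partial>unit_leb)
    \<le> ennreal l * (\<integral>\<^sup>+s. indicator {0..l} s * q (z + s *\<^sub>R e) \<partial>lborel)"
proof (cases "\<tau> = 0")
  case False
  then have t: "\<tau> > 0" using assms by simp
  have "(\<integral>\<^sup>+s. indicator {0..\<tau>} s * q (z + s *\<^sub>R e) \<partial>lborel)
    = ennreal \<tau> * (\<integral>\<^sup>+\<sigma>. indicator {0..\<tau>} (\<tau> * \<sigma>) * q (z + (\<tau> * \<sigma>) *\<^sub>R e) \<partial>lborel)"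
    using t nn_integral_real_affine[of "\<lambda>s. indicator {0..\<tau>} s * q (z + s *\<^sub>R e)" \<tau> 0] by simp
  also have "(\<integral>\<^sup>+\<sigma>. indicator {0..\<tau>} (\<tau> * \<sigma>) * q (z + (\<tau> * \<sigma>) *\<^sub>R e) \<partial>lborel)
     = (\<integral>\<^sup>+\<sigma>. q (z + (\<sigma> * \<tau>) *\<^sub>R e) \<partial>unit_leb)"
    using t by (subst nn_integral_restrict_space)
      (auto intro!: nn_integral_cong simp: indicator_def mult.commute zero_le_mult_iff mult_le_cancel_right1)
  finally have "ennreal (\<tau>\<^sup>2) * (\<integral>\<^sup>+\<sigma>. q (z + (\<sigma> * \<tau>) *\<^sub>R e) \<partial>unit_leb) =
      ennreal \<tau> * (\<integral>\<^sup>+s. indicator {0..\<tau>} s * q (z + s *\<^sub>R e) \<partial>lborel)"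
    using t by (simp add: power2_eq_square ennreal_mult mult.assoc)
  also have "\<dots> \<le> ennreal l * (\<integral>\<^sup>+s. indicator {0..l} s * q (z + s *\<^sub>R e) \<partial>lborel)"
    using assms by (intro mult_mono ennreal_leI nn_integral_mono) (auto simp: indicator_def)
  finally show ?thesis .
qed simp

lemma nn_integral_lborel_shift:
  fixes h :: "'a::euclidean_space \<Rightarrow> ennreal"
  assumes [measurable]: "h \<in> borel_measurable borel"
  shows "(\<integral>\<^sup>+y. h (y + e) \<partial>lborel) = (\<integral>\<^sup>+y. h y \<partial>lborel)"
proof -
  have "(\<integral>\<^sup>+y. h y \<partial>lborel) = (\<integral>\<^sup>+y. h y \<partial>distr lborel borel ((+) e))" by (subst lborel_distr_plus) simp
  also have "\<dots> = (\<integral>\<^sup>+y. h (e + y) \<partial>lborel)" by (rule nn_integral_distr) auto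
  finally show ?thesis by (simp add: add.commute)
qed

text \<open>Translate to \<open>y = z + \<tau> *\<^sub>R e\<close> and exchange the integrals: for
  fixed \<open>y\<close>, the parameters \<tau> that count are those for which the line through
  \<open>y\<close> runs in \<open>W\<close>, a set of measure at most \<open>c\<close>. This is
  where the thinness of \<open>W\<close> is gained.\<close>

lemma tube_integral_le:
  fixes p :: "'a::euclidean_space \<Rightarrow> ennreal"
  assumes p[measurable]: "p \<in> borel_measurable borel" and W[measurable]: "W \<in> sets borel"
    and slab: "\<And>y. emeasure lborel {\<tau> \<in> {0..l}. y - \<tau> *\<^sub>R e \<in> W} \<le> c"
  shows "(\<integral>\<^sup>+\<tau>. indicator {0..l} \<tau> * (\<integral>\<^sup>+z. indicator W z * p (z + \<tau> *\<^sub>R e) \<partial>lborel) \<partial>lborel)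
    \<le> c * (\<integral>\<^sup>+y. p y \<partial>lborel)"
proof -
  have "(\<integral>\<^sup>+z. indicator W z * p (z + \<tau> *\<^sub>R e) \<partial>lborel)
    = (\<integral>\<^sup>+y. indicator W (y - \<tau> *\<^sub>R e) * p y \<partial>lborel)" for \<tau>
    using nn_integral_lborel_shift[of "\<lambda>y. indicator W (y - \<tau> *\<^sub>R e) * p y" "\<tau> *\<^sub>R e"] by simp
  then have "(\<integral>\<^sup>+\<tau>. indicator {0..l} \<tau> * (\<integral>\<^sup>+z. indicator W z * p (z + \<tau> *\<^sub>R e) \<partial>lborel) \<partial>lborel)
    = (\<integral>\<^sup>+\<tau>. (\<integral>\<^sup>+y. indicator {0..l} \<tau> * (indicator W (y - \<tau> *\<^sub>R e) * p y) \<partial>lborel) \<partial>lborel)"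
    by (simp add: nn_integral_cmult)
  also have "\<dots> = (\<integral>\<^sup>+y. (\<integral>\<^sup>+\<tau>. indicator {0..l} \<tau> * (indicator W (y - \<tau> *\<^sub>R e) * p y) \<partial>lborel) \<partial>lborel)"
    by (rule lborel_pair.Fubini'[symmetric]) measurable
  also have "\<dots> \<le> (\<integral>\<^sup>+y. c * p y \<partial>lborel)"
  proof (rule nn_integral_mono)
    fix y
    have [measurable]: "{\<tau> \<in> {0..l}. y - \<tau> *\<^sub>R e \<in> W} \<in> sets lborel" by measurable
    have "(\<integral>\<^sup>+\<tau>. indicator {0..l} \<tau> * (indicator W (y - \<tau> *\<^sub>R e) * p y) \<partial>lborel)
      = (\<integral>\<^sup>+\<tau>. p y * indicator {\<tau> \<in> {0..l}. y - \<tau> *\<^sub>R e \<in> W} \<tau> \<partial>lborel)"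
      by (intro nn_integral_cong) (auto simp: indicator_def)
    also have "\<dots> = p y * emeasure lborel {\<tau> \<in> {0..l}. y - \<tau> *\<^sub>R e \<in> W}"
      by (rule nn_integral_cmult_indicator) measurable
    also have "\<dots> \<le> c * p y" using slab[of y] by (metis mult.commute mult_left_mono zero_le)
    finally show "(\<integral>\<^sup>+\<tau>. indicator {0..l} \<tau> * (indicator W (y - \<tau> *\<^sub>R e) * p y) \<partial>lborel) \<le> c * p y" .
  qed
  also have "\<dots> = c * (\<integral>\<^sup>+y. p y \<partial>lborel)" by (rule nn_integral_cmult) simp
  finally show ?thesis .
qed

text \<open>The assumption \<open>diff\<close> is integrated over \<open>W\<close> and then over
  \<tau> in \<open>{0..l}\<close>, which multiplies the left side by \<open>l\<close>. Both terms on
  the right become tube integrals and gain the factor \<open>c\<close>; dividing by \<open>l\<close>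
  gives the weights 2 / l and 2 l.\<close>

lemma strip_integral_le:
  fixes f q :: "'a::euclidean_space \<Rightarrow> ennreal"
  assumes f[measurable]: "f \<in> borel_measurable borel" and q[measurable]: "q \<in> borel_measurable borel"
    and W[measurable]: "W \<in> sets borel" and l: "0 < l"
    and slab: "\<And>y. emeasure lborel {\<tau> \<in> {0..l}. y - \<tau> *\<^sub>R e \<in> W} \<le> c"
    and diff: "\<And>\<tau>. 0 \<le> \<tau> \<Longrightarrow> \<tau> \<le> l \<Longrightarrow> AE z in lborel. z \<in> W \<longrightarrow> f z \<le> 2 * f (z + \<tau> *\<^sub>R e) +
        2 * (ennreal (\<tau>\<^sup>2) * (\<integral>\<^sup>+\<sigma>. q (z + (\<sigma> * \<tau>) *\<^sub>R e) \<partial>unit_leb))"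
  shows "(\<integral>\<^sup>+z. indicator W z * f z \<partial>lborel) \<le>
    c * (ennreal (2 / l) * (\<integral>\<^sup>+z. f z \<partial>lborel) + ennreal (2 * l) * (\<integral>\<^sup>+z. q z \<partial>lborel))"
proof -
  define X where "X = (\<integral>\<^sup>+z. indicator W z * f z \<partial>lborel)"
  define a where "a p \<tau> = (\<integral>\<^sup>+z. indicator W z * p (z + \<tau> *\<^sub>R e) \<partial>lborel)" for p and \<tau> :: real
  define J where "J p = (\<integral>\<^sup>+\<tau>. indicator {0..l} \<tau> * a p \<tau> \<partial>lborel)" for p
  have am[measurable]: "a p \<in> borel_measurable borel" if [measurable]: "p \<in> borel_measurable borel" for p
    unfolding a_def by measurable
  have Jle: "J p \<le> c * (\<integral>\<^sup>+y. p y \<partial>lborel)" if "p \<in> borel_measurable borel" for p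
    unfolding J_def a_def by (rule tube_integral_le[OF that W slab])
  \<comment> \<open>After \<open>line_average_le\<close> the derivative term is free of \<tau>.
    Exchanging the integrals shows that it is a tube integral of the same kind as that of
    \<open>f\<close>.\<close>
  have sw: "(\<integral>\<^sup>+z. indicator W z * (\<integral>\<^sup>+s. indicator {0..l} s * q (z + s *\<^sub>R e) \<partial>lborel) \<partial>lborel) = J q"
  proof -
    have "(\<integral>\<^sup>+z. indicator W z * (\<integral>\<^sup>+s. indicator {0..l} s * q (z + s *\<^sub>R e) \<partial>lborel) \<partial>lborel)
      = (\<integral>\<^sup>+z. (\<integral>\<^sup>+s. indicator W z * (indicator {0..l} s * q (z + s *\<^sub>R e)) \<partial>lborel) \<partial>lborel)"
      by (simp add: nn_integral_cmult)
    also have "\<dots> = (\<integral>\<^sup>+s. (\<integral>\<^sup>+z. indicator W z * (indicator {0..l} s * q (z + s *\<^sub>R e)) \<partial>lborel) \<partial>lborel)"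
      by (rule lborel_pair.Fubini') measurable
    also have "\<dots> = (\<integral>\<^sup>+s. indicator {0..l} s * a q s \<partial>lborel)"
    proof (rule nn_integral_cong)
      fix s
      have "(\<integral>\<^sup>+z. indicator W z * (indicator {0..l} s * q (z + s *\<^sub>R e)) \<partial>lborel) =
        (\<integral>\<^sup>+z. indicator {0..l} s * (indicator W z * q (z + s *\<^sub>R e)) \<partial>lborel)"
        by (simp add: mult_ac)
      then show "(\<integral>\<^sup>+z. indicator W z * (indicator {0..l} s * q (z + s *\<^sub>R e)) \<partial>lborel) = indicator {0..l} s * a q s"
        by (simp add: nn_integral_cmult a_def)
    qed
    finally show ?thesis by (simp add: J_def)
  qed
  have X: "X \<le> 2 * a f \<tau> + 2 * (ennreal l * J q)" if \<tau>: "0 \<le> \<tau>" "\<tau> \<le> l" for \<tau>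
  proof -
    have "X \<le> (\<integral>\<^sup>+z. 2 * (indicator W z * f (z + \<tau> *\<^sub>R e)) + 2 * (ennreal l * (indicator W z *
        (\<integral>\<^sup>+s. indicator {0..l} s * q (z + s *\<^sub>R e) \<partial>lborel))) \<partial>lborel)"
      unfolding X_def
    proof (rule nn_integral_mono_AE)
      show "AE z in lborel. indicator W z * f z \<le> 2 * (indicator W z * f (z + \<tau> *\<^sub>R e)) + 2 * (ennreal l * (indicator W z *
        (\<integral>\<^sup>+s. indicator {0..l} s * q (z + s *\<^sub>R e) \<partial>lborel)))"
        using diff[OF \<tau>]
      proof eventually_elim
        case (elim z)
        show ?case
        proof (cases "z \<in> W")
          case True
          then have "f z \<le> 2 * f (z + \<tau> *\<^sub>R e) +
            2 * (ennreal (\<tau>\<^sup>2) * (\<integral>\<^sup>+\<sigma>. q (z + (\<sigma> * \<tau>) *\<^sub>R e) \<partial>unit_leb))" using elim by simp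
          also have "\<dots> \<le> 2 * f (z + \<tau> *\<^sub>R e) +
            2 * (ennreal l * (\<integral>\<^sup>+s. indicator {0..l} s * q (z + s *\<^sub>R e) \<partial>lborel))"
            by (intro add_left_mono mult_left_mono line_average_le \<tau>) auto
          finally show ?thesis using True by simp
        qed simp
      qed
    qed
    also have "\<dots> = 2 * a f \<tau> + 2 * (ennreal l * J q)"
      by (simp add: nn_integral_add nn_integral_cmult a_def sw)
    finally show ?thesis .
  qed
  \<comment> \<open>Averaging over \<tau>: the left side is constant in \<tau>.\<close>
  have "ennreal l * X = (\<integral>\<^sup>+\<tau>. X * indicator {0..l} \<tau> \<partial>lborel)"
    using l by (subst nn_integral_cmult_indicator) (auto simp: mult.commute)
  also have "\<dots> \<le> (\<integral>\<^sup>+\<tau>. 2 * (indicator {0..l} \<tau> * a f \<tau>) + 2 * (ennreal l * J q) * indicator {0..l} \<tau> \<partial>lborel)"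
    using X by (intro nn_integral_mono) (auto simp: indicator_def)
  also have "\<dots> = 2 * J f + 2 * (ennreal l * J q) * ennreal l"
    using l by (simp add: nn_integral_add nn_integral_cmult nn_integral_cmult_indicator J_def)
  finally have lX: "ennreal l * X \<le> 2 * J f + 2 * (ennreal l * J q) * ennreal l" .
  have inv: "ennreal (1 / l) * ennreal l = 1" using l by (simp add: ennreal_mult[symmetric])
  have "X = ennreal (1 / l) * (ennreal l * X)" using inv by (simp add: mult.assoc[symmetric])
  also have "\<dots> \<le> ennreal (1 / l) * (2 * J f + 2 * (ennreal l * J q) * ennreal l)"
    by (rule mult_left_mono[OF lX]) simp
  also have "\<dots> = 2 * ennreal (1 / l) * J f + 2 * ennreal l * J q * (ennreal (1 / l) * ennreal l)"
    by (simp add: algebra_simps)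
  also have "\<dots> = ennreal (2 / l) * J f + ennreal (2 * l) * J q"
  proof -
    have "2 * ennreal (1 / l) = ennreal (2 / l)" "2 * ennreal l = ennreal (2 * l)"
      using l ennreal_mult[of 2 "1 / l"] ennreal_mult[of 2 l] by simp_all
    then show ?thesis by (simp add: inv)
  qed
  also have "\<dots> \<le> ennreal (2 / l) * (c * (\<integral>\<^sup>+z. f z \<partial>lborel)) + ennreal (2 * l) * (c * (\<integral>\<^sup>+z. q z \<partial>lborel))"
    by (intro add_mono mult_left_mono Jle) auto
  finally show ?thesis by (simp add: X_def algebra_simps)
qed


section \<open>The trace on a piece of a side\<close>

text \<open>Cauchy-Schwarz gives a factor M, the normalisation of the mean its inverse square; what
  remains, 1 / M, is at most 1 / m. On the way \<open>v\<close> is exchanged for its Borel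
  representative.\<close>

lemma mean_on_sq_le:
  assumes B: "open B" "B \<subseteq> \<Omega>" "B \<subseteq> U" and v: "sq_integrable \<Omega> v" and m: "0 < m" "m \<le> measure lebesgue B"
    and u[measurable]: "u \<in> borel_measurable borel" and uv: "AE x in lborel. x \<in> U \<longrightarrow> v x = u x"
  shows "esq (mean_on B v) \<le> ennreal (1 / m) * (\<integral>\<^sup>+z. indicator B z * esq (u z) \<partial>lborel)"
proof -
  define M where "M = measure lebesgue B"
  have M: "0 < M" "m \<le> M" using m by (auto simp: M_def)
  have Bs: "B \<in> sets lebesgue" "B \<in> sets borel" using B by auto
  \<comment> \<open>A set of infinite measure has \<open>measure\<close> 0, so positivity of
    \<open>M\<close> implies finiteness.\<close>
  have em: "emeasure lebesgue B = ennreal M"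
    unfolding M_def using M by (intro emeasure_eq_ennreal_measure) (auto simp: M_def measure_def)
  have "v \<in> borel_measurable (lebesgue_on B)"
    using v B(2) unfolding sq_integrable_def by (meson measurable_restrict_mono)
  from norm_integral_sq_le[OF this]
  have "esq (LINT y|lebesgue_on B. v y) \<le>
      ennreal M * (\<integral>\<^sup>+x. esq (v x) \<partial>lebesgue_on B)"
    using Bs em by (simp add: emeasure_restrict_space)
  also have "(\<integral>\<^sup>+x. esq (v x) \<partial>lebesgue_on B) = (\<integral>\<^sup>+x. esq (v x) * indicator B x \<partial>lborel)"
    using Bs by (simp add: nn_integral_restrict_space nn_integral_completion)
  also have "\<dots> = (\<integral>\<^sup>+z. indicator B z * esq (u z) \<partial>lborel)"
  proof (rule nn_integral_cong_AE)
    show "AE x in lborel. esq (v x) * indicator B x = indicator B x * esq (u x)"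
      using uv by eventually_elim (use B(3) in \<open>auto simp: indicator_def\<close>)
  qed
  finally have I: "esq (LINT y|lebesgue_on B. v y) \<le>
      ennreal M * (\<integral>\<^sup>+z. indicator B z * esq (u z) \<partial>lborel)" .
  have "esq (mean_on B v) = ennreal ((1/M)\<^sup>2) * esq (LINT y|lebesgue_on B. v y)"
    unfolding mean_on_def M_def[symmetric] using M
    by (simp add: ennreal_mult[symmetric] power_mult_distrib power_divide norm_divide)
  also have "\<dots> \<le> ennreal ((1/M)\<^sup>2) * (ennreal M * (\<integral>\<^sup>+z. indicator B z * esq (u z) \<partial>lborel))"
    by (rule mult_left_mono[OF I]) simp
  also have "\<dots> = ennreal (1 / M) * (\<integral>\<^sup>+z. indicator B z * esq (u z) \<partial>lborel)"
    using M by (simp add: mult.assoc[symmetric] ennreal_mult[symmetric] power2_eq_square)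
  also have "\<dots> \<le> ennreal (1 / m) * (\<integral>\<^sup>+z. indicator B z * esq (u z) \<partial>lborel)"
    using M m by (intro mult_right_mono ennreal_leI divide_left_mono) auto
  finally show ?thesis .
qed

text \<open>Fatou's lemma is about sequences, so the limit of the means is taken along these
  radii.\<close>

definition inv_Suc :: "nat \<Rightarrow> real" where "inv_Suc n = 1 / (real n + 1)"

lemma inv_Suc_pos: "0 < inv_Suc n" by (simp add: inv_Suc_def)

lemma inv_Suc_tendsto: "inv_Suc \<longlonglongrightarrow> 0"
  using LIMSEQ_inverse_real_of_nat by (simp add: inv_Suc_def[abs_def] inverse_eq_divide add.commute)

lemma inv_Suc_eventually: "0 < e \<Longrightarrow> \<forall>\<^sub>F n in sequentially. inv_Suc n < e"
  using order_tendstoD(2)[OF inv_Suc_tendsto] .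

text \<open>The factor is the reciprocal of the area of a disc of radius r / 2. Such a disc fits
  into a half disc of radius r, so this dominates the mean square over the part of the ball inside
  the domain.\<close>

definition ball_energy :: "(real^2) set \<Rightarrow> (real^2 \<Rightarrow> complex) \<Rightarrow> real \<Rightarrow> real^2 \<Rightarrow> ennreal" where
  "ball_energy U u r x = ennreal (4 / (pi * r\<^sup>2)) *
     (\<integral>\<^sup>+z. indicator (ball x r \<inter> U) z * esq (u z) \<partial>lborel)"

text \<open>If the means converge, the trace is also their limit along \<open>inv_Suc\<close>, and
  each mean is bounded by the ball energy; otherwise the trace is 0 by convention.\<close>

lemma bdry_trace_sq_le:
  assumes \<Omega>: "open \<Omega>" and v: "sq_integrable \<Omega> v"
    and u: "u \<in> borel_measurable borel" and uv: "AE x in lborel. x \<in> U \<longrightarrow> v x = u x"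
    and r0: "0 < r0" "\<And>r. 0 < r \<Longrightarrow> r < r0 \<Longrightarrow> ball x r \<inter> \<Omega> \<subseteq> U \<and> pi * r\<^sup>2 / 4 \<le> measure lebesgue (ball x r \<inter> \<Omega>)"
  shows "esq (bdry_trace \<Omega> v x) \<le> liminf (\<lambda>n. ball_energy U u (inv_Suc n) x)"
proof (cases "\<exists>c. ((\<lambda>r. mean_on (ball x r \<inter> \<Omega>) v) \<longlongrightarrow> c) (at_right 0)")
  case True
  then obtain c where c: "((\<lambda>r. mean_on (ball x r \<inter> \<Omega>) v) \<longlongrightarrow> c) (at_right 0)" by blast
  have tr: "bdry_trace \<Omega> v x = c"
    using c True by (simp add: bdry_trace_def tendsto_Lim)
  have "filterlim inv_Suc (at_right 0) sequentially"
    by (rule tendsto_imp_filterlim_at_right[OF inv_Suc_tendsto]) (simp add: inv_Suc_pos)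
  from filterlim_compose[OF c this]
  have "(\<lambda>n. mean_on (ball x (inv_Suc n) \<inter> \<Omega>) v) \<longlonglongrightarrow> c" .
  then have "(\<lambda>n. esq (mean_on (ball x (inv_Suc n) \<inter> \<Omega>) v)) \<longlonglongrightarrow> esq c"
    by (intro tendsto_ennrealI tendsto_power tendsto_norm)
  then have "esq c = liminf (\<lambda>n. esq (mean_on (ball x (inv_Suc n) \<inter> \<Omega>) v))"
    by (intro lim_imp_Liminf[symmetric]) auto
  also have "\<dots> \<le> liminf (\<lambda>n. ball_energy U u (inv_Suc n) x)"
  proof (rule Liminf_mono)
    show "\<forall>\<^sub>F n in sequentially. esq (mean_on (ball x (inv_Suc n) \<inter> \<Omega>) v) \<le> ball_energy U u (inv_Suc n) x"
      using inv_Suc_eventually[OF r0(1)]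
    proof eventually_elim
      case (elim n)
      define r where "r = inv_Suc n"
      have r: "0 < r" "r < r0" using elim inv_Suc_pos by (auto simp: r_def)
      have "esq (mean_on (ball x r \<inter> \<Omega>) v) \<le> ennreal (1 / (pi * r\<^sup>2 / 4)) *
          (\<integral>\<^sup>+z. indicator (ball x r \<inter> \<Omega>) z * esq (u z) \<partial>lborel)"
        using r0(2)[OF r] r by (intro mean_on_sq_le[OF _ _ _ v _ _ u uv]) (auto simp: \<Omega> open_Int)
      also have "\<dots> \<le> ball_energy U u r x"
        unfolding ball_energy_def using r0(2)[OF r]
        by (intro mult_mono nn_integral_mono) (auto simp: indicator_def)
      finally show ?case by (simp add: r_def)
    qed
  qed
  finally show ?thesis by (simp add: tr)
next
  case False
  then have "bdry_trace \<Omega> v x = 0" unfolding bdry_trace_def by (subst if_not_P) auto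
  then show ?thesis by simp
qed

definition collar :: "(real^2) set \<Rightarrow> real^2 \<Rightarrow> real^2 \<Rightarrow> real \<Rightarrow> real \<Rightarrow> real \<Rightarrow> (real^2) set" where
  "collar U a b \<alpha> \<beta> r = U \<inter> (\<Union>t\<in>{\<alpha>..\<beta>}. ball (linepath a b t) r)"

lemma open_collar: "open U \<Longrightarrow> open (collar U a b \<alpha> \<beta> r)"
  unfolding collar_def by auto

lemma measurable_linepath_dist [measurable]:
  "(\<lambda>(t, z). dist (linepath a b t) z) \<in> borel_measurable (borel \<Otimes>\<^sub>M (borel :: (real^2) measure))"
  unfolding linepath_def by measurable

lemma ball_energy_measurable:
  assumes [measurable]: "u \<in> borel_measurable borel" "U \<in> sets borel"
  shows "(\<lambda>t. ball_energy U u r (linepath a b t)) \<in> borel_measurable borel"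
proof -
  have [measurable]: "Measurable.pred (borel \<Otimes>\<^sub>M borel) (\<lambda>(t, z::real^2). dist (linepath a b t) z < r)"
    by measurable
  have "(\<lambda>(t, z). indicator (ball (linepath a b t) r \<inter> U) z * esq (u z))
     = (\<lambda>(t, z). (if dist (linepath a b t) z < r then 1 else 0) * (indicator U z * esq (u z)))"
    by (auto simp: fun_eq_iff indicator_def)
  also have "\<dots> \<in> borel_measurable (borel \<Otimes>\<^sub>M lborel)" by measurable
  finally have [measurable]: "(\<lambda>(t, z). indicator (ball (linepath a b t) r \<inter> U) z * esq (u z))
    \<in> borel_measurable (borel \<Otimes>\<^sub>M lborel)" .
  show ?thesis unfolding ball_energy_def
    by (intro borel_measurable_times_ennreal borel_measurable_const lborel.borel_measurable_nn_integral) measurable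
qed

text \<open>Tonelli: a point \<open>z\<close> lies within \<open>r\<close> of
  \<open>linepath a b t\<close> only for \<open>t\<close> in a set of diameter at most 2 r /
  \<open>dist a b\<close>, hence of measure at most twice that. Multiplied by the normalisation 4 /
  (pi r^2), this leaves one factor 1 / r.\<close>

lemma ball_energy_integral_le:
  assumes u[measurable]: "u \<in> borel_measurable borel" and U: "open U" and r: "0 < r" and ab: "a \<noteq> b"
  shows "(\<integral>\<^sup>+t. indicator {\<alpha>..\<beta>} t * ball_energy U u r (linepath a b t) \<partial>lborel) \<le>
    ennreal (16 / (pi * r * dist a b)) *
      (\<integral>\<^sup>+z. indicator (collar U a b \<alpha> \<beta> r) z * esq (u z) \<partial>lborel)"
proof -
  have L: "dist a b > 0" using ab by simp
  have [measurable]: "U \<in> sets borel" "collar U a b \<alpha> \<beta> r \<in> sets borel" using U open_collar[OF U] by auto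
  have [measurable]: "Measurable.pred (borel \<Otimes>\<^sub>M borel) (\<lambda>(t, z::real^2). dist (linepath a b t) z < r)"
    by measurable
  define F where "F t z = (if t \<in> {\<alpha>..\<beta>} \<and> dist (linepath a b t) z < r then 1 else 0) *
    (indicator U z * esq (u z))" for t z
  have F[measurable]: "(\<lambda>(t, z). F t z) \<in> borel_measurable (lborel \<Otimes>\<^sub>M lborel)"
    unfolding F_def by measurable
  have "indicator {\<alpha>..\<beta>} t * ball_energy U u r (linepath a b t) = ennreal (4 / (pi * r\<^sup>2)) * (\<integral>\<^sup>+z. F t z \<partial>lborel)" for t
  proof -
    have "ball (linepath a b t) r \<inter> U \<in> sets borel" by simp
    then have [measurable]: "(\<lambda>z. indicator (ball (linepath a b t) r \<inter> U) z * esq (u z)) \<in> borel_measurable lborel"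
      by measurable
    have "indicator {\<alpha>..\<beta>} t * (\<integral>\<^sup>+z. indicator (ball (linepath a b t) r \<inter> U) z * esq (u z) \<partial>lborel)
      = (\<integral>\<^sup>+z. indicator {\<alpha>..\<beta>} t * (indicator (ball (linepath a b t) r \<inter> U) z * esq (u z)) \<partial>lborel)"
      by (rule nn_integral_cmult[symmetric]) measurable
    also have "\<dots> = (\<integral>\<^sup>+z. F t z \<partial>lborel)"
      by (intro nn_integral_cong) (auto simp: F_def indicator_def)
    finally show ?thesis unfolding ball_energy_def by (subst mult.left_commute) simp
  qed
  then have L1: "(\<integral>\<^sup>+t. indicator {\<alpha>..\<beta>} t * ball_energy U u r (linepath a b t) \<partial>lborel) =
     ennreal (4 / (pi * r\<^sup>2)) * (\<integral>\<^sup>+t. (\<integral>\<^sup>+z. F t z \<partial>lborel) \<partial>lborel)"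
    by (simp add: nn_integral_cmult)
  have "(\<integral>\<^sup>+t. (\<integral>\<^sup>+z. F t z \<partial>lborel) \<partial>lborel) = (\<integral>\<^sup>+z. (\<integral>\<^sup>+t. F t z \<partial>lborel) \<partial>lborel)"
    by (rule lborel_pair.Fubini'[symmetric]) measurable
  also have "\<dots> \<le> (\<integral>\<^sup>+z. ennreal (4 * r / dist a b) * (indicator (collar U a b \<alpha> \<beta> r) z * esq (u z)) \<partial>lborel)"
  proof (rule nn_integral_mono)
    fix z
    define A where "A = {t \<in> {\<alpha>..\<beta>}. dist (linepath a b t) z < r}"
    have [measurable]: "A \<in> sets borel" unfolding A_def by measurable
    have "emeasure lborel A \<le> ennreal (2 * (2 * r / dist a b))"
    proof (rule emeasure_small_diameter)
      fix s t assume "s \<in> A" "t \<in> A"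
      then have "dist (linepath a b s) (linepath a b t) \<le> 2 * r"
        unfolding A_def using dist_triangle2[of "linepath a b s" "linepath a b t" z] by auto
      moreover have "linepath a b s - linepath a b t = (t - s) *\<^sub>R (a - b)"
        by (simp add: linepath_def algebra_simps)
      then have "dist (linepath a b s) (linepath a b t) = \<bar>s - t\<bar> * dist a b"
        by (simp add: dist_norm abs_minus_commute)
      ultimately show "\<bar>s - t\<bar> \<le> 2 * r / dist a b" using L by (simp add: field_simps)
    qed (use r L in auto)
    moreover have "(\<integral>\<^sup>+t. F t z \<partial>lborel) = (indicator U z * esq (u z)) * emeasure lborel A"
    proof -
      have "(\<integral>\<^sup>+t. F t z \<partial>lborel) = (\<integral>\<^sup>+t. (indicator U z * esq (u z)) * indicator A t \<partial>lborel)"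
        by (intro nn_integral_cong) (auto simp: F_def A_def)
      then show ?thesis by (simp add: nn_integral_cmult_indicator)
    qed
    moreover have "A = {}" if "z \<in> U" "z \<notin> collar U a b \<alpha> \<beta> r" using that by (auto simp: A_def collar_def)
    ultimately show "(\<integral>\<^sup>+t. F t z \<partial>lborel) \<le> ennreal (4 * r / dist a b) * (indicator (collar U a b \<alpha> \<beta> r) z * esq (u z))"
      by (cases "z \<in> U"; cases "z \<in> collar U a b \<alpha> \<beta> r")
        (auto simp: mult.commute[of "ennreal (4 * r / dist a b)"] intro!: mult_left_mono)
  qed
  also have "\<dots> = ennreal (4 * r / dist a b) * (\<integral>\<^sup>+z. (indicator (collar U a b \<alpha> \<beta> r) z * esq (u z)) \<partial>lborel)"
    by (rule nn_integral_cmult) measurable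
  finally have "(\<integral>\<^sup>+t. indicator {\<alpha>..\<beta>} t * ball_energy U u r (linepath a b t) \<partial>lborel) \<le>
      ennreal (4 / (pi * r\<^sup>2)) * (ennreal (4 * r / dist a b) *
        (\<integral>\<^sup>+z. (indicator (collar U a b \<alpha> \<beta> r) z * esq (u z)) \<partial>lborel))"
    unfolding L1 by (rule mult_left_mono) simp
  moreover have "ennreal (4 / (pi * r\<^sup>2)) * ennreal (4 * r / dist a b) = ennreal (16 / (pi * r * dist a b))"
    using r L by (subst ennreal_mult[symmetric]) (auto simp: power2_eq_square)
  ultimately show ?thesis by (simp only: mult.assoc[symmetric])
qed

text \<open>
  Fatou's lemma moves the estimate from the boundary to shrinking collars inside \<open>U\<close>; there \<open>v\<close> is
  compared with its translates along \<open>e\<close>, a direction transversal to the side.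
\<close>
lemma trace_piece_le:
  fixes a b n e :: "real^2"
  assumes \<Omega>: "open \<Omega>" and v: "sq_integrable \<Omega> v" and U: "open U" "convex U"
    and w: "weak_diff U e u g" and uv: "AE x in lborel. x \<in> U \<longrightarrow> v x = u x"
    and ab: "a \<noteq> b" and l: "0 < l" "l \<le> 1" and \<rho>: "0 < \<rho>" "\<rho> \<le> n \<bullet> e"
    and n: "norm n = 1" "n \<bullet> (b - a) = 0" "\<And>z. z \<in> U \<Longrightarrow> n \<bullet> (z - a) > 0"
    and r1: "0 < r1" "\<And>z \<tau>. z \<in> collar U a b \<alpha> \<beta> r1 \<Longrightarrow> 0 \<le> \<tau> \<Longrightarrow> \<tau> \<le> 1 \<Longrightarrow> z + \<tau> *\<^sub>R e \<in> U"
    and ball: "\<And>t. \<alpha> < t \<Longrightarrow> t < \<beta> \<Longrightarrow> \<exists>r0>0. \<forall>r. 0 < r \<and> r < r0 \<longrightarrow> ball (linepath a b t) r \<inter> \<Omega> \<subseteq> U \<and>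
       pi * r\<^sup>2 / 4 \<le> measure lebesgue (ball (linepath a b t) r \<inter> \<Omega>)"
  shows "(\<integral>\<^sup>+t. indicator {\<alpha>..\<beta>} t * ennreal ((cmod (bdry_trace \<Omega> v (linepath a b t)))\<^sup>2 * dist a b) \<partial>lborel)
    \<le> ennreal (32 / (pi * \<rho>)) * (ennreal (2 / l) * (\<integral>\<^sup>+z. esq (u z) \<partial>lborel) +
        ennreal (2 * l) * (\<integral>\<^sup>+z. esq (g z) \<partial>lborel))"
proof -
  have L: "dist a b > 0" using ab by simp
  have "integrable lborel u" "integrable lborel g" using w unfolding weak_diff_def by blast+
  then have [measurable]: "u \<in> borel_measurable borel" "g \<in> borel_measurable borel" by simp_all
  have [measurable]: "U \<in> sets borel" using U by auto
  define R where "R = ennreal (2 / l) * (\<integral>\<^sup>+z. esq (u z) \<partial>lborel) +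
        ennreal (2 * l) * (\<integral>\<^sup>+z. esq (g z) \<partial>lborel)"
  have collar: "(\<integral>\<^sup>+z. indicator (collar U a b \<alpha> \<beta> r) z * esq (u z) \<partial>lborel) \<le> ennreal (2 * (r / \<rho>)) * R"
    if r: "0 < r" "r < r1" for r
    unfolding R_def
  proof (rule strip_integral_le[where e=e])
    have sub: "collar U a b \<alpha> \<beta> r \<subseteq> collar U a b \<alpha> \<beta> r1" using r by (force simp: collar_def)
    show Wm[measurable]: "collar U a b \<alpha> \<beta> r \<in> sets borel" using open_collar[OF U(1)] by auto
    have slab: "0 < n \<bullet> (z - a) \<and> n \<bullet> (z - a) < r" if zc: "z \<in> collar U a b \<alpha> \<beta> r" for z
    proof -
      obtain t where t: "z \<in> U" "dist (linepath a b t) z < r" using zc by (auto simp: collar_def)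
      have "z - a = (z - linepath a b t) + t *\<^sub>R (b - a)" by (simp add: linepath_def algebra_simps)
      then have "n \<bullet> (z - a) = n \<bullet> (z - linepath a b t) + t * (n \<bullet> (b - a))"
        by (metis inner_add_right inner_scaleR_right)
      also have "\<dots> \<le> norm n * norm (z - linepath a b t)" using n(2) norm_cauchy_schwarz by simp
      also have "\<dots> < r" using t n by (simp add: dist_norm norm_minus_commute)
      finally show ?thesis using n(3)[OF t(1)] by simp
    qed
    \<comment> \<open>The collar lies in a slab of width \<open>r\<close> above the side, and motion
      along \<open>e\<close> crosses it with normal speed at least \<rho>.\<close>
    show "emeasure lborel {\<tau> \<in> {0..l}. y - \<tau> *\<^sub>R e \<in> collar U a b \<alpha> \<beta> r} \<le> ennreal (2 * (r / \<rho>))" for y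
    proof (rule emeasure_small_diameter)
      fix s t assume st: "s \<in> {\<tau> \<in> {0..l}. y - \<tau> *\<^sub>R e \<in> collar U a b \<alpha> \<beta> r}"
        "t \<in> {\<tau> \<in> {0..l}. y - \<tau> *\<^sub>R e \<in> collar U a b \<alpha> \<beta> r}"
      then have "\<bar>n \<bullet> (y - s *\<^sub>R e - a) - n \<bullet> (y - t *\<^sub>R e - a)\<bar> < r"
        using slab[of "y - s *\<^sub>R e"] slab[of "y - t *\<^sub>R e"] by auto
      also have "n \<bullet> (y - s *\<^sub>R e - a) - n \<bullet> (y - t *\<^sub>R e - a) = (t - s) * (n \<bullet> e)"
        by (simp add: inner_diff_right algebra_simps)
      finally have "\<bar>s - t\<bar> * (n \<bullet> e) < r" using \<rho> by (simp add: abs_mult abs_minus_commute)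
      moreover have "\<bar>s - t\<bar> * \<rho> \<le> \<bar>s - t\<bar> * (n \<bullet> e)" using \<rho> by (intro mult_left_mono) auto
      ultimately show "\<bar>s - t\<bar> \<le> r / \<rho>" using \<rho> by (simp add: field_simps)
    next
      show "{\<tau> \<in> {0..l}. y - \<tau> *\<^sub>R e \<in> collar U a b \<alpha> \<beta> r} \<in> sets borel" by measurable
    qed (use r \<rho> in auto)
    show "AE z in lborel. z \<in> collar U a b \<alpha> \<beta> r \<longrightarrow>
          esq (u z) \<le> 2 * esq (u (z + \<tau> *\<^sub>R e)) +
          2 * (ennreal (\<tau>\<^sup>2) * (\<integral>\<^sup>+\<sigma>. esq (g (z + (\<sigma> * \<tau>) *\<^sub>R e)) \<partial>unit_leb))"
      if "0 \<le> \<tau>" "\<tau> \<le> l" for \<tau>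
      using weak_diff_sq_bound[OF w U, of \<tau>]
    proof eventually_elim
      case (elim z)
      show ?case
      proof
        assume z: "z \<in> collar U a b \<alpha> \<beta> r"
        then have "z \<in> U" by (simp add: collar_def)
        moreover have "z + \<tau> *\<^sub>R e \<in> U" using r1(2)[of z \<tau>] z sub that l by auto
        ultimately have "z \<in> U" "z + \<tau> *\<^sub>R e \<in> U" by auto
        then show "esq (u z) \<le> 2 * esq (u (z + \<tau> *\<^sub>R e)) +
          2 * (ennreal (\<tau>\<^sup>2) * (\<integral>\<^sup>+\<sigma>. esq (g (z + (\<sigma> * \<tau>) *\<^sub>R e)) \<partial>unit_leb))"
          using elim by blast
      qed
    qed
  qed (use l in measurable)
  define E where "E k t = indicator {\<alpha>..\<beta>} t * ball_energy U u (inv_Suc k) (linepath a b t)" for k t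
  have [measurable]: "E k \<in> borel_measurable lborel" for k
    unfolding E_def using ball_energy_measurable[of u U] by measurable
  \<comment> \<open>The width of the collar cancels the remaining 1 / r, so the bound is uniform in
    \<open>k\<close>.\<close>
  have Ele: "(\<integral>\<^sup>+t. E k t \<partial>lborel) \<le> ennreal (32 / (pi * \<rho> * dist a b)) * R" if k: "inv_Suc k < r1" for k
  proof -
    have r: "0 < inv_Suc k" by (rule inv_Suc_pos)
    have "(\<integral>\<^sup>+t. E k t \<partial>lborel) \<le> ennreal (16 / (pi * inv_Suc k * dist a b)) * (ennreal (2 * (inv_Suc k / \<rho>)) * R)"
      unfolding E_def using U ab r
      by (intro order_trans[OF ball_energy_integral_le mult_left_mono[OF collar[OF r k]]]) auto
    also have "\<dots> = ennreal (16 / (pi * inv_Suc k * dist a b) * (2 * (inv_Suc k / \<rho>))) * R"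
      using r L \<rho> by (subst ennreal_mult) (simp_all add: mult.assoc)
    also have "16 / (pi * inv_Suc k * dist a b) * (2 * (inv_Suc k / \<rho>)) = 32 / (pi * \<rho> * dist a b)"
      using r L \<rho> by (simp add: field_simps)
    finally show ?thesis .
  qed
  \<comment> \<open>The trace itself may fail to be measurable. It is replaced here, by
    monotonicity, with a measurable majorant before Fatou's lemma is applied; the end points, where
    \<open>ball\<close> says nothing, form a null set.\<close>
  have "(\<integral>\<^sup>+t. indicator {\<alpha>..\<beta>} t * ennreal ((cmod (bdry_trace \<Omega> v (linepath a b t)))\<^sup>2 * dist a b) \<partial>lborel)
    \<le> (\<integral>\<^sup>+t. ennreal (dist a b) * liminf (\<lambda>k. E k t) \<partial>lborel)"
  proof (rule nn_integral_mono_AE)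
    have "AE t in lborel. t \<noteq> \<alpha>" "AE t in lborel. t \<noteq> \<beta>" by (rule AE_lborel_singleton)+
    then show "AE t in lborel. indicator {\<alpha>..\<beta>} t * ennreal ((cmod (bdry_trace \<Omega> v (linepath a b t)))\<^sup>2 * dist a b)
      \<le> ennreal (dist a b) * liminf (\<lambda>k. E k t)"
    proof eventually_elim
      case (elim t)
      show ?case
      proof (cases "t \<in> {\<alpha>..\<beta>}")
        case True
        then obtain r0 where "r0 > 0" "\<And>r. 0 < r \<Longrightarrow> r < r0 \<Longrightarrow> ball (linepath a b t) r \<inter> \<Omega> \<subseteq> U \<and>
          pi * r\<^sup>2 / 4 \<le> measure lebesgue (ball (linepath a b t) r \<inter> \<Omega>)"
          using ball[of t] elim by fastforce
        from bdry_trace_sq_le[OF \<Omega> v _ uv this]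
        have "esq (bdry_trace \<Omega> v (linepath a b t)) \<le> liminf (\<lambda>k. E k t)"
          using True by (simp add: E_def)
        then have "ennreal (dist a b) * esq (bdry_trace \<Omega> v (linepath a b t)) \<le> ennreal (dist a b) * liminf (\<lambda>k. E k t)"
          by (rule mult_left_mono) simp
        then show ?thesis using True by (simp add: ennreal_mult mult.commute)
      qed simp
    qed
  qed
  also have "\<dots> = ennreal (dist a b) * (\<integral>\<^sup>+t. liminf (\<lambda>k. E k t) \<partial>lborel)"
    by (rule nn_integral_cmult) measurable
  also have "(\<integral>\<^sup>+t. liminf (\<lambda>k. E k t) \<partial>lborel) \<le> liminf (\<lambda>k. \<integral>\<^sup>+t. E k t \<partial>lborel)"
    by (rule nn_integral_liminf) measurable
  also have "\<dots> \<le> liminf (\<lambda>k. ennreal (32 / (pi * \<rho> * dist a b)) * R)"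
    by (intro Liminf_mono eventually_mono[OF inv_Suc_eventually[OF r1(1)]] Ele)
  also have "\<dots> = ennreal (32 / (pi * \<rho> * dist a b)) * R"
    by (rule Liminf_const) simp
  also have "ennreal (dist a b) * \<dots> = ennreal (32 / (pi * \<rho>)) * R"
    using L \<rho> by (simp add: mult.assoc[symmetric] ennreal_mult[symmetric])
  finally show ?thesis by (simp add: R_def mult_left_mono)
qed


section \<open>The geometry of a polygon near a side\<close>

lemma ex_unit_normal:
  fixes d :: "real^2"
  obtains n where "norm n = 1" "n \<bullet> d = 0"
proof (cases "d = 0")
  case True
  then show ?thesis using that[of "axis 1 1"] by simp
next
  case False
  define p :: "real^2" where "p = vector [- (d $ 2), d $ 1]"
  have "p \<bullet> d = 0" by (simp add: p_def inner_vec_def sum_2)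
  moreover have "p \<noteq> 0" using False by (auto simp: p_def vec_eq_iff forall_2)
  ultimately show ?thesis using that[of "p /\<^sub>R norm p"] by simp
qed

lemma plane_decomposition:
  fixes n d y :: "real^2"
  assumes n: "norm n = 1" "n \<bullet> d = 0" and d: "d \<noteq> 0"
  shows "y = ((y \<bullet> d) / (d \<bullet> d)) *\<^sub>R d + (n \<bullet> y) *\<^sub>R n"
proof -
  have n2: "n $ 1 * n $ 1 + n $ 2 * n $ 2 = 1"
    using n(1) by (simp add: norm_eq_sqrt_inner inner_vec_def sum_2)
  have nd: "n $ 1 * d $ 1 + n $ 2 * d $ 2 = 0" using n(2) by (simp add: inner_vec_def sum_2)
  have dd: "d $ 1 * d $ 1 + d $ 2 * d $ 2 \<noteq> 0"
    using d by (auto simp: vec_eq_iff forall_2 sum_squares_eq_zero_iff)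
  \<comment> \<open>The cross product of \<open>n\<close> and \<open>d\<close>; since
    \<open>n\<close> is a unit vector orthogonal to \<open>d\<close>, \<open>d\<close> is
    \<open>k\<close> times \<open>n\<close> rotated by a right angle.\<close>
  define k where "k = n $ 1 * d $ 2 - n $ 2 * d $ 1"
  have d1: "d $ 1 = - k * n $ 2" "d $ 2 = k * n $ 1"
    unfolding k_def using n2 nd by algebra+
  have k: "k \<noteq> 0" using dd d1 by auto
  have "d $ 1 * d $ 1 + d $ 2 * d $ 2 = k * k" using d1 n2 by algebra
  then have c: "(y \<bullet> d) / (d \<bullet> d) * k = - (y $ 1) * n $ 2 + y $ 2 * n $ 1"
    using k d1 by (simp add: inner_vec_def sum_2 field_simps)
  define c0 where "c0 = (y \<bullet> d) / (d \<bullet> d)"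
  have c0k: "c0 * k = y $ 2 * n $ 1 - y $ 1 * n $ 2" using c[folded c0_def] by simp
  have "c0 * d $ 1 = - (c0 * k) * n $ 2" "c0 * d $ 2 = (c0 * k) * n $ 1" by (simp_all add: d1)
  then have cd: "c0 * d $ 1 = - (y $ 2 * n $ 1 - y $ 1 * n $ 2) * n $ 2"
    "c0 * d $ 2 = (y $ 2 * n $ 1 - y $ 1 * n $ 2) * n $ 1" unfolding c0k .
  have "y $ 1 = c0 * d $ 1 + (n $ 1 * y $ 1 + n $ 2 * y $ 2) * n $ 1"
    "y $ 2 = c0 * d $ 2 + (n $ 1 * y $ 1 + n $ 2 * y $ 2) * n $ 2"
  proof -
    have "y $ 1 = y $ 1 * (n $ 1 * n $ 1 + n $ 2 * n $ 2)" "y $ 2 = y $ 2 * (n $ 1 * n $ 1 + n $ 2 * n $ 2)"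
      by (simp_all add: n2)
    then show "y $ 1 = c0 * d $ 1 + (n $ 1 * y $ 1 + n $ 2 * y $ 2) * n $ 1"
      "y $ 2 = c0 * d $ 2 + (n $ 1 * y $ 1 + n $ 2 * y $ 2) * n $ 2"
      unfolding cd by (simp_all add: algebra_simps)
  qed
  then show ?thesis unfolding c0_def[symmetric] by (simp add: vec_eq_iff forall_2 inner_vec_def sum_2)
qed

text \<open>The parameter is any real number: here and below \<open>linepath a b\<close> also
  parametrizes the line beyond the segment.\<close>

lemma on_line:
  fixes n a b y :: "real^2"
  assumes "norm n = 1" "n \<bullet> (b - a) = 0" "a \<noteq> b" "n \<bullet> (y - a) = 0"
  obtains s where "y = linepath a b s"
proof -
  have "y - a = (((y - a) \<bullet> (b - a)) / ((b - a) \<bullet> (b - a))) *\<^sub>R (b - a)"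
    using plane_decomposition[OF assms(1,2), of "y - a"] assms(3,4) by simp
  then have "y = linepath a b (((y - a) \<bullet> (b - a)) / ((b - a) \<bullet> (b - a)))"
    by (simp add: linepath_def algebra_simps)
  then show ?thesis using that by blast
qed

lemma linepath_diff: "linepath a b s - linepath a b t = (s - t) *\<^sub>R (b - a)"
  by (simp add: linepath_def algebra_simps)

lemma linepath_diff_start: "linepath a b s - a = s *\<^sub>R (b - a)"
  by (simp add: linepath_def algebra_simps)

lemma linepath_in_open_segment:
  assumes "s < m" "m < t" "a \<noteq> b"
  shows "linepath a b m \<in> open_segment (linepath a b s) (linepath a b t)"
    "linepath a b m \<in> open_segment (linepath a b t) (linepath a b s)"
proof -
  define u where "u = (m - s) / (t - s)"
  have u: "0 < u" "u < 1" using assms by (auto simp: u_def)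
  have "linepath a b t - linepath a b s \<noteq> 0" using assms by (simp add: linepath_diff)
  moreover have "linepath a b m = (1 - u) *\<^sub>R linepath a b s + u *\<^sub>R linepath a b t"
  proof -
    have "linepath a b m = linepath a b s + (m - s) *\<^sub>R (b - a)" by (simp add: linepath_def algebra_simps)
    also have "m - s = u * (t - s)" using assms by (simp add: u_def)
    also have "linepath a b s + (u * (t - s)) *\<^sub>R (b - a) = (1 - u) *\<^sub>R linepath a b s + u *\<^sub>R linepath a b t"
      by (simp add: linepath_def algebra_simps)
    finally show ?thesis .
  qed
  ultimately show "linepath a b m \<in> open_segment (linepath a b s) (linepath a b t)"
    using u by (auto simp: in_segment)
  then show "linepath a b m \<in> open_segment (linepath a b t) (linepath a b s)"
    by (simp add: open_segment_commute)
qed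

lemma side_in_frontier:
  assumes "polygonal_domain \<Omega> S" "(a, b) \<in> S" "0 \<le> t" "t \<le> 1"
  shows "linepath a b t \<in> frontier \<Omega>"
proof -
  have "linepath a b t \<in> closed_segment a b"
    using assms by (auto simp: in_segment linepath_def)
  then show ?thesis using assms unfolding polygonal_domain_def by fastforce
qed

lemma polygonal_sides_disjoint:
  assumes "polygonal_domain \<Omega> S" "(a, b) \<in> S" "(c, d) \<in> S" "(c, d) \<noteq> (a, b)"
  shows "open_segment a b \<inter> closed_segment c d = {}"
proof -
  have "\<forall>(a, b)\<in>S. \<forall>(c, d)\<in>S. (a, b) \<noteq> (c, d) \<longrightarrow> open_segment a b \<inter> closed_segment c d = {}"
    using assms(1) unfolding polygonal_domain_def by (elim conjE)
  from bspec[OF bspec[OF this assms(2), unfolded prod.case] assms(3), unfolded prod.case]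
  show ?thesis using assms(4) by metis
qed

lemma frontier_disjoint_open: "open S \<Longrightarrow> x \<in> frontier S \<Longrightarrow> x \<notin> S"
  by (simp add: frontier_def interior_open)

text \<open>\<open>U\<close> cannot meet the line of the side. A common point would lie beyond the
  side, whose points are in the frontier of \<Omega>; the midpoint of the piece would then lie
  strictly between a point of \<open>U\<close> and a point of its closure, hence in
  \<open>U\<close>. So the convex set \<open>U\<close> stays on one side of the line, and the sign
  of \<open>n\<close> is chosen accordingly.\<close>

lemma side_normal:
  assumes P: "polygonal_domain \<Omega> S" "(a, b) \<in> S"
    and U: "open U" "convex U" "U \<subseteq> \<Omega>"
    and \<alpha>: "0 \<le> \<alpha>" "\<alpha> < \<beta>" "\<beta> \<le> 1" and cl: "\<And>t. \<alpha> \<le> t \<Longrightarrow> t \<le> \<beta> \<Longrightarrow> linepath a b t \<in> closure U"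
  obtains n where "norm n = 1" "n \<bullet> (b - a) = 0" "\<And>z. z \<in> U \<Longrightarrow> n \<bullet> (z - a) > 0"
proof -
  have \<Omega>: "open \<Omega>" and ab: "a \<noteq> b" using P unfolding polygonal_domain_def by auto
  obtain n where n: "norm n = 1" "n \<bullet> (b - a) = 0" using ex_unit_normal by blast
  have nz: "n \<bullet> (z - a) \<noteq> 0" if z: "z \<in> U" for z
  proof
    assume "n \<bullet> (z - a) = 0"
    then obtain s where s: "z = linepath a b s" using on_line[OF n ab] by blast
    define m where "m = (\<alpha> + \<beta>) / 2"
    have m: "\<alpha> < m" "m < \<beta>" using \<alpha> by (auto simp: m_def)
    have mf: "linepath a b m \<in> frontier \<Omega>" using m \<alpha> by (intro side_in_frontier[OF P]) auto
    have "s < 0 \<or> s > 1"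
      using side_in_frontier[OF P, of s] frontier_disjoint_open[OF \<Omega>] z U(3) s by fastforce
    then have "linepath a b m \<in> open_segment z (linepath a b \<beta>) \<or> linepath a b m \<in> open_segment z (linepath a b \<alpha>)"
      using linepath_in_open_segment(1)[of s m \<beta> a b] linepath_in_open_segment(2)[of \<alpha> m s a b] m \<alpha> ab s by auto
    then have "linepath a b m \<in> U"
      using in_interior_closure_convex_segment[OF U(2), of z "linepath a b \<beta>"]
        in_interior_closure_convex_segment[OF U(2), of z "linepath a b \<alpha>"] z U(1) cl \<alpha>
      by (auto simp: interior_open)
    then show False using mf frontier_disjoint_open[OF \<Omega>] U by blast
  qed
  have same: False if "z1 \<in> U" "z2 \<in> U" "n \<bullet> (z1 - a) > 0" "n \<bullet> (z2 - a) < 0" for z1 z2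
  proof -
    define p q where "p = n \<bullet> (z1 - a)" and "q = - (n \<bullet> (z2 - a))"
    have pq: "p > 0" "q > 0" using that by (auto simp: p_def q_def)
    \<comment> \<open>The weights are chosen to make the normal coordinates \<open>p\<close> and
      \<open>- q\<close> cancel.\<close>
    define z where "z = (q / (p + q)) *\<^sub>R z1 + (p / (p + q)) *\<^sub>R z2"
    have "q / (p + q) + p / (p + q) = 1" using pq by (simp add: add_divide_distrib[symmetric] add.commute)
    then have "z \<in> U" unfolding z_def using that pq U(2) by (intro convexD) auto
    have "z - a = (q / (p + q)) *\<^sub>R (z1 - a) + (p / (p + q)) *\<^sub>R (z2 - a)"
    proof -
      have a: "(q / (p + q)) *\<^sub>R a + (p / (p + q)) *\<^sub>R a = a"
        using \<open>q / (p + q) + p / (p + q) = 1\<close> by (simp flip: scaleR_add_left)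
      have "(q / (p + q)) *\<^sub>R (z1 - a) + (p / (p + q)) *\<^sub>R (z2 - a) =
          z - ((q / (p + q)) *\<^sub>R a + (p / (p + q)) *\<^sub>R a)"
        unfolding z_def scaleR_diff_right by simp
      then show ?thesis unfolding a by simp
    qed
    then have "n \<bullet> (z - a) = (q / (p + q)) * (n \<bullet> (z1 - a)) + (p / (p + q)) * (n \<bullet> (z2 - a))"
      by (simp only: inner_add_right inner_scaleR_right)
    moreover have "n \<bullet> (z1 - a) = p" "n \<bullet> (z2 - a) = - q" by (simp_all add: p_def q_def)
    ultimately have "n \<bullet> (z - a) = (q / (p + q)) * p + (p / (p + q)) * (- q)" by (simp only:)
    then have "n \<bullet> (z - a) = 0" by simp
    then show False using nz \<open>z \<in> U\<close> by blast
  qed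
  show ?thesis
  proof (cases "\<exists>z\<in>U. n \<bullet> (z - a) < 0")
    case True
    then obtain z2 where z2: "z2 \<in> U" "n \<bullet> (z2 - a) < 0" by blast
    have "(- n) \<bullet> (z - a) > 0" if "z \<in> U" for z
      using same[OF that z2(1) _ z2(2)] nz[OF that] by (cases "n \<bullet> (z - a) > 0") auto
    moreover have "norm (- n) = 1" "(- n) \<bullet> (b - a) = 0" using n by simp_all
    ultimately show ?thesis using that by blast
  next
    case False
    then have "n \<bullet> (z - a) > 0" if "z \<in> U" for z using nz[OF that] that by force
    then show ?thesis using that n by blast
  qed
qed

text \<open>A point \<open>y\<close> just above the side lies on the segment from \<open>x0\<close>
  in \<open>U\<close> to a point \<open>p\<close> of the line. If \<open>y\<close> is close to
  \<open>linepath a b t\<close>, then \<open>p\<close> belongs to the piece, hence to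
  \<open>closure U\<close>, and the open part of the segment is in \<open>U\<close> by
  convexity.\<close>

lemma half_disc_subset:
  fixes n a b x0 :: "real^2"
  assumes U: "open U" "convex U" and ab: "a \<noteq> b" and n: "norm n = 1" "n \<bullet> (b - a) = 0"
    and cl: "\<And>t. \<alpha> \<le> t \<Longrightarrow> t \<le> \<beta> \<Longrightarrow> linepath a b t \<in> closure U"
    and x0: "x0 \<in> U" "n \<bullet> (x0 - a) > 0" and t: "\<alpha> < t" "t < \<beta>"
  obtains r where "r > 0" "\<And>y. dist (linepath a b t) y < r \<Longrightarrow> n \<bullet> (y - a) > 0 \<Longrightarrow> y \<in> U"
proof -
  define x where "x = linepath a b t"
  define H where "H = n \<bullet> (x0 - a)"
  \<comment> \<open>Moving from \<open>y\<close> to its projection \<open>p\<close> from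
    \<open>x0\<close> enlarges the distance to \<open>x\<close> at most by this factor;
    \<open>w\<close> is the distance from \<open>x\<close> to the ends of the piece. The bound r
    \<le> H / 2 makes the relative height \<theta> less than 1/2, which accounts for the 2.\<close>
  define D where "D = 2 * (1 + norm (x0 - x) / H)"
  define w where "w = min (t - \<alpha>) (\<beta> - t) * norm (b - a)"
  have H: "H > 0" using x0 by (simp add: H_def)
  have D: "D > 0" using H unfolding D_def by (intro mult_pos_pos add_pos_nonneg) auto
  have w: "w > 0" using t ab by (simp add: w_def)
  define r where "r = min (H / 2) (w / D)"
  have r: "r > 0" "r \<le> H / 2" "r * D \<le> w" using H D w by (auto simp: r_def min_def field_simps)
  have "y \<in> U" if y: "dist x y < r" "n \<bullet> (y - a) > 0" for y
  proof -
    define \<theta> where "\<theta> = n \<bullet> (y - a) / H"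
    have "y - a = (y - x) + t *\<^sub>R (b - a)" by (simp add: x_def linepath_def algebra_simps)
    then have nya: "n \<bullet> (y - a) = n \<bullet> (y - x)" using n(2) by (metis add.right_neutral inner_add_right inner_scaleR_right mult_zero_right)
    also have "\<dots> \<le> norm n * norm (y - x)" by (rule norm_cauchy_schwarz)
    also have "\<dots> < r" using y n by (simp add: dist_norm norm_minus_commute)
    finally have yr: "n \<bullet> (y - a) < r" .
    have "r / H \<le> 1 / 2" using r(2) H by (simp add: divide_le_eq)
    moreover have "0 < \<theta>" "\<theta> < r / H"
      unfolding \<theta>_def using y(2) H yr by (simp_all add: divide_strict_right_mono)
    ultimately have \<theta>: "0 < \<theta>" "\<theta> < r / H" "\<theta> < 1 / 2" by linarith+
    \<comment> \<open>The projection of \<open>y\<close> from \<open>x0\<close> onto the line of the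
      side.\<close>
    define p where "p = (1 / (1 - \<theta>)) *\<^sub>R (y - \<theta> *\<^sub>R x0)"
    have yp: "y = p - \<theta> *\<^sub>R (p - x0)"
    proof -
      have "(1 - \<theta>) *\<^sub>R p = y - \<theta> *\<^sub>R x0" using \<theta> by (simp add: p_def)
      then show ?thesis by (simp add: algebra_simps)
    qed
    have "y - a = (1 - \<theta>) *\<^sub>R (p - a) + \<theta> *\<^sub>R (x0 - a)" by (subst yp) (simp add: algebra_simps)
    then have "n \<bullet> (y - a) = (1 - \<theta>) * (n \<bullet> (p - a)) + \<theta> * H" by (simp add: inner_add_right H_def)
    moreover have "\<theta> * H = n \<bullet> (y - a)" using H by (simp add: \<theta>_def)
    ultimately have "n \<bullet> (p - a) = 0" using \<theta> by simp
    then obtain s where s: "p = linepath a b s" using on_line[OF n ab] by blast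
    have "(1 - \<theta>) *\<^sub>R (p - x) = (y - x) - \<theta> *\<^sub>R (x0 - x)" by (subst yp) (simp add: algebra_simps)
    then have "norm ((1 - \<theta>) *\<^sub>R (p - x)) \<le> norm (y - x) + norm (\<theta> *\<^sub>R (x0 - x))"
      using norm_triangle_ineq4[of "y - x" "\<theta> *\<^sub>R (x0 - x)"] by (simp only:)
    then have "(1 - \<theta>) * norm (p - x) \<le> norm (y - x) + \<theta> * norm (x0 - x)" using \<theta> by simp
    also have "\<dots> < r + (r / H) * norm (x0 - x)"
      using y(1) \<theta>(2) by (intro add_less_le_mono mult_right_mono) (auto simp: dist_norm norm_minus_commute)
    also have "\<dots> = r * D / 2" by (simp add: D_def algebra_simps)
    finally have "(1 - \<theta>) * norm (p - x) < w / 2" using r(3) by simp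
    moreover have "1 / 2 * norm (p - x) \<le> (1 - \<theta>) * norm (p - x)" using \<theta> by (intro mult_right_mono) auto
    ultimately have "norm (p - x) < w" by simp
    then have "\<bar>s - t\<bar> * norm (b - a) < w" by (simp add: s x_def linepath_diff)
    then have "\<bar>s - t\<bar> < min (t - \<alpha>) (\<beta> - t)" using ab by (simp add: w_def)
    then have "p \<in> closure U" unfolding s by (intro cl) auto
    then have "p - \<theta> *\<^sub>R (p - x0) \<in> interior U"
      using mem_interior_closure_convex_shrink[OF U(2), of x0 p \<theta>] x0 U(1) \<theta> by (simp add: interior_open)
    then show "y \<in> U" using yp U(1) by (simp add: interior_open)
  qed
  then show ?thesis using that r(1) by (simp add: x_def)
qed

text \<open>Near an inner point of the piece no other side is present. The upper half disc is in
  \<open>U\<close>; the lower one is connected and free of frontier points, so it lies in \<Omega>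
  or misses it. The first is impossible, because then the point would be interior to
  \<open>closure \<Omega>\<close>, that is, in \<Omega>.\<close>

lemma side_half_disc:
  fixes a b n :: "real^2"
  assumes P: "polygonal_domain \<Omega> S" "(a, b) \<in> S"
    and U: "open U" "convex U" "U \<subseteq> \<Omega>" "U \<noteq> {}"
    and \<alpha>: "0 \<le> \<alpha>" "\<beta> \<le> 1" and cl: "\<And>t. \<alpha> \<le> t \<Longrightarrow> t \<le> \<beta> \<Longrightarrow> linepath a b t \<in> closure U"
    and n: "norm n = 1" "n \<bullet> (b - a) = 0" "\<And>z. z \<in> U \<Longrightarrow> n \<bullet> (z - a) > 0"
    and t: "\<alpha> < t" "t < \<beta>"
  shows "\<exists>r0>0. \<forall>r. 0 < r \<and> r < r0 \<longrightarrow> ball (linepath a b t) r \<inter> \<Omega> \<subseteq> U \<and>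
       pi * r\<^sup>2 / 4 \<le> measure lebesgue (ball (linepath a b t) r \<inter> \<Omega>)"
proof -
  have \<Omega>: "open \<Omega>" "interior (closure \<Omega>) = \<Omega>" "bounded \<Omega>" and ab: "a \<noteq> b" and fin: "finite S"
    and fr: "frontier \<Omega> = (\<Union>(a, b)\<in>S. closed_segment a b)"
    using P unfolding polygonal_domain_def by auto
  have cross: "open_segment a b \<inter> closed_segment c d = {}" if "(c, d) \<in> S" "(c, d) \<noteq> (a, b)" for c d
    by (rule polygonal_sides_disjoint[OF P that])
  define x where "x = linepath a b t"
  have t01: "0 < t" "t < 1" using t \<alpha> by auto
  have xf: "x \<in> frontier \<Omega>" unfolding x_def using t01 by (intro side_in_frontier[OF P]) auto
  have xo: "x \<in> open_segment a b"
    using linepath_in_open_segment(1)[of 0 t 1 a b] t01 ab by (simp add: x_def linepath_0' linepath_1')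
  obtain x0 where x0: "x0 \<in> U" using U by blast
  obtain r1 where r1: "r1 > 0" "\<And>y. dist x y < r1 \<Longrightarrow> n \<bullet> (y - a) > 0 \<Longrightarrow> y \<in> U"
    using half_disc_subset[OF U(1,2) ab n(1,2) cl x0 n(3)[OF x0] t] unfolding x_def by blast
  define K where "K = (\<Union>(c, d)\<in>S - {(a, b)}. closed_segment c d)"
  have "closed K" unfolding K_def using fin by (intro closed_UN) auto
  moreover have "x \<notin> K" using cross xo by (auto simp: K_def)
  ultimately obtain r2 where r2: "r2 > 0" "ball x r2 \<inter> K = {}"
    by (metis Compl_iff disjoint_eq_subset_Compl open_Compl open_contains_ball)
  define r3 where "r3 = min (t * norm (b - a)) ((1 - t) * norm (b - a))"
  have r3: "r3 > 0" using t01 ab by (simp add: r3_def)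
  have line: "y \<in> frontier \<Omega>" if y: "dist x y < r3" "n \<bullet> (y - a) = 0" for y
  proof -
    obtain s where s: "y = linepath a b s" using on_line[OF n(1,2) ab y(2)] by blast
    have "\<bar>t - s\<bar> * norm (b - a) < r3" using y(1) by (simp add: s x_def dist_norm linepath_diff)
    then have "\<bar>t - s\<bar> < min t (1 - t)" using ab by (auto simp: r3_def)
    then show ?thesis unfolding s by (intro side_in_frontier[OF P]) auto
  qed
  have nx: "n \<bullet> (x - a) = 0" by (simp add: x_def linepath_diff_start n(2))
  \<comment> \<open>Below \<open>r1\<close> the upper half disc is in \<open>U\<close>, below
    \<open>r2\<close> the other sides are out of reach, below \<open>r3\<close> the diameter of the
    disc is part of the side.\<close>
  define r0 where "r0 = min r1 (min r2 r3)"
  have r0: "r0 > 0" "r0 \<le> r1" "r0 \<le> r2" "r0 \<le> r3" using r1 r2 r3 by (auto simp: r0_def)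
  have "ball x r \<inter> \<Omega> \<subseteq> U \<and> pi * r\<^sup>2 / 4 \<le> measure lebesgue (ball x r \<inter> \<Omega>)" if r: "0 < r" "r < r0" for r
  proof
    define D where "D = ball x r \<inter> {y. n \<bullet> y < n \<bullet> a}"
    have "convex D" unfolding D_def by (intro convex_Int convex_ball convex_halfspace_lt)
    then have cD: "connected D" by (rule convex_connected)
    have Df: "D \<inter> frontier \<Omega> = {}"
    proof -
      have "y \<notin> frontier \<Omega>" if y: "y \<in> D" for y
      proof
        assume "y \<in> frontier \<Omega>"
        moreover have "y \<notin> K" using y r2 r r0 unfolding D_def by (fastforce simp: disjoint_iff)
        ultimately have "y \<in> closed_segment a b" unfolding fr K_def by auto
        then obtain u where "y = linepath a b u" by (auto simp: in_segment linepath_def)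
        then have "n \<bullet> (y - a) = 0" by (simp add: linepath_diff_start n(2))
        then show False using y by (simp add: D_def inner_diff_right)
      qed
      then show ?thesis by blast
    qed
    have D\<Omega>: "D \<inter> \<Omega> = {}"
    proof (rule ccontr)
      assume "D \<inter> \<Omega> \<noteq> {}"
      then have "D \<subseteq> \<Omega>" using connected_Int_frontier[OF cD] Df by blast
      have "ball x r \<subseteq> closure \<Omega>"
      proof
        fix y assume y: "y \<in> ball x r"
        consider "n \<bullet> (y - a) > 0" | "n \<bullet> (y - a) < 0" | "n \<bullet> (y - a) = 0" by linarith
        then show "y \<in> closure \<Omega>"
        proof cases
          case 1
          then show ?thesis using r1(2)[of y] y r r0 U(3) closure_subset by fastforce
        next
          case 2
          then have "y \<in> D" using y by (simp add: D_def inner_diff_right)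
          then show ?thesis using \<open>D \<subseteq> \<Omega>\<close> closure_subset by blast
        next
          case 3
          then show ?thesis using line[of y] y r r0 by (simp add: frontier_def)
        qed
      qed
      then have "x \<in> interior (closure \<Omega>)" using r by (meson centre_in_ball interior_maximal open_ball subsetD)
      then show False using \<Omega> xf frontier_disjoint_open by blast
    qed
    show sub: "ball x r \<inter> \<Omega> \<subseteq> U"
    proof
      fix y assume y: "y \<in> ball x r \<inter> \<Omega>"
      have "\<not> n \<bullet> (y - a) < 0" using y D\<Omega> by (auto simp: D_def inner_diff_right)
      moreover have "n \<bullet> (y - a) \<noteq> 0" using line[of y] y r r0 frontier_disjoint_open[OF \<Omega>(1)] by auto
      ultimately show "y \<in> U" using r1(2)[of y] y r r0 by auto
    qed
    \<comment> \<open>The disc over the radius in direction \<open>n\<close> fits into the upper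
      half disc; its area is the claimed lower bound.\<close>
    have "ball (x + (r / 2) *\<^sub>R n) (r / 2) \<subseteq> ball x r \<inter> \<Omega>"
    proof
      fix y assume y: "y \<in> ball (x + (r / 2) *\<^sub>R n) (r / 2)"
      define d where "d = y - (x + (r / 2) *\<^sub>R n)"
      have d: "norm d < r / 2" using y by (simp add: d_def dist_norm norm_minus_commute)
      have yx: "y - x = d + (r / 2) *\<^sub>R n" by (simp add: d_def)
      have "norm (y - x) \<le> norm d + r / 2"
        unfolding yx using norm_triangle_ineq[of d "(r / 2) *\<^sub>R n"] n r by simp
      then have 1: "dist x y < r" using d by (simp add: dist_norm norm_minus_commute)
      have "n \<bullet> (y - a) = n \<bullet> (y - x) + n \<bullet> (x - a)" by (simp add: inner_diff_right)
      also have "\<dots> = n \<bullet> d + r / 2" unfolding yx nx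
        using n(1) by (simp add: inner_add_right flip: power2_norm_eq_inner)
      finally have 2: "n \<bullet> (y - a) = n \<bullet> d + r / 2" .
      have "- (n \<bullet> d) \<le> norm n * norm d" using norm_cauchy_schwarz[of "-n" d] by simp
      then have "n \<bullet> (y - a) > 0" using 2 d n by simp
      then show "y \<in> ball x r \<inter> \<Omega>" using r1(2)[of y] 1 r r0 U(3) by auto
    qed
    then have "measure lebesgue (ball (x + (r / 2) *\<^sub>R n) (r / 2)) \<le> measure lebesgue (ball x r \<inter> \<Omega>)"
      using \<Omega> by (intro measure_mono_fmeasurable fmeasurable_Int_fmeasurable lmeasurable_ball) auto
    moreover have "measure lebesgue (ball (x + (r / 2) *\<^sub>R n) (r / 2)) = pi * (r / 2)\<^sup>2"
      using r content_ball[of "r / 2" "x + (r / 2) *\<^sub>R n"] by (simp add: unit_ball_vol_2 eval_nat_numeral)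
    ultimately show "pi * r\<^sup>2 / 4 \<le> measure lebesgue (ball x r \<inter> \<Omega>)" by (simp add: power_divide)
  qed
  then show ?thesis using r0 unfolding x_def by blast
qed

text \<open>
  Here \<open>s0 + x * s1\<close> and \<open>t0 + x * t1\<close> are the coordinates, along and normal to a side, of the
  points of another side.
\<close>
lemma flat_triangle_avoids:
  fixes s0 s1 t0 t1 :: real
  assumes side: "\<And>x. 0 \<le> x \<Longrightarrow> x \<le> 1 \<Longrightarrow> t0 + x * t1 = 0 \<Longrightarrow> s0 + x * s1 \<le> 0 \<or> s0 + x * s1 \<ge> 1"
  shows "\<exists>\<epsilon>>0. \<forall>\<eta>. 0 < \<eta> \<and> \<eta> < \<epsilon> \<longrightarrow> (\<forall>x. 0 \<le> x \<and> x \<le> 1 \<longrightarrow>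
    \<not> (0 < \<bar>t0 + x * t1\<bar> \<and> \<bar>t0 + x * t1\<bar> < \<eta> * (s0 + x * s1) \<and> \<bar>t0 + x * t1\<bar> < \<eta> * (1 - (s0 + x * s1))))"
proof -
  \<comment> \<open>If the side keeps distance \<open>c\<close> from the line, a triangle of height
    below \<open>c\<close> cannot reach it.\<close>
  have far: "\<exists>\<epsilon>>0. \<forall>\<eta>. 0 < \<eta> \<and> \<eta> < \<epsilon> \<longrightarrow> (\<forall>x. 0 \<le> x \<and> x \<le> 1 \<longrightarrow>
    \<not> (0 < \<bar>t0 + x * t1\<bar> \<and> \<bar>t0 + x * t1\<bar> < \<eta> * (s0 + x * s1) \<and> \<bar>t0 + x * t1\<bar> < \<eta> * (1 - (s0 + x * s1))))"
    if c: "c > 0" "\<And>x. 0 \<le> x \<Longrightarrow> x \<le> 1 \<Longrightarrow> c \<le> \<bar>t0 + x * t1\<bar>" for c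
  proof (intro exI[of _ c] conjI allI impI notI)
    fix \<eta> x assume \<eta>: "0 < \<eta> \<and> \<eta> < c" and x: "0 \<le> x \<and> x \<le> 1"
      and h: "0 < \<bar>t0 + x * t1\<bar> \<and> \<bar>t0 + x * t1\<bar> < \<eta> * (s0 + x * s1) \<and> \<bar>t0 + x * t1\<bar> < \<eta> * (1 - (s0 + x * s1))"
    have "0 < \<eta> * (1 - (s0 + x * s1))" using h by linarith
    then have "s0 + x * s1 < 1" using \<eta> by (simp add: zero_less_mult_iff)
    then have "\<eta> * (s0 + x * s1) \<le> \<eta> * 1" using \<eta> by (intro mult_left_mono) auto
    then show False using c(2)[of x] x h \<eta> by linarith
  qed (use c in auto)
  show ?thesis
  proof (cases "t1 = 0")
    case True
    show ?thesis
    proof (cases "t0 = 0")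
      case True
      then show ?thesis using \<open>t1 = 0\<close> by (intro exI[of _ 1]) auto
    next
      case False
      then show ?thesis using \<open>t1 = 0\<close> by (intro far[of "\<bar>t0\<bar>"]) auto
    qed
  next
    case t1: False
    define x0 where "x0 = - t0 / t1"
    have tx: "t0 + x * t1 = t1 * (x - x0)" for x using t1 by (simp add: x0_def field_simps)
    consider "x0 < 0" | "x0 > 1" | "0 \<le> x0" "x0 \<le> 1" by linarith
    then show ?thesis
    proof cases
      case 1
      show ?thesis
      proof (rule far)
        show "\<bar>t1\<bar> * (- x0) > 0" using 1 t1 by (intro mult_pos_pos) auto
        show "\<bar>t1\<bar> * (- x0) \<le> \<bar>t0 + x * t1\<bar>" if "0 \<le> x" "x \<le> 1" for x
          unfolding tx abs_mult using that by (intro mult_left_mono) auto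
      qed
    next
      case 2
      show ?thesis
      proof (rule far)
        show "\<bar>t1\<bar> * (x0 - 1) > 0" using 2 t1 by (intro mult_pos_pos) auto
        show "\<bar>t1\<bar> * (x0 - 1) \<le> \<bar>t0 + x * t1\<bar>" if "0 \<le> x" "x \<le> 1" for x
          unfolding tx abs_mult using that by (intro mult_left_mono) auto
      qed
    next
      case 3
      \<comment> \<open>The other side crosses the line at \<open>x0\<close>, outside the open base.
        Moving on by d, its height is |t1| |d| while it can enter the range of the base by at most
        |s1| |d|. Below this slope it stays outside the triangle; the 1 avoids division by
        zero.\<close>
      define \<epsilon> where "\<epsilon> = \<bar>t1\<bar> / (\<bar>s1\<bar> + 1)"
      have \<epsilon>: "\<epsilon> > 0" using t1 by (simp add: \<epsilon>_def)
      have key: "\<not> (0 < \<bar>t1 * d\<bar> \<and> \<bar>t1 * d\<bar> < \<eta> * (\<bar>d\<bar> * \<bar>s1\<bar>))" if "0 < \<eta>" "\<eta> < \<epsilon>" for d \<eta>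
      proof
        assume h: "0 < \<bar>t1 * d\<bar> \<and> \<bar>t1 * d\<bar> < \<eta> * (\<bar>d\<bar> * \<bar>s1\<bar>)"
        then have d: "\<bar>d\<bar> > 0" by auto
        from h have "\<bar>d\<bar> * \<bar>t1\<bar> < \<bar>d\<bar> * (\<eta> * \<bar>s1\<bar>)" by (simp add: abs_mult mult_ac)
        then have "\<bar>t1\<bar> < \<eta> * \<bar>s1\<bar>" using d by (simp only: mult_less_cancel_left_pos)
        moreover have "\<eta> * (\<bar>s1\<bar> + 1) < \<bar>t1\<bar>" using that by (simp add: \<epsilon>_def less_divide_eq add_nonneg_pos)
        ultimately show False using that by (simp add: algebra_simps)
      qed
      define sx where "sx = s0 + x0 * s1"
      have sx: "s0 + x * s1 = sx + (x - x0) * s1" for x by (simp add: sx_def algebra_simps)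
      have "sx \<le> 0 \<or> sx \<ge> 1" using side[of x0] 3 tx[of x0] unfolding sx_def by simp
      then show ?thesis
      proof
        assume s: "sx \<le> 0"
        show ?thesis unfolding tx sx
        proof (intro exI[of _ \<epsilon>] conjI allI impI notI \<epsilon>)
          fix \<eta> x assume \<eta>: "0 < \<eta> \<and> \<eta> < \<epsilon>" and h: "0 < \<bar>t1 * (x - x0)\<bar> \<and> \<bar>t1 * (x - x0)\<bar> < \<eta> * (sx + (x - x0) * s1) \<and>
             \<bar>t1 * (x - x0)\<bar> < \<eta> * (1 - (sx + (x - x0) * s1))"
          have "sx + (x - x0) * s1 \<le> \<bar>x - x0\<bar> * \<bar>s1\<bar>" using s abs_ge_self[of "(x - x0) * s1"] by (simp add: abs_mult)
          then have "\<eta> * (sx + (x - x0) * s1) \<le> \<eta> * (\<bar>x - x0\<bar> * \<bar>s1\<bar>)" using \<eta> by (intro mult_left_mono) auto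
          then show False using key[of \<eta> "x - x0"] \<eta> h by linarith
        qed
      next
        assume s: "sx \<ge> 1"
        show ?thesis unfolding tx sx
        proof (intro exI[of _ \<epsilon>] conjI allI impI notI \<epsilon>)
          fix \<eta> x assume \<eta>: "0 < \<eta> \<and> \<eta> < \<epsilon>" and h: "0 < \<bar>t1 * (x - x0)\<bar> \<and> \<bar>t1 * (x - x0)\<bar> < \<eta> * (sx + (x - x0) * s1) \<and>
             \<bar>t1 * (x - x0)\<bar> < \<eta> * (1 - (sx + (x - x0) * s1))"
          have "1 - (sx + (x - x0) * s1) \<le> \<bar>x - x0\<bar> * \<bar>s1\<bar>" using s abs_ge_minus_self[of "(x - x0) * s1"] by (simp add: abs_mult)
          then have "\<eta> * (1 - (sx + (x - x0) * s1)) \<le> \<eta> * (\<bar>x - x0\<bar> * \<bar>s1\<bar>)" using \<eta> by (intro mult_left_mono) auto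
          then show False using key[of \<eta> "x - x0"] \<eta> h by linarith
        qed
      qed
    qed
  qed
qed

text \<open>The affine coordinate of the orthogonal projection onto the line, 0 at \<open>a\<close>
  and 1 at \<open>b\<close>.\<close>

definition along :: "real^2 \<Rightarrow> real^2 \<Rightarrow> real^2 \<Rightarrow> real" where
  "along a b y = ((y - a) \<bullet> (b - a)) / ((b - a) \<bullet> (b - a))"

lemma along_decomposition:
  assumes "norm n = 1" "n \<bullet> (b - a) = 0" "a \<noteq> b"
  shows "y = linepath a b (along a b y) + (n \<bullet> (y - a)) *\<^sub>R n"
  using plane_decomposition[OF assms(1,2), of "y - a"] assms(3)
  by (simp add: along_def linepath_def algebra_simps)

lemma along_add:
  assumes "n \<bullet> (b - a) = 0" "a \<noteq> b"
  shows "along a b (linepath a b s + t *\<^sub>R n) = s"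
proof -
  have e: "linepath a b s + t *\<^sub>R n - a = s *\<^sub>R (b - a) + t *\<^sub>R n" by (simp add: linepath_def algebra_simps)
  show ?thesis unfolding along_def e inner_add_left inner_scaleR_left using assms by simp
qed

lemma along_linepath: "along a b (linepath c d x) = along a b c + x * (along a b d - along a b c)"
proof -
  have e: "linepath c d x - a = (1 - x) *\<^sub>R (c - a) + x *\<^sub>R (d - a)" by (simp add: linepath_def algebra_simps)
  have "((1 - x) * P + x * Q) / R = P / R + x * (Q / R - P / R)" for P Q R :: real
    by (cases "R = 0") (simp_all add: field_simps)
  then show ?thesis unfolding along_def e inner_add_left inner_scaleR_left .
qed

lemma continuous_on_along [continuous_intros]: "continuous_on A (along a b)"
  unfolding along_def divide_inverse by (intro continuous_intros)

text \<open>An open isosceles triangle over the whole base from \<open>a\<close> to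
  \<open>b\<close>, with apex at height \<eta> / 2. Its base angles tend to 0 with \<eta>, so it can
  avoid sides that meet the base at its end points.\<close>

definition flat_triangle :: "real^2 \<Rightarrow> real^2 \<Rightarrow> real^2 \<Rightarrow> real \<Rightarrow> (real^2) set" where
  "flat_triangle a b n \<eta> = {y. 0 < n \<bullet> (y - a) \<and> n \<bullet> (y - a) < \<eta> * along a b y \<and>
     n \<bullet> (y - a) < \<eta> * (1 - along a b y)}"

lemma open_flat_triangle: "open (flat_triangle a b n \<eta>)"
  unfolding flat_triangle_def
  by (intro open_Collect_conj open_Collect_less continuous_intros)

lemma convex_flat_triangle: "convex (flat_triangle a b n \<eta>)"
proof -
  have aff: "along a b (u *\<^sub>R x + v *\<^sub>R y) = u * along a b x + v * along a b y"
    "n \<bullet> (u *\<^sub>R x + v *\<^sub>R y - a) = u * (n \<bullet> (x - a)) + v * (n \<bullet> (y - a))"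
    if "u + v = 1" for u v x y
  proof -
    have "u *\<^sub>R x + v *\<^sub>R y - a = u *\<^sub>R (x - a) + v *\<^sub>R (y - a)"
      using that by (simp add: algebra_simps) (metis scaleR_add_left scaleR_one)
    then show "along a b (u *\<^sub>R x + v *\<^sub>R y) = u * along a b x + v * along a b y"
      "n \<bullet> (u *\<^sub>R x + v *\<^sub>R y - a) = u * (n \<bullet> (x - a)) + v * (n \<bullet> (y - a))"
      by (simp_all add: along_def inner_add_left inner_add_right add_divide_distrib)
  qed
  have pos: "0 < u * p + v * q" if "0 \<le> u" "0 \<le> v" "u + v = 1" "0 < p" "0 < q" for u v p q :: real
    using that by (metis add_cancel_left_left add_nonneg_pos add_pos_nonneg linorder_less_linear mult_nonneg_nonneg mult_pos_pos not_le less_le zero_neq_one)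
  show ?thesis unfolding convex_def
  proof (intro ballI allI impI)
    fix x y u v assume xy: "x \<in> flat_triangle a b n \<eta>" "y \<in> flat_triangle a b n \<eta>" and uv: "0 \<le> (u::real)" "0 \<le> (v::real)" "u + v = 1"
    have "0 < u * (n \<bullet> (x - a)) + v * (n \<bullet> (y - a))"
      "0 < u * (\<eta> * along a b x - n \<bullet> (x - a)) + v * (\<eta> * along a b y - n \<bullet> (y - a))"
      "0 < u * (\<eta> * (1 - along a b x) - n \<bullet> (x - a)) + v * (\<eta> * (1 - along a b y) - n \<bullet> (y - a))"
      using xy by (auto simp: flat_triangle_def intro!: pos uv)
    moreover have c: "1 - (u * p + v * q) = u * (1 - p) + v * (1 - q)" for p q
      using uv(3) by (simp add: algebra_simps)
    moreover have "u * (\<eta> * p - p') + v * (\<eta> * q - q') = \<eta> * (u * p + v * q) - (u * p' + v * q')"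
      "u * (\<eta> * (1 - p) - p') + v * (\<eta> * (1 - q) - q') = \<eta> * (1 - (u * p + v * q)) - (u * p' + v * q')" for p q p' q'
    proof -
      have v: "v = 1 - u" using uv(3) by linarith
      show "u * (\<eta> * p - p') + v * (\<eta> * q - q') = \<eta> * (u * p + v * q) - (u * p' + v * q')"
        "u * (\<eta> * (1 - p) - p') + v * (\<eta> * (1 - q) - q') = \<eta> * (1 - (u * p + v * q)) - (u * p' + v * q')"
        unfolding v by (simp_all add: algebra_simps)
    qed
    ultimately show "u *\<^sub>R x + v *\<^sub>R y \<in> flat_triangle a b n \<eta>"
      unfolding flat_triangle_def mem_Collect_eq aff[OF uv(3)] by (simp only: diff_gt_0_iff_gt c)
  qed
qed

lemma flat_triangle_point:
  assumes "norm n = 1" "n \<bullet> (b - a) = 0" "a \<noteq> b" "0 < t" "t < \<eta> * s" "t < \<eta> * (1 - s)"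
  shows "linepath a b s + t *\<^sub>R n \<in> flat_triangle a b n \<eta>"
proof -
  have e: "linepath a b s + t *\<^sub>R n - a = s *\<^sub>R (b - a) + t *\<^sub>R n" by (simp add: linepath_def algebra_simps)
  have "n \<bullet> n = 1" using assms(1) by (simp flip: power2_norm_eq_inner)
  then have "n \<bullet> (linepath a b s + t *\<^sub>R n - a) = t" unfolding e inner_add_right inner_scaleR_right using assms(2) by simp
  then show ?thesis using assms along_add[OF assms(2,3)] by (simp add: flat_triangle_def)
qed

lemma closure_flat_triangle:
  assumes n: "norm n = 1" "n \<bullet> (b - a) = 0" "a \<noteq> b" and \<eta>: "0 < \<eta>" and s: "0 \<le> s" "s \<le> 1"
  shows "linepath a b s \<in> closure (flat_triangle a b n \<eta>)"
proof -
  \<comment> \<open>A path that moves from the base point towards the middle while rising. At time d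
    the distances to both ends are at least d / 2 in the coordinate \<open>along\<close>, so height
    d \<eta> / 4 is below both slanted edges.\<close>
  define f where "f d = linepath a b (s + d * (1/2 - s)) + (d * \<eta> / 4) *\<^sub>R n" for d :: real
  have "(f \<longlongrightarrow> f 0) (at_right 0)"
  proof -
    have "isCont f 0" unfolding f_def linepath_def by (intro continuous_intros) auto
    then show ?thesis unfolding isCont_def by (rule tendsto_within_subset) simp
  qed
  moreover have "\<forall>\<^sub>F d in at_right 0. f d \<in> flat_triangle a b n \<eta>"
  proof -
    have "\<forall>\<^sub>F d in at_right 0. (0::real) < d \<and> d < 1"
      by (intro eventually_conj eventually_at_right_less) (auto intro: order_tendstoD)
    then show ?thesis
    proof eventually_elim
      case (elim d)
      have "d / 2 \<le> s + d * (1/2 - s)" "d / 2 \<le> 1 - (s + d * (1/2 - s))"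
        using s elim mult_nonneg_nonneg[of s "1 - d"] mult_nonneg_nonneg[of "1 - s" "1 - d"] by (auto simp: algebra_simps)
      then have "\<eta> * (d / 2) \<le> \<eta> * (s + d * (1/2 - s))" "\<eta> * (d / 2) \<le> \<eta> * (1 - (s + d * (1/2 - s)))"
        using \<eta> by (intro mult_left_mono; simp)+
      moreover have "0 < \<eta> * d" using \<eta> elim by simp
      ultimately show ?case unfolding f_def
        by (intro flat_triangle_point n) (simp_all add: algebra_simps)
    qed
  qed
  ultimately have "f 0 \<in> closure (flat_triangle a b n \<eta>)"
    by (intro Lim_in_closed_set[OF closed_closure _ trivial_limit_at_right_real])
      (auto elim!: eventually_mono intro: subsetD[OF closure_subset])
  then show ?thesis by (simp add: f_def)
qed

text \<open>Both coordinates relative to the base are affine along the other segment, and a zero of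
  the normal one with \<open>along\<close> strictly between 0 and 1 would be a common point with the
  open base. The absolute value in \<open>flat_triangle_avoids\<close> treats the triangles on both
  sides together.\<close>

lemma segment_avoids_flat_triangles:
  assumes n: "norm n = 1" "n \<bullet> (b - a) = 0" "a \<noteq> b"
    and avoid: "open_segment a b \<inter> closed_segment c d = {}"
  shows "\<forall>\<^sub>F \<eta> in at_right 0. closed_segment c d \<inter> (flat_triangle a b n \<eta> \<union> flat_triangle a b (- n) \<eta>) = {}"
proof -
  define T where "T y = n \<bullet> (y - a)" for y
  have T: "T (linepath c d x) = T c + x * (T d - T c)" for x
    by (simp add: T_def linepath_def algebra_simps inner_add_right inner_diff_right)
  have "\<exists>\<epsilon>>0. \<forall>\<eta>. 0 < \<eta> \<and> \<eta> < \<epsilon> \<longrightarrow> (\<forall>x. 0 \<le> x \<and> x \<le> 1 \<longrightarrow>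
    \<not> (0 < \<bar>T c + x * (T d - T c)\<bar> \<and> \<bar>T c + x * (T d - T c)\<bar> < \<eta> * (along a b c + x * (along a b d - along a b c)) \<and>
      \<bar>T c + x * (T d - T c)\<bar> < \<eta> * (1 - (along a b c + x * (along a b d - along a b c)))))"
  proof (rule flat_triangle_avoids, rule ccontr)
    fix x :: real
    assume x: "0 \<le> x" "x \<le> 1" "T c + x * (T d - T c) = 0"
      and "\<not> (along a b c + x * (along a b d - along a b c) \<le> 0 \<or> 1 \<le> along a b c + x * (along a b d - along a b c))"
    then have s: "0 < along a b (linepath c d x)" "along a b (linepath c d x) < 1" by (auto simp: along_linepath)
    have "linepath c d x = linepath a b (along a b (linepath c d x))"
      using along_decomposition[OF n, of "linepath c d x"] x(3) T[of x] by (simp add: T_def)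
    also have "\<dots> \<in> open_segment a b"
      using linepath_in_open_segment(1)[OF s n(3)] by (simp add: linepath_0' linepath_1')
    finally show False using avoid x linepath_in_path[of x c d] by auto
  qed
  then obtain \<epsilon> where \<epsilon>: "\<epsilon> > 0" and no: "\<And>\<eta> x. 0 < \<eta> \<Longrightarrow> \<eta> < \<epsilon> \<Longrightarrow> 0 \<le> x \<Longrightarrow> x \<le> 1 \<Longrightarrow>
    \<not> (0 < \<bar>T (linepath c d x)\<bar> \<and> \<bar>T (linepath c d x)\<bar> < \<eta> * along a b (linepath c d x) \<and>
      \<bar>T (linepath c d x)\<bar> < \<eta> * (1 - along a b (linepath c d x)))"
    unfolding T along_linepath by blast
  have "closed_segment c d \<inter> (flat_triangle a b n \<eta> \<union> flat_triangle a b (- n) \<eta>) = {}" if "0 < \<eta>" "\<eta> < \<epsilon>" for \<eta>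
  proof -
    have "y \<notin> flat_triangle a b n \<eta> \<union> flat_triangle a b (- n) \<eta>" if yc: "y \<in> closed_segment c d" for y
    proof -
      obtain x where x: "0 \<le> x" "x \<le> 1" "y = linepath c d x" using yc unfolding linepath_image_01[symmetric] by auto
      show ?thesis using no[OF \<open>0 < \<eta>\<close> \<open>\<eta> < \<epsilon>\<close> x(1,2), folded x(3)] by (auto simp: flat_triangle_def T_def)
    qed
    then show ?thesis by blast
  qed
  then show ?thesis using \<epsilon> unfolding eventually_at_right_field by blast
qed

text \<open>For small \<eta> the triangles on both sides of the base miss the frontier, so each lies
  in \<Omega> or misses it. Not both can miss \<Omega>, since the midpoint of the side is in its
  closure. The height is less than \<eta> < e, which keeps the triangle near the frontier.\<close>

lemma side_triangle:
  assumes P: "polygonal_domain \<Omega> S" "(a, b) \<in> S" and e: "e > 0"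
  obtains U where "open U" "convex U" "U \<noteq> {}" "U \<subseteq> \<Omega>"
    "\<And>t. 0 \<le> t \<Longrightarrow> t \<le> 1 \<Longrightarrow> linepath a b t \<in> closure U"
    "\<And>y. y \<in> U \<Longrightarrow> \<exists>x\<in>frontier \<Omega>. dist x y < e"
proof -
  have \<Omega>: "open \<Omega>" and ab: "a \<noteq> b" and fin: "finite S"
    and fr: "frontier \<Omega> = (\<Union>(a, b)\<in>S. closed_segment a b)"
    using P unfolding polygonal_domain_def by auto
  obtain n where n: "norm n = 1" "n \<bullet> (b - a) = 0" using ex_unit_normal by blast
  have n': "norm (- n) = 1" "(- n) \<bullet> (b - a) = 0" using n by simp_all
  have "\<forall>\<^sub>F \<eta> in at_right 0. \<forall>p\<in>S. closed_segment (fst p) (snd p) \<inter> (flat_triangle a b n \<eta> \<union> flat_triangle a b (- n) \<eta>) = {}"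
  proof (rule eventually_ball_finite[OF fin], rule ballI)
    fix p assume p: "p \<in> S"
    obtain c d where cd: "p = (c, d)" by force
    show "\<forall>\<^sub>F \<eta> in at_right 0. closed_segment (fst p) (snd p) \<inter> (flat_triangle a b n \<eta> \<union> flat_triangle a b (- n) \<eta>) = {}"
    proof (cases "p = (a, b)")
      case True
      have "y \<notin> flat_triangle a b n \<eta> \<union> flat_triangle a b (- n) \<eta>" if yc: "y \<in> closed_segment a b" for y \<eta>
      proof -
        obtain x where "y = linepath a b x" using yc unfolding linepath_image_01[symmetric] by auto
        then have "n \<bullet> (y - a) = 0" by (simp add: linepath_diff_start n(2))
        then show ?thesis by (auto simp: flat_triangle_def)
      qed
      then have "closed_segment (fst p) (snd p) \<inter> (flat_triangle a b n \<eta> \<union> flat_triangle a b (- n) \<eta>) = {}" for \<eta>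
        using True by auto
      then show ?thesis by simp
    next
      case False
      then show ?thesis
        using segment_avoids_flat_triangles[OF n ab polygonal_sides_disjoint[OF P, of c d]] p cd by simp
    qed
  qed
  moreover have "\<forall>\<^sub>F \<eta> in at_right 0. (0::real) < \<eta> \<and> \<eta> < e"
    using e by (intro eventually_conj eventually_at_right_less) (auto intro: order_tendstoD)
  ultimately have "\<forall>\<^sub>F \<eta> in at_right 0. (0 < \<eta> \<and> \<eta> < e) \<and>
    (\<forall>p\<in>S. closed_segment (fst p) (snd p) \<inter> (flat_triangle a b n \<eta> \<union> flat_triangle a b (- n) \<eta>) = {})"
    by eventually_elim auto
  from eventually_happens'[OF trivial_limit_at_right_real this]
  obtain \<eta> where \<eta>: "0 < \<eta>" "\<eta> < e"
    and av: "\<And>p. p \<in> S \<Longrightarrow> closed_segment (fst p) (snd p) \<inter> (flat_triangle a b n \<eta> \<union> flat_triangle a b (- n) \<eta>) = {}"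
    by blast
  have dis: "(flat_triangle a b n \<eta> \<union> flat_triangle a b (- n) \<eta>) \<inter> frontier \<Omega> = {}"
    unfolding fr using av by fastforce
  note thesis_intro = that
  have good: "thesis" if m: "m \<in> {n, -n}" and sub: "flat_triangle a b m \<eta> \<inter> \<Omega> \<noteq> {}" for m
  proof (rule thesis_intro)
    have m1: "norm m = 1" "m \<bullet> (b - a) = 0" using m n by auto
    have "connected (flat_triangle a b m \<eta>)" by (intro convex_connected convex_flat_triangle)
    from connected_Int_frontier[OF this sub]
    show "flat_triangle a b m \<eta> \<subseteq> \<Omega>" using dis m by blast
    show "flat_triangle a b m \<eta> \<noteq> {}" using sub by blast
    show "linepath a b t \<in> closure (flat_triangle a b m \<eta>)" if "0 \<le> t" "t \<le> 1" for t
      by (rule closure_flat_triangle[OF m1 ab \<eta>(1) that])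
    fix y assume y: "y \<in> flat_triangle a b m \<eta>"
    define s where "s = along a b y"
    have h: "0 < m \<bullet> (y - a)" "m \<bullet> (y - a) < \<eta> * s" "m \<bullet> (y - a) < \<eta> * (1 - s)"
      using y by (auto simp: flat_triangle_def s_def)
    then have "0 < \<eta> * s" "0 < \<eta> * (1 - s)" by linarith+
    then have s: "0 < s" "s < 1" using \<eta> by (auto simp: zero_less_mult_iff)
    have "y - linepath a b s = (m \<bullet> (y - a)) *\<^sub>R m" using along_decomposition[OF m1 ab, of y] unfolding s_def[symmetric] by (metis add_diff_cancel_left')
    then have "dist (linepath a b s) y = m \<bullet> (y - a)" using m1 h by (simp add: dist_norm norm_minus_commute)
    also have "\<dots> < \<eta>" using h(2) s \<eta> mult_left_le[of s \<eta>] by linarith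
    finally show "\<exists>x\<in>frontier \<Omega>. dist x y < e"
      using side_in_frontier[OF P, of s] s \<eta> by (intro bexI[of _ "linepath a b s"]) auto
  qed (use open_flat_triangle convex_flat_triangle in auto)
  show thesis
  proof (cases "flat_triangle a b n \<eta> \<inter> \<Omega> = {} \<and> flat_triangle a b (- n) \<eta> \<inter> \<Omega> = {}")
    case True
    \<comment> \<open>The two triangles together with the open base: a neighbourhood of the
      midpoint. If both triangles missed \<Omega>, a point of \<Omega> in it would lie on the base,
      hence in the frontier.\<close>
    define Q where "Q = {y. \<bar>n \<bullet> (y - a)\<bar> < \<eta> * along a b y \<and> \<bar>n \<bullet> (y - a)\<bar> < \<eta> * (1 - along a b y)}"
    have "open Q" unfolding Q_def by (intro open_Collect_conj open_Collect_less continuous_intros)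
    moreover have "linepath a b (1/2) \<in> Q"
      using along_add[OF n(2) ab, of "1/2" 0] \<eta> by (simp add: Q_def linepath_diff_start n(2))
    moreover have "linepath a b (1/2) \<in> closure \<Omega>"
      using side_in_frontier[OF P, of "1/2"] by (simp add: frontier_def)
    ultimately obtain y where y: "y \<in> Q" "y \<in> \<Omega>" by (meson closure_iff_nhds_not_empty disjoint_iff subset_refl)
    have "n \<bullet> (y - a) = 0"
    proof (rule ccontr)
      assume "n \<bullet> (y - a) \<noteq> 0"
      then have "y \<in> flat_triangle a b n \<eta> \<or> y \<in> flat_triangle a b (- n) \<eta>"
        using y(1) by (auto simp: Q_def flat_triangle_def)
      then show False using y True by blast
    qed
    with along_decomposition[OF n ab, of y] have ye: "y = linepath a b (along a b y)"
      by (metis add.right_neutral scaleR_zero_left)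
    have "0 < \<eta> * along a b y" "0 < \<eta> * (1 - along a b y)" using y(1) by (auto simp: Q_def)
    then have "0 < along a b y" "along a b y < 1" using \<eta> by (auto simp: zero_less_mult_iff)
    then have "y \<in> frontier \<Omega>" by (subst ye) (intro side_in_frontier[OF P]; simp)
    then show ?thesis using y frontier_disjoint_open[OF \<Omega>] by blast
  next
    case False
    then show ?thesis using good by blast
  qed
qed


section \<open>Borel representatives and calculus of weak derivatives\<close>

text \<open>Real and imaginary part of the function extended by zero are measurable for the
  completion and so agree almost everywhere with Borel functions. Integrability follows from c \<le>
  1 + c^2 and the boundedness of \<open>U\<close>.\<close>

lemma borel_representative:
  fixes u :: "real^2 \<Rightarrow> complex"
  assumes u: "sq_integrable U u" and U: "U \<in> sets borel" "bounded U"
  obtains u' where "integrable lborel u'" "\<And>x. x \<notin> U \<Longrightarrow> u' x = 0"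
    "AE x in lborel. x \<in> U \<longrightarrow> u x = u' x"
    "(\<integral>\<^sup>+x. esq (u' x) \<partial>lborel) = ennreal ((L2_norm U u)\<^sup>2)"
proof -
  have Ul: "U \<in> sets lebesgue" using U by auto
  have um: "u \<in> borel_measurable (lebesgue_on U)" and ui: "integrable (lebesgue_on U) (\<lambda>x. (cmod (u x))\<^sup>2)"
    using u by (auto simp: sq_integrable_def)
  define u0 where "u0 x = indicator U x *\<^sub>R u x" for x
  have u0: "u0 \<in> borel_measurable lebesgue"
    unfolding u0_def using um Ul by (subst (asm) borel_measurable_restrict_space_iff) auto
  then have "(\<lambda>x. Re (u0 x)) \<in> borel_measurable (completion lborel)" "(\<lambda>x. Im (u0 x)) \<in> borel_measurable (completion lborel)"
    by auto
  from completion_ex_borel_measurable_real[OF this(1)] completion_ex_borel_measurable_real[OF this(2)]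
  obtain r i where [measurable]: "r \<in> borel_measurable lborel" "i \<in> borel_measurable lborel"
    and r: "AE x in lborel. Re (u0 x) = r x" and i: "AE x in lborel. Im (u0 x) = i x" by blast
  have [measurable]: "U \<in> sets borel" by (rule U)
  define u' where "u' x = indicator U x *\<^sub>R Complex (r x) (i x)" for x
  have [measurable]: "u' \<in> borel_measurable borel"
  proof -
    have "(\<lambda>x. Complex (r x) (i x)) = (\<lambda>x. of_real (r x) + \<i> * of_real (i x))" by (simp add: Complex_eq)
    also have "\<dots> \<in> borel_measurable borel" by measurable
    finally show ?thesis unfolding u'_def by measurable
  qed
  have ae: "AE x in lborel. x \<in> U \<longrightarrow> u x = u' x"
    using r i by eventually_elim (auto simp: u0_def u'_def complex_eq_iff)
  have "(\<integral>\<^sup>+x. esq (u' x) \<partial>lborel) = (\<integral>\<^sup>+x. esq (u x) * indicator U x \<partial>lborel)"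
    using ae by (intro nn_integral_cong_AE, eventually_elim) (auto simp: u'_def indicator_def)
  also have "\<dots> = (\<integral>\<^sup>+x. esq (u x) \<partial>lebesgue_on U)"
    using Ul by (simp add: nn_integral_restrict_space nn_integral_completion)
  also have "\<dots> = ennreal (LINT x|lebesgue_on U. (cmod (u x))\<^sup>2)" by (rule nn_integral_eq_integral[OF ui]) simp
  also have "(LINT x|lebesgue_on U. (cmod (u x))\<^sup>2) = (L2_norm U u)\<^sup>2" by (simp add: L2_norm_def)
  finally have sq: "(\<integral>\<^sup>+x. esq (u' x) \<partial>lborel) = ennreal ((L2_norm U u)\<^sup>2)" .
  have "integrable lborel u'"
  proof (rule integrableI_bounded)
    have "(\<integral>\<^sup>+x. ennreal (cmod (u' x)) \<partial>lborel) \<le> (\<integral>\<^sup>+x. indicator U x + esq (u' x) \<partial>lborel)"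
    proof (rule nn_integral_mono)
      fix x
      have "c \<le> 1 + c\<^sup>2" for c :: real using zero_le_power2[of "c - 1/2"] by (simp add: power2_eq_square algebra_simps)
      then have "ennreal (cmod (u' x)) \<le> 1 + esq (u' x)"
        by (simp flip: ennreal_1 ennreal_plus add: ennreal_leI)
      then show "ennreal (cmod (u' x)) \<le> indicator U x + esq (u' x)"
        by (cases "x \<in> U") (auto simp: u'_def)
    qed
    also have "\<dots> = emeasure lborel U + ennreal ((L2_norm U u)\<^sup>2)"
      by (subst nn_integral_add) (simp_all add: sq)
    also have "\<dots> < \<infinity>" using emeasure_bounded_finite[OF U(2)] by (simp add: less_top)
    finally show "(\<integral>\<^sup>+x. ennreal (cmod (u' x)) \<partial>lborel) < \<infinity>" .
  qed simp
  then show ?thesis using that[of u'] ae sq by (simp add: u'_def)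
qed

lemma sq_integrable_borel:
  fixes u :: "real^2 \<Rightarrow> complex"
  assumes "u \<in> borel_measurable borel" "(\<integral>\<^sup>+x. esq (u x) \<partial>lborel) < \<infinity>" "U \<in> sets borel"
  shows "sq_integrable U u"
proof -
  have ul: "u \<in> borel_measurable lebesgue" using assms(1) by (simp add: measurable_completion)
  have U: "U \<in> sets lebesgue" using assms(3) by auto
  have "integrable lebesgue (\<lambda>x. (cmod (u x))\<^sup>2)"
    using ul assms(2) by (intro integrableI_nonneg) (auto simp: nn_integral_completion)
  from integrable_mult_indicator[OF U this] have "integrable (lebesgue_on U) (\<lambda>x. (cmod (u x))\<^sup>2)"
    using U by (simp add: integrable_restrict_space)
  then show ?thesis using ul by (simp add: sq_integrable_def measurable_restrict_space1)
qed

text \<open>As \<phi> vanishes off \<open>U\<close>, the integral extends to the plane, where the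
  representative can be substituted.\<close>

lemma integral_lebesgue_on_representative:
  fixes u :: "real^2 \<Rightarrow> complex" and \<phi> :: "real^2 \<Rightarrow> real"
  assumes u: "u \<in> borel_measurable (lebesgue_on U)" and U: "U \<in> sets borel"
    and u': "u' \<in> borel_measurable borel" and ae: "AE x in lborel. x \<in> U \<longrightarrow> u x = u' x"
    and \<phi>: "\<phi> \<in> borel_measurable borel" "\<And>x. x \<notin> U \<Longrightarrow> \<phi> x = 0"
  shows "(LINT x|lebesgue_on U. \<phi> x *\<^sub>R u x) = (LINT x|lborel. \<phi> x *\<^sub>R u' x)"
proof -
  have Ul: "U \<in> sets lebesgue" using U by auto
  have [measurable]: "u' \<in> borel_measurable lebesgue" "\<phi> \<in> borel_measurable lebesgue"
    using u' \<phi> by (simp_all add: measurable_completion)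
  have [measurable]: "(\<lambda>x. indicator U x *\<^sub>R u x) \<in> borel_measurable lebesgue"
    using u Ul by (subst (asm) borel_measurable_restrict_space_iff) auto
  have "(LINT x|lebesgue_on U. \<phi> x *\<^sub>R u x) = (LINT x|lebesgue. \<phi> x *\<^sub>R (indicator U x *\<^sub>R u x))"
    using Ul by (simp add: integral_restrict_space mult.commute)
  also have "\<dots> = (LINT x|lebesgue. \<phi> x *\<^sub>R u' x)"
  proof (rule integral_cong_AE)
    have "AE x in lborel. \<phi> x *\<^sub>R (indicator U x *\<^sub>R u x) = \<phi> x *\<^sub>R u' x"
      using ae by eventually_elim (auto simp: indicator_def \<phi>)
    then show "AE x in lebesgue. \<phi> x *\<^sub>R (indicator U x *\<^sub>R u x) = \<phi> x *\<^sub>R u' x"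
      by (simp add: AE_completion_iff)
  qed measurable
  also have "\<dots> = (LINT x|lborel. \<phi> x *\<^sub>R u' x)"
    by (rule integral_completion) (use u' \<phi> in measurable)
  finally show ?thesis .
qed

lemma test_fn_outside:
  assumes "test_fn U \<phi> G" "x \<notin> U"
  shows "\<phi> x = 0" "G x = 0"
proof -
  obtain K where K: "compact K" "K \<subseteq> U" "\<And>x. x \<notin> K \<Longrightarrow> \<phi> x = 0" using assms(1) unfolding test_fn_def by blast
  then have "x \<notin> K" using assms(2) by blast
  then show "\<phi> x = 0" "G x = 0" using K test_fn_grad_zero[OF assms(1) K(1)] by auto
qed

lemma test_fn_measurable:
  assumes "test_fn U \<phi> G"
  shows "\<phi> \<in> borel_measurable borel" "(\<lambda>x. e \<bullet> G x) \<in> borel_measurable borel"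
proof -
  show "\<phi> \<in> borel_measurable borel" by (rule borel_measurable_continuous_onI[OF test_fn_continuous[OF assms]])
  have "continuous_on UNIV G" using assms by (simp add: test_fn_def)
  then show "(\<lambda>x. e \<bullet> G x) \<in> borel_measurable borel"
    by (intro borel_measurable_continuous_onI continuous_intros)
qed

text \<open>Test functions and their gradients vanish off \<open>U\<close>, so both sides of the
  defining identity can be computed with the representatives.\<close>

lemma has_weak_deriv_iff_weak_diff:
  assumes u: "sq_integrable U u" and g: "sq_integrable U g" and U: "U \<in> sets borel"
    and u': "integrable lborel u'" "AE x in lborel. x \<in> U \<longrightarrow> u x = u' x"
    and g': "integrable lborel g'" "AE x in lborel. x \<in> U \<longrightarrow> g x = g' x"
  shows "has_weak_deriv U i u g \<longleftrightarrow> weak_diff U (axis i 1) u' g'"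
proof -
  have m: "u \<in> borel_measurable (lebesgue_on U)" "g \<in> borel_measurable (lebesgue_on U)"
    using u g by (simp_all add: sq_integrable_def)
  have m': "u' \<in> borel_measurable borel" "g' \<in> borel_measurable borel" using u' g' by simp_all
  have eq: "(LINT x|lebesgue_on U. (G x $ i) *\<^sub>R u x) = (LINT x|lborel. (axis i 1 \<bullet> G x) *\<^sub>R u' x)"
    "(LINT x|lebesgue_on U. \<phi> x *\<^sub>R g x) = (LINT x|lborel. \<phi> x *\<^sub>R g' x)" if t: "test_fn U \<phi> G" for \<phi> G
  proof -
    have ax: "axis i 1 \<bullet> G x = G x $ i" for x by (simp add: inner_axis inner_commute[of "axis i 1"])
    show "(LINT x|lebesgue_on U. (G x $ i) *\<^sub>R u x) = (LINT x|lborel. (axis i 1 \<bullet> G x) *\<^sub>R u' x)"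
      unfolding ax using test_fn_measurable(2)[OF t, of "axis i 1"] test_fn_outside[OF t]
      by (intro integral_lebesgue_on_representative[OF m(1) U m'(1) u'(2)]) (auto simp: ax)
    show "(LINT x|lebesgue_on U. \<phi> x *\<^sub>R g x) = (LINT x|lborel. \<phi> x *\<^sub>R g' x)"
      using test_fn_measurable(1)[OF t] test_fn_outside[OF t]
      by (intro integral_lebesgue_on_representative[OF m(2) U m'(2) g'(2)]) auto
  qed
  have "has_weak_deriv U i u g \<longleftrightarrow> (\<forall>\<phi> G. test_fn U \<phi> G \<longrightarrow>
     (LINT x|lebesgue_on U. (G x $ i) *\<^sub>R u x) = - (LINT x|lebesgue_on U. \<phi> x *\<^sub>R g x))"
    unfolding has_weak_deriv_def test_fn_def by blast
  then show ?thesis using u'(1) g'(1) eq by (simp add: weak_diff_def)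
qed

text \<open>Shrinks the open set and changes the representatives at once; test functions on
  \<open>V\<close> see both only inside \<open>V\<close>.\<close>

lemma weak_diff_restrict:
  assumes w: "weak_diff U e u g" and "V \<subseteq> U"
    and u': "integrable lborel u'" "AE x in lborel. x \<in> V \<longrightarrow> u' x = u x"
    and g': "integrable lborel g'" "AE x in lborel. x \<in> V \<longrightarrow> g' x = g x"
  shows "weak_diff V e u' g'"
  unfolding weak_diff_def
proof (intro conjI allI impI u' g')
  fix \<phi> G assume t: "test_fn V \<phi> G"
  have ug: "integrable lborel u" "integrable lborel g" using w unfolding weak_diff_def by blast+
  then have [measurable]: "u \<in> borel_measurable borel" "g \<in> borel_measurable borel"
    "u' \<in> borel_measurable borel" "g' \<in> borel_measurable borel" using u' g' by simp_all
  note [measurable] = test_fn_measurable[OF t]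
  have "(LINT x|lborel. (e \<bullet> G x) *\<^sub>R u' x) = (LINT x|lborel. (e \<bullet> G x) *\<^sub>R u x)"
  proof (rule integral_cong_AE)
    show "AE x in lborel. (e \<bullet> G x) *\<^sub>R u' x = (e \<bullet> G x) *\<^sub>R u x"
      using u'(2) by eventually_elim (use test_fn_outside[OF t] in force)
  qed measurable
  moreover have "(LINT x|lborel. \<phi> x *\<^sub>R g' x) = (LINT x|lborel. \<phi> x *\<^sub>R g x)"
  proof (rule integral_cong_AE)
    show "AE x in lborel. \<phi> x *\<^sub>R g' x = \<phi> x *\<^sub>R g x"
      using g'(2) by eventually_elim (use test_fn_outside[OF t] in force)
  qed measurable
  ultimately show "(LINT x|lborel. (e \<bullet> G x) *\<^sub>R u' x) = - (LINT x|lborel. \<phi> x *\<^sub>R g' x)"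
    using w test_fn_mono[OF t \<open>V \<subseteq> U\<close>] by (simp add: weak_diff_def)
qed

lemma integrable_bounded_mult:
  fixes h :: "real^2 \<Rightarrow> complex" and \<phi> :: "real^2 \<Rightarrow> real"
  assumes "integrable lborel h" "\<phi> \<in> borel_measurable borel" "\<And>x. \<bar>\<phi> x\<bar> \<le> B"
  shows "integrable lborel (\<lambda>x. \<phi> x *\<^sub>R h x)"
proof (rule Bochner_Integration.integrable_bound)
  show "integrable lborel (\<lambda>x. B *\<^sub>R norm (h x))" using assms(1) by (intro integrable_scaleR_right integrable_norm)
  show "AE x in lborel. norm (\<phi> x *\<^sub>R h x) \<le> norm (B *\<^sub>R norm (h x))"
    by (intro AE_I2) (auto simp: abs_mult intro!: mult_right_mono order_trans[OF assms(3) abs_ge_self])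
  have "h \<in> borel_measurable borel" using assms(1) by simp
  then show "(\<lambda>x. \<phi> x *\<^sub>R h x) \<in> borel_measurable lborel" using assms(2) by measurable
qed

lemma test_fn_bounded:
  assumes t: "test_fn U \<phi> G"
  obtains B where "\<And>x. \<bar>\<phi> x\<bar> \<le> B" "\<And>x. \<bar>e \<bullet> G x\<bar> \<le> B"
proof -
  obtain K where K: "compact K" "\<And>x. x \<notin> K \<Longrightarrow> \<phi> x = 0" using t unfolding test_fn_def by blast
  obtain B1 where B1: "\<And>x. norm (\<phi> x) \<le> B1"
    using compact_support_bounded[OF K(1) test_fn_continuous[OF t] K(2)] by blast
  have "continuous_on UNIV G" using t by (simp add: test_fn_def)
  then have c: "continuous_on UNIV (\<lambda>x. e \<bullet> G x)" by (intro continuous_intros)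
  obtain B2 where B2: "\<And>x. norm (e \<bullet> G x) \<le> B2"
    using compact_support_bounded[OF K(1) c] test_fn_grad_zero[OF t K(1,2)] by (metis inner_zero_right)
  show ?thesis using that[of "max B1 B2"] B1 B2 by (simp add: le_max_iff_disj)
qed

text \<open>The assumption \<open>eq\<close> is shaped to cover two uses: a sum of two functions in
  one direction, and one function in a combination of two directions.\<close>

lemma weak_diff_lincomb:
  assumes w1: "weak_diff U e1 u1 g1" and w2: "weak_diff U e2 u2 g2"
    and eq: "\<And>G x. (e \<bullet> G) *\<^sub>R u x = c1 *\<^sub>R ((e1 \<bullet> G) *\<^sub>R u1 x) + c2 *\<^sub>R ((e2 \<bullet> G) *\<^sub>R u2 x)"
    and u: "integrable lborel u"
  shows "weak_diff U e u (\<lambda>x. c1 *\<^sub>R g1 x + c2 *\<^sub>R g2 x)"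
proof -
  have i: "integrable lborel u1" "integrable lborel g1" "integrable lborel u2" "integrable lborel g2"
    using w1 w2 unfolding weak_diff_def by blast+
  have "(LINT x|lborel. (e \<bullet> G x) *\<^sub>R u x) = - (LINT x|lborel. \<phi> x *\<^sub>R (c1 *\<^sub>R g1 x + c2 *\<^sub>R g2 x))"
    if t: "test_fn U \<phi> G" for \<phi> G
  proof -
    obtain B1 where B1: "\<And>x. \<bar>\<phi> x\<bar> \<le> B1" "\<And>x. \<bar>e1 \<bullet> G x\<bar> \<le> B1" using test_fn_bounded[OF t, of e1] by blast
    obtain B2 where B2: "\<And>x. \<bar>\<phi> x\<bar> \<le> B2" "\<And>x. \<bar>e2 \<bullet> G x\<bar> \<le> B2" using test_fn_bounded[OF t, of e2] by blast
    note m = test_fn_measurable[OF t]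
    have "(LINT x|lborel. (e \<bullet> G x) *\<^sub>R u x) =
      (LINT x|lborel. c1 *\<^sub>R ((e1 \<bullet> G x) *\<^sub>R u1 x) + c2 *\<^sub>R ((e2 \<bullet> G x) *\<^sub>R u2 x))"
      by (simp only: eq)
    also have "\<dots> = c1 *\<^sub>R (LINT x|lborel. (e1 \<bullet> G x) *\<^sub>R u1 x) + c2 *\<^sub>R (LINT x|lborel. (e2 \<bullet> G x) *\<^sub>R u2 x)"
      using integrable_bounded_mult[OF i(1) m(2) B1(2)] integrable_bounded_mult[OF i(3) m(2) B2(2)]
      by (subst Bochner_Integration.integral_add) (simp_all only: integrable_scaleR_right integral_scaleR_right)
    also have "\<dots> = - (c1 *\<^sub>R (LINT x|lborel. \<phi> x *\<^sub>R g1 x) + c2 *\<^sub>R (LINT x|lborel. \<phi> x *\<^sub>R g2 x))"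
      using w1 w2 t by (simp add: weak_diff_def)
    also have "c1 *\<^sub>R (LINT x|lborel. \<phi> x *\<^sub>R g1 x) + c2 *\<^sub>R (LINT x|lborel. \<phi> x *\<^sub>R g2 x) =
      (LINT x|lborel. c1 *\<^sub>R (\<phi> x *\<^sub>R g1 x) + c2 *\<^sub>R (\<phi> x *\<^sub>R g2 x))"
      using integrable_bounded_mult[OF i(2) m(1) B1(1)] integrable_bounded_mult[OF i(4) m(1) B1(1)]
      by (subst Bochner_Integration.integral_add) (simp_all only: integrable_scaleR_right integral_scaleR_right)
    also have "(\<lambda>x. c1 *\<^sub>R (\<phi> x *\<^sub>R g1 x) + c2 *\<^sub>R (\<phi> x *\<^sub>R g2 x)) = (\<lambda>x. \<phi> x *\<^sub>R (c1 *\<^sub>R g1 x + c2 *\<^sub>R g2 x))"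
      by (simp add: fun_eq_iff scaleR_add_right mult.commute)
    finally show ?thesis .
  qed
  then show ?thesis using i u unfolding weak_diff_def by simp
qed

lemma weak_diff_add:
  assumes w: "weak_diff U e u1 g1" "weak_diff U e u2 g2"
  shows "weak_diff U e (\<lambda>x. u1 x + u2 x) (\<lambda>x. g1 x + g2 x)"
proof -
  have "integrable lborel u1" "integrable lborel u2" using w unfolding weak_diff_def by blast+
  then show ?thesis
    using weak_diff_lincomb[OF w, of e "\<lambda>x. u1 x + u2 x" 1 1] by (simp add: scaleR_add_right)
qed

lemma weak_diff_direction:
  assumes w: "weak_diff U (axis 1 1) u g1" "weak_diff U (axis 2 1) u g2"
  shows "weak_diff U e u (\<lambda>x. (e $ 1) *\<^sub>R g1 x + (e $ 2) *\<^sub>R g2 x)"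
proof (rule weak_diff_lincomb[OF w])
  show "integrable lborel u" using w unfolding weak_diff_def by blast
  have "e \<bullet> G = e $ 1 * (axis 1 1 \<bullet> G) + e $ 2 * (axis 2 1 \<bullet> G)" for G :: "real^2"
    by (simp add: inner_axis inner_commute[of "axis _ _"]) (simp add: inner_vec_def sum_2)
  then show "(e \<bullet> G) *\<^sub>R u x = (e $ 1) *\<^sub>R ((axis 1 1 \<bullet> G) *\<^sub>R u x) + (e $ 2) *\<^sub>R ((axis 2 1 \<bullet> G) *\<^sub>R u x)" for G x
    by (simp add: scaleR_add_left)
qed

text \<open>Needed to compare a derivative on \<open>U\<close> with the choices made by
  \<open>weak_deriv\<close> on single elements; the difference annihilates all test
  functions.\<close>

lemma weak_diff_unique:
  assumes w: "weak_diff U e u1 g1" "weak_diff U e u2 g2" and U: "open U"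
    and ae: "AE x in lborel. x \<in> U \<longrightarrow> u1 x = u2 x"
  shows "AE x in lborel. x \<in> U \<longrightarrow> g1 x = g2 x"
proof -
  have i: "integrable lborel u1" "integrable lborel g1" "integrable lborel u2" "integrable lborel g2"
    using w unfolding weak_diff_def by blast+
  have w2: "weak_diff U e u1 g2" by (rule weak_diff_restrict[OF w(2) subset_refl i(1) ae i(4)]) simp
  have "AE x in lborel. x \<in> U \<longrightarrow> g1 x - g2 x = 0"
  proof (rule fundamental_lemma[OF U])
    show "integrable lborel (\<lambda>x. g1 x - g2 x)" using i by simp
    fix \<phi> G assume t: "test_fn U \<phi> G"
    obtain B where B: "\<And>x. \<bar>\<phi> x\<bar> \<le> B" using test_fn_bounded[OF t] by blast
    note m = integrable_bounded_mult[OF _ test_fn_measurable(1)[OF t] B]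
    have "(LINT x|lborel. \<phi> x *\<^sub>R (g1 x - g2 x)) = (LINT x|lborel. \<phi> x *\<^sub>R g1 x) - (LINT x|lborel. \<phi> x *\<^sub>R g2 x)"
      using m[OF i(2)] m[OF i(4)] by (simp add: scaleR_diff_right)
    also have "(LINT x|lborel. \<phi> x *\<^sub>R g1 x) = - (LINT x|lborel. (e \<bullet> G x) *\<^sub>R u1 x)"
      using w(1) t by (simp add: weak_diff_def)
    also have "(LINT x|lborel. \<phi> x *\<^sub>R g2 x) = - (LINT x|lborel. (e \<bullet> G x) *\<^sub>R u1 x)"
      using w2 t by (simp add: weak_diff_def)
    also have "- (LINT x|lborel. (e \<bullet> G x) *\<^sub>R u1 x) - - (LINT x|lborel. (e \<bullet> G x) *\<^sub>R u1 x) = 0" by simp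
    finally show "(LINT x|lborel. \<phi> x *\<^sub>R (g1 x - g2 x)) = 0" .
  qed
  then show ?thesis by simp
qed


section \<open>Piecewise bilinear functions on a mesh\<close>

text \<open>
  On overlaps the first set of the list wins. A Borel function with a definite value everywhere is
  needed, because the fundamental theorem of calculus is applied on all lines, also on those
  that run inside an edge of the mesh.
\<close>
fun piecewise :: "(real^2) set list \<Rightarrow> ((real^2) set \<Rightarrow> real^2 \<Rightarrow> complex) \<Rightarrow> real^2 \<Rightarrow> complex" where
  "piecewise [] f y = 0"
| "piecewise (T # Ts) f y = (if y \<in> T then f T y else piecewise Ts f y)"

text \<open>The selected set does not depend on \<open>f\<close>, so a function and its derivative
  are read off from the same piece.\<close>

lemma piecewise_select:
  assumes "y \<in> \<Union>(set Ts)"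
  obtains T where "T \<in> set Ts" "y \<in> T" "\<And>f. piecewise Ts f y = f T y"
proof -
  have "\<exists>T\<in>set Ts. y \<in> T \<and> (\<forall>f. piecewise Ts f y = f T y)" using assms by (induction Ts) auto
  then show ?thesis using that by blast
qed

lemma piecewise_eq:
  assumes "T \<in> set Ts" "y \<in> T" "\<And>T T'. T \<in> set Ts \<Longrightarrow> T' \<in> set Ts \<Longrightarrow> y \<in> T \<Longrightarrow> y \<in> T' \<Longrightarrow> f T y = f T' y"
  shows "piecewise Ts f y = f T y"
proof -
  obtain T' where "T' \<in> set Ts" "y \<in> T'" "piecewise Ts f y = f T' y"
    using piecewise_select[of y Ts] assms(1,2) by blast
  then show ?thesis using assms by metis
qed

lemma piecewise_measurable:
  assumes "\<And>T. T \<in> set Ts \<Longrightarrow> closed T \<and> continuous_on UNIV (f T)"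
  shows "piecewise Ts f \<in> borel_measurable borel"
  using assms
proof (induction Ts)
  case (Cons T Ts)
  then have [measurable]: "piecewise Ts f \<in> borel_measurable borel" "T \<in> sets borel" "f T \<in> borel_measurable borel"
    by (auto intro: borel_measurable_continuous_onI)
  have "piecewise (T # Ts) f = (\<lambda>y. if y \<in> T then f T y else piecewise Ts f y)" by (simp add: fun_eq_iff)
  then show ?case by simp
next
  case Nil
  have "piecewise [] f = (\<lambda>_. 0)" by (simp add: fun_eq_iff)
  then show ?case by simp
qed

lemma piecewise_bounded:
  assumes "\<And>T. T \<in> set Ts \<Longrightarrow> continuous_on UNIV (f T)" "compact K"
  obtains B where "0 \<le> B" "\<And>y. y \<in> K \<Longrightarrow> cmod (piecewise Ts f y) \<le> B"
proof -
  have "\<exists>B\<ge>0. \<forall>y\<in>K. cmod (piecewise Ts f y) \<le> B" using assms(1)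
  proof (induction Ts)
    case (Cons T Ts)
    then obtain B where B: "B \<ge> 0" "\<And>y. y \<in> K \<Longrightarrow> cmod (piecewise Ts f y) \<le> B" by auto
    have "compact (f T ` K)"
      using Cons.prems[of T] assms(2) by (auto intro: compact_continuous_image continuous_on_subset)
    then obtain B' where B': "\<And>y. y \<in> K \<Longrightarrow> cmod (f T y) \<le> B'"
      using compact_imp_bounded bounded_iff by (metis imageI)
    show ?case using B B' by (intro exI[of _ "max B B'"]) (auto simp: le_max_iff_disj)
  qed auto
  then show ?thesis using that by blast
qed

lemma integrable_compact_support:
  fixes h :: "real^2 \<Rightarrow> complex"
  assumes h: "h \<in> borel_measurable borel" and K: "compact K" "\<And>x. x \<notin> K \<Longrightarrow> h x = 0" "\<And>x. x \<in> K \<Longrightarrow> cmod (h x) \<le> B"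
  shows "integrable lborel h"
proof (rule Bochner_Integration.integrable_bound)
  have "K \<in> sets lborel" "emeasure lborel K < \<infinity>"
    using K(1) emeasure_bounded_finite[OF compact_imp_bounded[OF K(1)]] by (auto simp: compact_imp_closed)
  then show "integrable lborel (\<lambda>x. indicator K x * B :: real)"
    by (intro integrable_mult_left integrable_real_indicator)
  show "AE x in lborel. cmod (h x) \<le> norm (indicator K x * B :: real)"
    using K(2,3) by (intro AE_I2) (force simp: indicator_def)
qed (use h in simp)

lemma has_vector_derivative_zero_nbhd:
  fixes h :: "real \<Rightarrow> complex"
  assumes "open W" "s \<in> W" "\<And>x. x \<in> W \<Longrightarrow> h x = 0"
  shows "(h has_vector_derivative 0) (at s)"
  by (rule has_vector_derivative_transform_within_open[where f="\<lambda>_. 0" and S=W]) (use assms in auto)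

text \<open>There are finitely many pieces. Those that do not contain \<open>x\<close> are closed
  and stay away from a neighbourhood of it; the others are continuous and take the common value at
  \<open>x\<close>.\<close>

lemma piecewise_continuous_on:
  assumes fin: "\<And>T. T \<in> set Ts \<Longrightarrow> closed T \<and> continuous_on UNIV (f T)"
    and cov: "U \<subseteq> \<Union>(set Ts)"
    and cons: "\<And>T T' y. T \<in> set Ts \<Longrightarrow> T' \<in> set Ts \<Longrightarrow> y \<in> U \<Longrightarrow> y \<in> T \<Longrightarrow> y \<in> T' \<Longrightarrow> f T y = f T' y"
  shows "continuous_on U (piecewise Ts f)"
  unfolding continuous_on_def
proof (intro ballI tendstoI)
  fix x e assume x: "x \<in> U" and e: "(0::real) < e"
  have "\<forall>\<^sub>F y in at x within U. \<forall>T\<in>set Ts. y \<in> T \<longrightarrow> dist (f T y) (piecewise Ts f x) < e"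
  proof (rule eventually_ball_finite, simp, rule ballI)
    fix T assume T: "T \<in> set Ts"
    show "\<forall>\<^sub>F y in at x within U. y \<in> T \<longrightarrow> dist (f T y) (piecewise Ts f x) < e"
    proof (cases "x \<in> T")
      case True
      have "isCont (f T) x" using fin[OF T] by (simp add: continuous_on_eq_continuous_at)
      then have "(f T \<longlongrightarrow> f T x) (at x within U)" using isCont_def tendsto_within_subset by blast
      moreover have "f T x = piecewise Ts f x" 
        by (rule piecewise_eq[OF T True, symmetric]) (rule cons[OF _ _ x])
      ultimately have "\<forall>\<^sub>F y in at x within U. dist (f T y) (piecewise Ts f x) < e" using e by (simp add: tendstoD)
      then show ?thesis by eventually_elim simp
    next
      case False
      have "open (- T)" using fin[OF T] by blast
      then have "\<forall>\<^sub>F y in at x within U. y \<in> - T" using False by (intro eventually_at_topological[THEN iffD2]) auto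
      then show ?thesis by eventually_elim simp
    qed
  qed
  moreover have "\<forall>\<^sub>F y in at x within U. y \<in> U" by (simp add: eventually_at_filter)
  ultimately show "\<forall>\<^sub>F y in at x within U. dist (piecewise Ts f y) (piecewise Ts f x) < e"
  proof eventually_elim
    case (elim y)
    then show ?case using piecewise_select[of y Ts] cov by (metis subsetD)
  qed
qed

text \<open>The product of a test function and the piecewise function is continuous with compact
  support. A line meets every convex piece in an interval, so on each segment the product is
  differentiable off finitely many points and the fundamental theorem of calculus holds. By
  \<open>integral_line_derivative\<close> its derivative has integral 0, which is the identity
  sought.\<close>

lemma weak_diff_piecewise:
  assumes U: "open U" "bounded U" and cov: "U \<subseteq> \<Union>(set Ts)"
    and closed: "\<And>T. T \<in> set Ts \<Longrightarrow> closed T \<and> convex T"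
    and cont: "\<And>T. T \<in> set Ts \<Longrightarrow> continuous_on UNIV (f T)" "\<And>T. T \<in> set Ts \<Longrightarrow> continuous_on UNIV (f' T)"
    and deriv: "\<And>T y s. T \<in> set Ts \<Longrightarrow> ((\<lambda>s. f T (y + s *\<^sub>R e)) has_vector_derivative f' T (y + s *\<^sub>R e)) (at s)"
    and cons: "\<And>T T' y. T \<in> set Ts \<Longrightarrow> T' \<in> set Ts \<Longrightarrow> y \<in> U \<Longrightarrow> y \<in> T \<Longrightarrow> y \<in> T' \<Longrightarrow> f T y = f T' y"
  shows "weak_diff U e (\<lambda>x. indicator U x *\<^sub>R piecewise Ts f x) (\<lambda>x. indicator U x *\<^sub>R piecewise Ts f' x)"
proof -
  define P where "P = piecewise Ts f"
  define Q where "Q = piecewise Ts f'"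
  have [measurable]: "P \<in> borel_measurable borel" "Q \<in> borel_measurable borel" "U \<in> sets borel"
    unfolding P_def Q_def using closed cont U by (auto intro: piecewise_measurable)
  have cl: "compact (closure U)" using U by simp
  obtain BP where BP: "\<And>y. y \<in> closure U \<Longrightarrow> cmod (P y) \<le> BP" "0 \<le> BP" 
    using piecewise_bounded[of Ts f, OF cont(1) cl] unfolding P_def by blast
  obtain BQ where BQ: "\<And>y. y \<in> closure U \<Longrightarrow> cmod (Q y) \<le> BQ" "0 \<le> BQ"
    using piecewise_bounded[of Ts f', OF cont(2) cl] unfolding Q_def by blast
  have iP: "integrable lborel (\<lambda>x. indicator U x *\<^sub>R P x)"
    using BP closure_subset[of U] by (intro integrable_compact_support[OF _ cl, of _ BP]) (auto simp: indicator_def)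
  have iQ: "integrable lborel (\<lambda>x. indicator U x *\<^sub>R Q x)"
    using BQ closure_subset[of U] by (intro integrable_compact_support[OF _ cl, of _ BQ]) (auto simp: indicator_def)
  have contP: "continuous_on U P"
    unfolding P_def
  proof (rule piecewise_continuous_on[OF _ cov])
    show "closed T \<and> continuous_on UNIV (f T)" if "T \<in> set Ts" for T
      using closed[OF that] cont(1)[OF that] by simp
  qed (rule cons)
  have "(LINT x|lborel. (e \<bullet> G x) *\<^sub>R indicator U x *\<^sub>R P x) = - (LINT x|lborel. \<phi> x *\<^sub>R indicator U x *\<^sub>R Q x)"
    if t: "test_fn U \<phi> G" for \<phi> G
  proof -
    obtain K where K: "compact K" "K \<subseteq> U" "\<And>x. x \<notin> K \<Longrightarrow> \<phi> x = 0" using t unfolding test_fn_def by blast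
    have G: "\<And>x. GDERIV \<phi> x :> G x" using t by (simp add: test_fn_def)
    note G0 = test_fn_grad_zero[OF t K(1,3)]
    have c\<phi>: "continuous_on UNIV \<phi>" by (rule test_fn_continuous[OF t])
    note [measurable] = test_fn_measurable[OF t]
    obtain B where B: "\<And>x. \<bar>\<phi> x\<bar> \<le> B" "\<And>x. \<bar>e \<bullet> G x\<bar> \<le> B" using test_fn_bounded[OF t, of e] by blast
    have KU: "x \<in> U" if "x \<in> K" for x using K that by blast
    define \<psi> where "\<psi> x = \<phi> x *\<^sub>R P x" for x
    define D where "D x = (e \<bullet> G x) *\<^sub>R (indicator U x *\<^sub>R P x) + \<phi> x *\<^sub>R (indicator U x *\<^sub>R Q x)" for x
    have i1: "integrable lborel (\<lambda>x. (e \<bullet> G x) *\<^sub>R (indicator U x *\<^sub>R P x))"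
      by (rule integrable_bounded_mult[OF iP _ B(2)]) measurable
    have i2: "integrable lborel (\<lambda>x. \<phi> x *\<^sub>R (indicator U x *\<^sub>R Q x))"
      by (rule integrable_bounded_mult[OF iQ _ B(1)]) measurable
    have D: "integrable lborel D" unfolding D_def by (intro Bochner_Integration.integrable_add i1 i2)
    have "\<psi> = (\<lambda>x. \<phi> x *\<^sub>R (indicator U x *\<^sub>R P x))"
      using KU K(3) by (force simp: fun_eq_iff \<psi>_def indicator_def)
    then have \<psi>: "integrable lborel \<psi>" using integrable_bounded_mult[OF iP _ B(1)] by simp
    \<comment> \<open>\<psi> is continuous on \<open>U\<close> and zero on the complement of
      \<open>K\<close>; these open sets cover the plane.\<close>
    have c\<psi>: "continuous_on UNIV \<psi>"
    proof -
      have "continuous_on U \<psi>" unfolding \<psi>_def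
        by (intro continuous_on_scaleR contP continuous_on_subset[OF c\<phi>]) simp
      moreover have "continuous_on (- K) \<psi>"
        by (rule continuous_on_eq[of _ "\<lambda>_. 0"]) (auto simp: \<psi>_def K)
      ultimately have "continuous_on (U \<union> - K) \<psi>"
        using U K(1) by (intro continuous_on_open_Un) (auto simp: compact_imp_closed open_Compl)
      moreover have "U \<union> - K = UNIV" using K by blast
      ultimately show ?thesis by simp
    qed
    have line: "((\<lambda>s. D (y + s *\<^sub>R e)) has_integral \<psi> (y + e) - \<psi> y) {0..1}" for y
    proof -
      define I where "I T = {s \<in> {0..1::real}. y + s *\<^sub>R e \<in> T}" for T
      have I: "\<exists>c d. I T = {c..d}" if T: "T \<in> set Ts" for T
      proof -
        have eq: "I T = {0..1} \<inter> (\<lambda>s. y + s *\<^sub>R e) -` T" by (auto simp: I_def)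
        have "compact (I T)" unfolding eq using closed[OF T]
          by (intro compact_Int_closed closed_vimage) (auto intro!: continuous_intros)
        moreover have "convex (I T)"
        proof (rule convexI)
          fix p q u v :: real assume h: "p \<in> I T" "q \<in> I T" "0 \<le> u" "0 \<le> v" "u + v = 1"
          then have "u *\<^sub>R (y + p *\<^sub>R e) + v *\<^sub>R (y + q *\<^sub>R e) \<in> T"
            using closed[OF T] by (intro convexD) (auto simp: I_def)
          moreover have "u *\<^sub>R (y + p *\<^sub>R e) + v *\<^sub>R (y + q *\<^sub>R e) = (u + v) *\<^sub>R y + (u * p + v * q) *\<^sub>R e"
            by (simp add: algebra_simps)
          moreover have "u *\<^sub>R p + v *\<^sub>R q \<in> {0..1}" using h by (intro convexD[of "{0..1::real}"]) (auto simp: I_def)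
          ultimately show "u *\<^sub>R p + v *\<^sub>R q \<in> I T" using h by (simp add: I_def)
        qed
        ultimately show ?thesis using connected_compact_interval_1 convex_connected by blast
      qed
      then obtain c d where cd: "\<And>T. T \<in> set Ts \<Longrightarrow> I T = {c T..d T}" by metis
      \<comment> \<open>The finite exceptional set: the parameters at which the line enters or
        leaves a piece.\<close>
      define X where "X = c ` set Ts \<union> d ` set Ts"
      have "((\<lambda>s. D (y + s *\<^sub>R e)) has_integral \<psi> (y + 1 *\<^sub>R e) - \<psi> (y + 0 *\<^sub>R e)) {0..1}"
      proof (rule fundamental_theorem_of_calculus_interior_strong[where S=X])
        show "continuous_on {0..1} (\<lambda>s. \<psi> (y + s *\<^sub>R e))"
          by (intro continuous_on_compose2[OF c\<psi>] continuous_intros) auto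
        fix s assume s: "s \<in> {0<..<1} - X"
        define x where "x = y + s *\<^sub>R e"
        have op: "open ((\<lambda>s. y + s *\<^sub>R e) -` V)" if "open V" for V
          using that by (intro open_vimage) (auto intro!: continuous_intros)
        show "((\<lambda>s. \<psi> (y + s *\<^sub>R e)) has_vector_derivative D (y + s *\<^sub>R e)) (at s)"
        proof (cases "x \<in> K")
          case False
          have "((\<lambda>s. \<psi> (y + s *\<^sub>R e)) has_vector_derivative 0) (at s)"
            by (rule has_vector_derivative_zero_nbhd[OF op[of "- K"]])
              (use False K in \<open>auto simp: x_def \<psi>_def compact_imp_closed open_Compl\<close>)
          moreover have "D x = 0" using False K G0 by (simp add: D_def)
          ultimately show ?thesis by (simp add: x_def)
        next
          case True
          then have xU: "x \<in> U" by (rule KU)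
          then obtain T where T: "T \<in> set Ts" "x \<in> T" and sel: "\<And>f. piecewise Ts f x = f T x"
            using piecewise_select[of x Ts] cov by blast
          have "s \<in> I T" using T s by (auto simp: I_def x_def)
          \<comment> \<open>As \<open>s\<close> is not an end point, the line stays in
            \<open>T\<close> near \<open>s\<close>. There the piecewise function equals
            \<open>f T\<close> by consistency, even if the list selects another piece at nearby
            points.\<close>
          then have sI: "s \<in> {c T<..<d T}" using cd[OF T(1)] s T(1) by (auto simp: X_def less_le)
          have "((\<lambda>s. \<phi> (y + s *\<^sub>R e)) has_vector_derivative e \<bullet> G x) (at s)"
            by (rule has_derivative_along_line) (simp add: G x_def)
          then have "((\<lambda>s. \<phi> (y + s *\<^sub>R e) *\<^sub>R f T (y + s *\<^sub>R e)) has_vector_derivative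
              (\<phi> (y + s *\<^sub>R e) *\<^sub>R f' T (y + s *\<^sub>R e) + (e \<bullet> G x) *\<^sub>R f T (y + s *\<^sub>R e))) (at s)"
            by (intro has_vector_derivative_scaleR deriv T) (simp add: has_real_derivative_iff_has_vector_derivative)
          moreover have "\<phi> (y + s *\<^sub>R e) *\<^sub>R f' T (y + s *\<^sub>R e) + (e \<bullet> G x) *\<^sub>R f T (y + s *\<^sub>R e) = D x"
            using xU sel[of f] sel[of f'] by (simp add: D_def P_def Q_def x_def)
          ultimately have d: "((\<lambda>s. \<phi> (y + s *\<^sub>R e) *\<^sub>R f T (y + s *\<^sub>R e)) has_vector_derivative D x) (at s)" by simp
          have "((\<lambda>s. \<psi> (y + s *\<^sub>R e)) has_vector_derivative D x) (at s)"
          proof (rule has_vector_derivative_transform_within_open[OF d])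
            show "open ({c T<..<d T} \<inter> (\<lambda>s. y + s *\<^sub>R e) -` U)" using U by (intro open_Int op) auto
            show "s \<in> {c T<..<d T} \<inter> (\<lambda>s. y + s *\<^sub>R e) -` U" using sI xU by (simp add: x_def)
            fix r assume r: "r \<in> {c T<..<d T} \<inter> (\<lambda>s. y + s *\<^sub>R e) -` U"
            then have "r \<in> I T" using cd[OF T(1)] by auto
            then have "y + r *\<^sub>R e \<in> T" by (simp add: I_def)
            then have "P (y + r *\<^sub>R e) = f T (y + r *\<^sub>R e)"
              unfolding P_def by (rule piecewise_eq[OF T(1)]) (rule cons, use r in auto)
            then show "\<phi> (y + r *\<^sub>R e) *\<^sub>R f T (y + r *\<^sub>R e) = \<psi> (y + r *\<^sub>R e)" by (simp add: \<psi>_def)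
          qed
          then show ?thesis by (simp add: x_def)
        qed
      qed (simp_all add: X_def)
      then show ?thesis by simp
    qed
    have "(LINT x|lborel. D x) = 0" by (rule integral_line_derivative[OF \<psi> D line])
    then show ?thesis unfolding D_def using i1 i2 by (simp add: add_eq_0_iff)
  qed
  then show ?thesis unfolding weak_diff_def using iP iQ by (simp add: P_def Q_def)
qed

section \<open>Bilinear functions, their directional derivatives, and agreement on common
  faces\<close>

definition bilin_dir :: "real^2 \<Rightarrow> complex \<Rightarrow> complex \<Rightarrow> complex \<Rightarrow> real^2 \<Rightarrow> complex" where
  "bilin_dir e a b d p = (e $ 1) *\<^sub>R a + (e $ 2) *\<^sub>R b + (e $ 1 * p $ 2 + p $ 1 * e $ 2) *\<^sub>R d"

lemma bilin_continuous: "continuous_on UNIV (bilin a b c d :: real^2 \<Rightarrow> complex)"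
  unfolding bilin_def by (intro continuous_intros)

lemma bilin_dir_continuous: "continuous_on UNIV (bilin_dir e a b d)"
  unfolding bilin_dir_def by (intro continuous_intros)

lemma bilin_derivative:
  "((\<lambda>s. bilin a b c d (y + s *\<^sub>R e)) has_vector_derivative bilin_dir e a b d (y + s *\<^sub>R e)) (at s)"
  unfolding bilin_def bilin_dir_def
  by (auto intro!: derivative_eq_intros simp: has_vector_derivative_def algebra_simps)

lemma bilin_diff: "bilin a b c d y - bilin a' b' c' d' y = bilin (a - a') (b - b') (c - c') (d - d') y"
  by (simp add: bilin_def algebra_simps)

lemma convex_bilin_zero: "convex {y. bilin a b c 0 y = (0::complex)}"
proof (rule convexI)
  fix x y :: "real^2" and u v :: real
  assume h: "x \<in> {y. bilin a b c 0 y = 0}" "y \<in> {y. bilin a b c 0 y = 0}" "u + v = 1"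
  have "bilin a b c 0 (u *\<^sub>R x + v *\<^sub>R y) = u *\<^sub>R bilin a b c 0 x + v *\<^sub>R bilin a b c 0 y"
  proof -
    have "c = (u + v) *\<^sub>R c" using h by simp
    then have "c = u *\<^sub>R c + v *\<^sub>R c" by (simp add: scaleR_add_left)
    then show ?thesis unfolding bilin_def by (simp add: algebra_simps)
  qed
  then show "u *\<^sub>R x + v *\<^sub>R y \<in> {y. bilin a b c 0 y = 0}" using h by simp
qed

text \<open>With one coordinate fixed at \<open>k\<close>, the mixed term is linear in the other one
  and is absorbed as \<open>k *\<^sub>R d\<close>.\<close>

lemma bilin_on_axis_line:
  fixes i :: 2 and k :: real
  obtains a' b' c' where "\<And>y. y $ i = k \<Longrightarrow> bilin a b c d y = bilin a' b' c' (0::complex) y"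
proof -
  consider "i = 1" | "i = 2" using exhaust_2 by blast
  then show ?thesis
  proof cases
    case 1
    then show ?thesis using that[of a "b + k *\<^sub>R d" c] by (simp add: bilin_def algebra_simps)
  next
    case 2
    then show ?thesis using that[of "a + k *\<^sub>R d" b c] by (simp add: bilin_def algebra_simps)
  qed
qed

text \<open>By Minkowski's theorem the face is the convex hull of its extreme points, and the zero
  set of an affine function is convex.\<close>

lemma affine_zero_on_face:
  assumes "compact F" "convex F" "\<And>A. A extreme_point_of F \<Longrightarrow> q A = 0"
    and "\<And>y. y \<in> F \<Longrightarrow> q y = bilin a b c (0::complex) y" and "y \<in> F"
  shows "q y = 0"
proof -
  have "F = convex hull {A. A extreme_point_of F}" using assms by (intro Krein_Milman_Minkowski)
  also have "\<dots> \<subseteq> {y. bilin a b c 0 y = 0}"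
  proof (rule hull_minimal)
    show "{A. A extreme_point_of F} \<subseteq> {y. bilin a b c 0 y = 0}"
      using assms(3,4) by (auto simp: extreme_point_of_def)
  qed (rule convex_bilin_zero)
  finally show ?thesis using assms(4,5) by auto
qed

text \<open>Otherwise \<open>F\<close> has, for each of the four side lines of the box, a point off
  that line; the mean of the four is a point of \<open>F\<close> in the open box.\<close>

lemma convex_frontier_cbox_in_side:
  fixes F :: "(real^2) set"
  assumes F: "convex F" "F \<subseteq> cbox a b" "F \<inter> box a b = {}"
  obtains i k where "\<And>y. y \<in> F \<Longrightarrow> y $ i = (k::real)"
proof (rule ccontr)
  assume no: "\<not> thesis"
  have "\<exists>y\<in>F. y $ i \<noteq> k" for i k using no that by blast
  then obtain f where f: "\<And>i k. f i k \<in> F" "\<And>i k. f i k $ i \<noteq> k" by metis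
  have b: "a $ i \<le> y $ i \<and> y $ i \<le> b $ i" if "y \<in> F" for y i using F(2) that by (auto simp: mem_box_cart)
  define z where "z = (1/2) *\<^sub>R ((1/2) *\<^sub>R f 1 (a $ 1) + (1/2) *\<^sub>R f 1 (b $ 1)) + (1/2) *\<^sub>R ((1/2) *\<^sub>R f 2 (a $ 2) + (1/2) *\<^sub>R f 2 (b $ 2))"
  have "z \<in> F" unfolding z_def using F(1) f(1) by (intro convexD) auto
  moreover have "z \<in> box a b"
  proof -
    note bb = b[OF f(1), of 1 1 "a $ 1"] b[OF f(1), of 1 1 "b $ 1"] b[OF f(1), of 1 2 "a $ 2"] b[OF f(1), of 1 2 "b $ 2"]
       b[OF f(1), of 2 1 "a $ 1"] b[OF f(1), of 2 1 "b $ 1"] b[OF f(1), of 2 2 "a $ 2"] b[OF f(1), of 2 2 "b $ 2"]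
    have n: "f 1 (a $ 1) $ 1 > a $ 1" "f 1 (b $ 1) $ 1 < b $ 1" "f 2 (a $ 2) $ 2 > a $ 2" "f 2 (b $ 2) $ 2 < b $ 2"
      using f(2)[of 1 "a $ 1"] f(2)[of 1 "b $ 1"] f(2)[of 2 "a $ 2"] f(2)[of 2 "b $ 2"] bb by auto
    have "a $ 1 < z $ 1" "z $ 1 < b $ 1" "a $ 2 < z $ 2" "z $ 2 < b $ 2"
      unfolding z_def using bb n by (simp_all add: field_simps)
    then show ?thesis by (simp add: mem_box_cart forall_2)
  qed
  ultimately show False using F(3) by blast
qed

text \<open>Extreme points of the common face are vertices of \<open>T\<close>, where the two
  functions agree. Their difference is affine on the face: for triangles because there is no mixed
  term, for distinct rectangles because the face lies on an axis-parallel line. So it vanishes on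
  the whole face.\<close>

lemma mesh_conforming:
  assumes M: "mesh \<Omega> M" and T: "T \<in> M" "T' \<in> M"
    and p: "p T = bilin a b c d" "p T' = bilin a' b' c' d'"
    and tri: "triangle T \<Longrightarrow> d = 0" "triangle T' \<Longrightarrow> d' = 0"
    and nodes: "\<And>A. A \<in> vertices T \<Longrightarrow> A \<in> T \<Longrightarrow> A \<in> T' \<Longrightarrow> p T A = (p T' A :: complex)"
    and y: "y \<in> T" "y \<in> T'"
  shows "p T y = p T' y"
proof -
  define F where "F = T \<inter> T'"
  have face: "F face_of T" "F face_of T'" using M T unfolding mesh_def F_def by auto
  have extr: "p T A - p T' A = 0" if "A extreme_point_of F" for A
  proof -
    have "A extreme_point_of T" using extreme_point_of_face[OF face(1)] that by simp
    then show ?thesis using nodes[of A] that by (auto simp: vertices_def extreme_point_of_def F_def)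
  qed
  have diff: "p T z - p T' z = bilin (a - a') (b - b') (c - c') (d - d') z" for z
    unfolding p by (rule bilin_diff)
  have "p T y - p T' y = 0"
  proof (cases "triangle T \<and> triangle T'")
    case True
    then have "compact F" "convex F"
      unfolding F_def triangle_def by (auto intro: compact_Int convex_Int compact_simplex convex_simplex)
    then show ?thesis
      by (rule affine_zero_on_face[where a="a - a'" and b="b - b'" and c="c - c'"]) (use extr True tri y diff F_def in auto)
  next
    case False
    then have "rectangle T" "rectangle T'" using M T unfolding mesh_def by auto
    then obtain l u l' u' where box: "T = cbox l u" "T' = cbox l' u'" "l $ 1 < u $ 1" "l $ 2 < u $ 2" "l' $ 1 < u' $ 1" "l' $ 2 < u' $ 2"
      unfolding rectangle_def by blast
    have Fc: "compact F" "convex F" unfolding F_def box by (auto intro: compact_Int convex_Int)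
    show ?thesis
    proof (cases "T = T'")
      case False
      \<comment> \<open>The face is proper in at least one of the rectangles and therefore misses
        its interior.\<close>
      have "F \<noteq> T \<or> F \<noteq> T'" using False by blast
      then have "\<exists>l u. F \<subseteq> cbox l u \<and> F \<inter> box l u = {}"
      proof
        assume "F \<noteq> T"
        then have "F \<inter> interior T = {}" by (rule face_of_disjoint_interior[OF face(1)])
        then show ?thesis unfolding F_def box by (intro exI[of _ l] exI[of _ u]) (auto simp: interior_cbox)
      next
        assume "F \<noteq> T'"
        then have "F \<inter> interior T' = {}" by (rule face_of_disjoint_interior[OF face(2)])
        then show ?thesis unfolding F_def box by (intro exI[of _ l'] exI[of _ u']) (auto simp: interior_cbox)
      qed
      then obtain i k where ik: "\<And>y. y \<in> F \<Longrightarrow> y $ i = (k::real)"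
        using convex_frontier_cbox_in_side[OF Fc(2)] by blast
      obtain a1 b1 c1 where lin: "\<And>y. y $ i = k \<Longrightarrow> bilin (a - a') (b - b') (c - c') (d - d') y = bilin a1 b1 c1 (0::complex) y"
        using bilin_on_axis_line by blast
      show ?thesis
      proof (rule affine_zero_on_face[OF Fc, where q="\<lambda>z. p T z - p T' z" and a=a1 and b=b1 and c=c1])
        show "p T A - p T' A = 0" if "A extreme_point_of F" for A by (rule extr[OF that])
        show "p T z - p T' z = bilin a1 b1 c1 0 z" if "z \<in> F" for z
          unfolding diff by (rule lin[OF ik[OF that]])
        show "y \<in> F" using y by (simp add: F_def)
      qed
    qed simp
  qed
  then show ?thesis by simp
qed

section \<open>Square integrability on the plane and on the whole domain\<close>

definition l2 :: "(real^2 \<Rightarrow> complex) \<Rightarrow> bool" where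
  "l2 f \<longleftrightarrow> f \<in> borel_measurable borel \<and> (\<integral>\<^sup>+x. esq (f x) \<partial>lborel) < \<infinity>"

lemma cmod_add_sq_le: "(cmod (a + b))\<^sup>2 \<le> 2 * (cmod a)\<^sup>2 + 2 * (cmod b)\<^sup>2"
proof -
  have "(cmod (a + b))\<^sup>2 \<le> (cmod a + cmod b)\<^sup>2" by (intro power_mono norm_triangle_ineq) auto
  also have "\<dots> \<le> 2 * (cmod a)\<^sup>2 + 2 * (cmod b)\<^sup>2"
    using sum_squares_bound[of "cmod a" "cmod b"] by (simp add: power2_sum)
  finally show ?thesis .
qed

lemma l2_add:
  assumes "l2 f" "l2 g"
  shows "l2 (\<lambda>x. f x + g x)"
proof -
  have [measurable]: "f \<in> borel_measurable borel" "g \<in> borel_measurable borel" using assms by (auto simp: l2_def)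
  have "(\<integral>\<^sup>+x. esq (f x + g x) \<partial>lborel) \<le>
      (\<integral>\<^sup>+x. 2 * esq (f x) + 2 * esq (g x) \<partial>lborel)"
  proof (rule nn_integral_mono)
    fix x
    have "esq (f x + g x) \<le> ennreal (2 * (cmod (f x))\<^sup>2 + 2 * (cmod (g x))\<^sup>2)"
      by (intro ennreal_leI cmod_add_sq_le)
    then show "esq (f x + g x) \<le> 2 * esq (f x) + 2 * esq (g x)"
      by (simp add: ennreal_plus ennreal_mult)
  qed
  also have "\<dots> = 2 * (\<integral>\<^sup>+x. esq (f x) \<partial>lborel) + 2 * (\<integral>\<^sup>+x. esq (g x) \<partial>lborel)"
    by (simp add: nn_integral_add nn_integral_cmult)
  also have "\<dots> < \<infinity>" using assms by (simp add: l2_def ennreal_mult_less_top)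
  finally show ?thesis by (simp add: l2_def)
qed

lemma l2_indicator:
  assumes "l2 f" and [measurable]: "U \<in> sets borel"
  shows "l2 (\<lambda>x. indicator U x *\<^sub>R f x)"
proof -
  have [measurable]: "f \<in> borel_measurable borel" using assms by (auto simp: l2_def)
  have "(\<integral>\<^sup>+x. esq (indicator U x *\<^sub>R f x) \<partial>lborel) \<le> (\<integral>\<^sup>+x. esq (f x) \<partial>lborel)"
    by (intro nn_integral_mono) (auto simp: indicator_def)
  then show ?thesis using assms by (auto simp: l2_def)
qed

lemma l2_bounded_indicator:
  assumes [measurable]: "f \<in> borel_measurable borel" "U \<in> sets borel" and U: "bounded U" and B: "\<And>x. x \<in> U \<Longrightarrow> cmod (f x) \<le> B"
  shows "l2 (\<lambda>x. indicator U x *\<^sub>R f x)"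
proof -
  have "(\<integral>\<^sup>+x. esq (indicator U x *\<^sub>R f x) \<partial>lborel) \<le> (\<integral>\<^sup>+x. ennreal (B\<^sup>2) * indicator U x \<partial>lborel)"
    using B by (intro nn_integral_mono) (auto simp: indicator_def intro!: ennreal_leI power_mono)
  also have "\<dots> = ennreal (B\<^sup>2) * emeasure lborel U" by (simp add: nn_integral_cmult_indicator)
  also have "\<dots> < \<infinity>" using emeasure_bounded_finite[OF U] by (simp add: ennreal_mult_less_top)
  finally show ?thesis by (simp add: l2_def)
qed

lemma l2_representative:
  assumes u: "sq_integrable U u" and U: "U \<in> sets borel" "bounded U"
  obtains u' where "l2 u'" "integrable lborel u'" "\<And>x. x \<notin> U \<Longrightarrow> u' x = 0" "AE x in lborel. x \<in> U \<longrightarrow> u x = u' x"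
proof -
  obtain u' where u': "integrable lborel u'" "\<And>x. x \<notin> U \<Longrightarrow> u' x = 0" "AE x in lborel. x \<in> U \<longrightarrow> u x = u' x"
    "(\<integral>\<^sup>+x. esq (u' x) \<partial>lborel) = ennreal ((L2_norm U u)\<^sup>2)"
    using borel_representative[OF u U] by blast
  then have "l2 u'" by (simp add: l2_def)
  then show ?thesis using that u' by blast
qed

lemma sq_integrable_AE:
  assumes l: "l2 u'" and U: "U \<in> sets borel" and ae: "AE x in lborel. x \<in> U \<longrightarrow> u x = u' x"
  shows "sq_integrable U u"
proof -
  have Ul: "U \<in> sets lebesgue" using U by auto
  have m': "u' \<in> borel_measurable borel" using l by (simp add: l2_def)
  have "(\<lambda>x. indicator U x *\<^sub>R u' x) \<in> borel_measurable lebesgue"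
    using m' U by (simp add: measurable_completion)
  moreover have "AE x in lebesgue. indicator U x *\<^sub>R u' x = indicator U x *\<^sub>R u x"
  proof -
    have "AE x in lborel. indicator U x *\<^sub>R u' x = indicator U x *\<^sub>R u x"
      using ae by eventually_elim (auto simp: indicator_def)
    then show ?thesis by (simp add: AE_completion_iff)
  qed
  ultimately have "(\<lambda>x. indicator U x *\<^sub>R u x) \<in> borel_measurable lebesgue" by (rule borel_measurable_AE)
  then have um: "u \<in> borel_measurable (lebesgue_on U)"
    using Ul by (subst borel_measurable_restrict_space_iff) auto
  have "sq_integrable U u'" using sq_integrable_borel[OF m' _ U] l by (simp add: l2_def)
  then have i': "integrable (lebesgue_on U) (\<lambda>x. (cmod (u' x))\<^sup>2)" by (simp add: sq_integrable_def)
  have "AE x in lebesgue. x \<in> U \<longrightarrow> u x = u' x" using ae by (simp add: AE_completion_iff)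
  then have "AE x in lebesgue_on U. u' x = u x" using Ul by (auto simp: AE_restrict_space_iff elim: eventually_mono)
  then have "AE x in lebesgue_on U. (cmod (u' x))\<^sup>2 = (cmod (u x))\<^sup>2" by eventually_elim simp
  moreover have "(\<lambda>x. (cmod (u' x))\<^sup>2) \<in> borel_measurable (lebesgue_on U)" using i' by (rule borel_measurable_integrable)
  ultimately have "integrable (lebesgue_on U) (\<lambda>x. (cmod (u x))\<^sup>2)"
    using i' um integrable_cong_AE[of "\<lambda>x. (cmod (u' x))\<^sup>2" "lebesgue_on U" "\<lambda>x. (cmod (u x))\<^sup>2"] by simp
  then show ?thesis using um by (simp add: sq_integrable_def)
qed

lemma nn_integral_L2_norm:
  assumes u: "sq_integrable U u" and U: "U \<in> sets borel"
  shows "(\<integral>\<^sup>+x. esq (u x) * indicator U x \<partial>lborel) = ennreal ((L2_norm U u)\<^sup>2)"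
proof -
  have Ul: "U \<in> sets lebesgue" using U by auto
  have "(\<integral>\<^sup>+x. esq (u x) * indicator U x \<partial>lborel) = (\<integral>\<^sup>+x. esq (u x) \<partial>lebesgue_on U)"
    using Ul by (simp add: nn_integral_restrict_space nn_integral_completion)
  also have "\<dots> = ennreal (LINT x|lebesgue_on U. (cmod (u x))\<^sup>2)"
    using u by (intro nn_integral_eq_integral) (auto simp: sq_integrable_def)
  also have "(LINT x|lebesgue_on U. (cmod (u x))\<^sup>2) = (L2_norm U u)\<^sup>2" by (simp add: L2_norm_def)
  finally show ?thesis .
qed

text \<open>A differentiable image of an interval in the plane is a null set; hence the two
  subdomains fill the domain up to a null set.\<close>

lemma negligible_piecewise_C2:
  assumes "piecewise_C2 \<gamma>"
  shows "negligible (path_image \<gamma>)"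
proof -
  obtain \<tau> :: "nat \<Rightarrow> real" and n where \<tau>: "\<tau> 0 = 0" "\<tau> n = 1" and
    C: "\<And>i. i < n \<Longrightarrow> \<tau> i < \<tau> (Suc i) \<and> C2_regular \<gamma> {\<tau> i..\<tau> (Suc i)}"
    using assms unfolding piecewise_C2_def by blast
  have neg: "negligible (\<gamma> ` {\<tau> i..\<tau> (Suc i)})" if i: "i < n" for i
  proof -
    obtain g' where "\<And>t. t \<in> {\<tau> i..\<tau> (Suc i)} \<Longrightarrow> (\<gamma> has_vector_derivative g' t) (at t within {\<tau> i..\<tau> (Suc i)})"
      using C[OF i] unfolding C2_regular_def by blast
    then have "\<gamma> differentiable_on {\<tau> i..\<tau> (Suc i)}"
      unfolding differentiable_on_def using differentiableI_vector by blast
    then show ?thesis by (intro negligible_differentiable_image_lowdim) auto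
  qed
  have "k \<le> n \<Longrightarrow> negligible (\<gamma> ` {\<tau> 0..\<tau> k})" for k
  proof (induction k)
    case (Suc k)
    have "{\<tau> 0..\<tau> (Suc k)} \<subseteq> {\<tau> 0..\<tau> k} \<union> {\<tau> k..\<tau> (Suc k)}" by auto
    then have "\<gamma> ` {\<tau> 0..\<tau> (Suc k)} \<subseteq> \<gamma> ` {\<tau> 0..\<tau> k} \<union> \<gamma> ` {\<tau> k..\<tau> (Suc k)}" by blast
    moreover have "negligible (\<gamma> ` {\<tau> 0..\<tau> k} \<union> \<gamma> ` {\<tau> k..\<tau> (Suc k)})"
      using Suc neg[of k] by (intro negligible_Un) auto
    ultimately show ?case by (rule negligible_subset[rotated])
  qed simp
  then show ?thesis using \<tau> by (metis order_refl path_image_def)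
qed

text \<open>\<open>PH2\<close> gives square integrability only on each subdomain; the
  representatives, extended by zero, are added, and the interface is negligible.\<close>

lemma sum_space_sq_integrable:
  assumes P: "polygonal_domain \<Omega> S" and I: "interface \<Omega> \<Omega>m \<Omega>p \<gamma>"
    and v: "v \<in> sum_space (PH2 \<Omega>m \<Omega>p \<gamma> \<beta>m \<beta>p) (ife_space \<Omega> \<Omega>m \<Omega>p \<Gamma> \<beta>m' \<beta>p' M)"
  shows "sq_integrable \<Omega> v"
proof -
  have \<Omega>: "open \<Omega>" "bounded \<Omega>" using P by (auto simp: polygonal_domain_def)
  have I': "open \<Omega>m" "open \<Omega>p" "\<Omega>m \<inter> \<Omega>p = {}" "\<Omega>m \<union> \<Omega>p = \<Omega> - path_image \<gamma>" and \<gamma>: "piecewise_C2 \<gamma>"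
    using I by (auto simp: interface_def)
  have "\<Omega>m \<subseteq> \<Omega>" "\<Omega>p \<subseteq> \<Omega>" using I'(4) by blast+
  then have b: "bounded \<Omega>m" "bounded \<Omega>p" using bounded_subset[OF \<Omega>(2)] by blast+
  obtain w s where w: "w \<in> PH2 \<Omega>m \<Omega>p \<gamma> \<beta>m \<beta>p" and s: "s \<in> ife_space \<Omega> \<Omega>m \<Omega>p \<Gamma> \<beta>m' \<beta>p' M" and vws: "v = (\<lambda>x. w x + s x)"
    using v unfolding sum_space_def by blast
  have sq: "sq_integrable \<Omega>m w" "sq_integrable \<Omega>p w" "sq_integrable \<Omega> s"
    using w s unfolding PH2_def H2_def H1_def ife_space_def by auto
  have m: "\<Omega>m \<in> sets borel" "\<Omega>p \<in> sets borel" "\<Omega> \<in> sets borel" using I' \<Omega> by auto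
  obtain wm where wm: "l2 wm" "integrable lborel wm" "\<And>x. x \<notin> \<Omega>m \<Longrightarrow> wm x = 0" "AE x in lborel. x \<in> \<Omega>m \<longrightarrow> w x = wm x"
    by (rule l2_representative[OF sq(1) m(1) b(1)]) (rule that)
  obtain wp where wp: "l2 wp" "integrable lborel wp" "\<And>x. x \<notin> \<Omega>p \<Longrightarrow> wp x = 0" "AE x in lborel. x \<in> \<Omega>p \<longrightarrow> w x = wp x"
    by (rule l2_representative[OF sq(2) m(2) b(2)]) (rule that)
  obtain s' where s': "l2 s'" "integrable lborel s'" "\<And>x. x \<notin> \<Omega> \<Longrightarrow> s' x = 0" "AE x in lborel. x \<in> \<Omega> \<longrightarrow> s x = s' x"
    by (rule l2_representative[OF sq(3) m(3) \<Omega>(2)]) (rule that)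
  have "AE x in lebesgue. x \<notin> path_image \<gamma>"
    using negligible_piecewise_C2[OF \<gamma>] by (intro AE_not_in) (simp add: negligible_iff_null_sets)
  then have "AE x in lborel. x \<notin> path_image \<gamma>" by (simp add: AE_completion_iff)
  with wm(4) wp(4) s'(4) have "AE x in lborel. x \<in> \<Omega> \<longrightarrow> v x = wm x + wp x + s' x"
  proof eventually_elim
    case (elim x)
    show ?case
    proof
      assume x: "x \<in> \<Omega>"
      then consider "x \<in> \<Omega>m" "x \<notin> \<Omega>p" | "x \<in> \<Omega>p" "x \<notin> \<Omega>m" using elim I'(3,4) by blast
      then show "v x = wm x + wp x + s' x" by cases (use elim x wm(3) wp(3) in \<open>auto simp: vws\<close>)
    qed
  qed
  then show ?thesis using \<Omega> by (intro sq_integrable_AE[OF l2_add[OF l2_add[OF wm(1) wp(1)] s'(1)]]) auto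
qed

section \<open>Mesh elements and weak differentiability away from the interface\<close>

lemma mesh_element:
  assumes "mesh \<Omega> M" "T \<in> M"
  shows "compact T" "convex T" "T \<subseteq> closure \<Omega>"
proof -
  have "triangle T \<or> rectangle T" "T \<subseteq> \<Union>M" "\<Union>M = closure \<Omega>" using assms unfolding mesh_def by auto
  then show "compact T" "convex T" "T \<subseteq> closure \<Omega>"
    unfolding triangle_def rectangle_def by (auto intro: compact_simplex convex_simplex)
qed

lemma mesh_interior_subset:
  assumes "polygonal_domain \<Omega> S" "mesh \<Omega> M" "T \<in> M"
  shows "interior T \<subseteq> \<Omega>"
  using interior_mono[OF mesh_element(3)[OF assms(2,3)]] assms(1) by (simp add: polygonal_domain_def)

lemma regular_mesh_interior:
  assumes "regular_mesh \<sigma> \<kappa> M" "T \<in> M"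
  shows "interior T \<noteq> {}"
proof -
  obtain x r where xr: "0 < r" "cball x r \<subseteq> T" using assms unfolding regular_mesh_def by blast
  then have "ball x r \<subseteq> interior T" by (meson ball_subset_cball interior_maximal open_ball order_trans)
  then show ?thesis using xr(1) by (metis centre_in_ball empty_iff subsetD)
qed

text \<open>The intersection is a face of both elements, and a proper face misses the interior. So
  it is all of \<open>T'\<close>; as \<open>T'\<close> has inner points, which are then inner points
  of \<open>T\<close>, it is all of \<open>T\<close> as well.\<close>

lemma mesh_interior_disjoint:
  assumes M: "mesh \<Omega> M" and R: "regular_mesh \<sigma> \<kappa> M" and T: "T \<in> M" "T' \<in> M" and meet: "T \<inter> interior T' \<noteq> {}"
  shows "T = T'"
proof -
  have f: "T \<inter> T' face_of T" "T \<inter> T' face_of T'" using M T unfolding mesh_def by auto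
  have "T \<inter> T' = T'"
  proof (rule ccontr)
    assume "T \<inter> T' \<noteq> T'"
    then have "T \<inter> T' \<inter> interior T' = {}" by (rule face_of_disjoint_interior[OF f(2)])
    then show False using meet interior_subset by blast
  qed
  moreover have "T \<inter> T' = T"
  proof (rule ccontr)
    assume "T \<inter> T' \<noteq> T"
    then have "T \<inter> T' \<inter> interior T = {}" by (rule face_of_disjoint_interior[OF f(1)])
    moreover have "interior T' \<subseteq> interior T" using \<open>T \<inter> T' = T'\<close> by (metis inf_le1 interior_mono)
    ultimately show False using regular_mesh_interior[OF R T(2)] \<open>T \<inter> T' = T'\<close> interior_subset by blast
  qed
  ultimately show ?thesis by simp
qed

lemma local_space_bilin:
  assumes "q \<in> local_space \<Omega>m \<Omega>p \<Gamma> \<beta>m \<beta>p T" "T \<inter> \<Gamma> = {}"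
  obtains a b c d where "q = bilin a b c d" "triangle T \<longrightarrow> d = 0"
proof -
  have "\<not> interface_element \<Gamma> T" using assms(2) interior_subset unfolding interface_element_def by blast
  then show ?thesis using assms(1) that unfolding local_space_def by (auto split: if_splits)
qed

text \<open>The elements that meet \<open>U\<close> cover it and miss the interface. On them the
  finite element part is given by polynomials that agree on common faces, so
  \<open>weak_diff_piecewise\<close> applies; the other part is in \<open>H1\<close> of the
  subdomain that contains \<open>U\<close>.\<close>

lemma weak_diff_away_from_interface:
  assumes P: "polygonal_domain \<Omega> S" and I: "interface \<Omega> \<Omega>m \<Omega>p \<gamma>" and M: "mesh \<Omega> M"
    and v: "v \<in> sum_space (PH2 \<Omega>m \<Omega>p \<gamma> \<beta>m \<beta>p) (ife_space \<Omega> \<Omega>m \<Omega>p (path_image \<gamma>) \<beta>m \<beta>p M)"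
    and U: "open U" "convex U" "U \<subseteq> \<Omega>" and away: "\<And>T. T \<in> M \<Longrightarrow> T \<inter> U \<noteq> {} \<Longrightarrow> T \<inter> path_image \<gamma> = {}"
  obtains u g where "\<And>i. weak_diff U (axis i 1) u (g i)" "\<And>x. x \<notin> U \<Longrightarrow> u x = 0" "\<And>i x. x \<notin> U \<Longrightarrow> g i x = 0"
    "l2 u" "\<And>i. l2 (g i)" "AE x in lborel. x \<in> U \<longrightarrow> v x = u x"
proof -
  have \<Omega>: "open \<Omega>" "bounded \<Omega>" using P by (auto simp: polygonal_domain_def)
  have bU: "bounded U" using bounded_subset[OF \<Omega>(2) U(3)] .
  have Um[measurable]: "U \<in> sets borel" using U by auto
  have I': "open \<Omega>m" "open \<Omega>p" "\<Omega>m \<inter> \<Omega>p = {}" "\<Omega>m \<union> \<Omega>p = \<Omega> - path_image \<gamma>"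
    using I by (auto simp: interface_def)
  have fin: "finite M" and UM: "\<Union>M = closure \<Omega>" using M by (auto simp: mesh_def)
  obtain w s where w: "w \<in> PH2 \<Omega>m \<Omega>p \<gamma> \<beta>m \<beta>p" and s: "s \<in> ife_space \<Omega> \<Omega>m \<Omega>p (path_image \<gamma>) \<beta>m \<beta>p M"
    and vws: "v = (\<lambda>x. w x + s x)"
    using v unfolding sum_space_def by blast
  define N where "N = {T \<in> M. T \<inter> U \<noteq> {}}"
  have UN: "U \<subseteq> \<Union>N" using U(3) UM closure_subset[of \<Omega>] unfolding N_def by blast
  have U\<gamma>: "U \<inter> path_image \<gamma> = {}" using UN away unfolding N_def by blast
  \<comment> \<open>A connected set that misses the interface lies in one of the two disjoint open
    subdomains.\<close>
  have "connected U" using U(2) by (rule convex_connected)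
  then have "U \<subseteq> \<Omega>m \<or> U \<subseteq> \<Omega>p"
    using connectedD[of U \<Omega>m \<Omega>p] I' U(3) U\<gamma> by blast
  then obtain \<Omega>0 where \<Omega>0: "U \<subseteq> \<Omega>0" "open \<Omega>0" "bounded \<Omega>0" "w \<in> H1 \<Omega>0"
  proof
    assume "U \<subseteq> \<Omega>m"
    moreover have "bounded \<Omega>m" using bounded_subset[OF \<Omega>(2)] I'(4) by blast
    ultimately show ?thesis using that[of \<Omega>m] I' w by (auto simp: PH2_def H2_def)
  next
    assume "U \<subseteq> \<Omega>p"
    moreover have "bounded \<Omega>p" using bounded_subset[OF \<Omega>(2)] I'(4) by blast
    ultimately show ?thesis using that[of \<Omega>p] I' w by (auto simp: PH2_def H2_def)
  qed
  have \<Omega>0m: "\<Omega>0 \<in> sets borel" using \<Omega>0 by auto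
  have wsq: "sq_integrable \<Omega>0 w" using \<Omega>0(4) by (simp add: H1_def)
  obtain w' where w': "l2 w'" "integrable lborel w'" "\<And>x. x \<notin> \<Omega>0 \<Longrightarrow> w' x = 0" "AE x in lborel. x \<in> \<Omega>0 \<longrightarrow> w x = w' x"
    by (rule l2_representative[OF wsq \<Omega>0m \<Omega>0(3)]) (rule that)
  have "\<exists>h'. l2 h' \<and> weak_diff \<Omega>0 (axis i 1) w' h'" for i
  proof -
    obtain h where h: "sq_integrable \<Omega>0 h" "has_weak_deriv \<Omega>0 i w h" using \<Omega>0(4) unfolding H1_def by blast
    obtain h' where h': "l2 h'" "integrable lborel h'" "\<And>x. x \<notin> \<Omega>0 \<Longrightarrow> h' x = 0" "AE x in lborel. x \<in> \<Omega>0 \<longrightarrow> h x = h' x"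
      by (rule l2_representative[OF h(1) \<Omega>0m \<Omega>0(3)]) (rule that)
    show ?thesis
      using has_weak_deriv_iff_weak_diff[OF wsq h(1) \<Omega>0m w'(2,4) h'(2,4), of i] h(2) h'(1) by blast
  qed
  then obtain h where h: "\<And>i. l2 (h i)" "\<And>i. weak_diff \<Omega>0 (axis i 1) w' (h i)" by metis
  have hint: "integrable lborel (h i)" for i using h(2) unfolding weak_diff_def by blast
  have iU: "integrable lborel (\<lambda>x. indicator U x *\<^sub>R f x)" if "integrable lborel f" for f :: "real^2 \<Rightarrow> complex"
    using that by (intro integrable_mult_indicator) auto
  have wU: "weak_diff U (axis i 1) (\<lambda>x. indicator U x *\<^sub>R w' x) (\<lambda>x. indicator U x *\<^sub>R h i x)" for i
    by (rule weak_diff_restrict[OF h(2) \<Omega>0(1) iU[OF w'(2)] _ iU[OF hint]]) auto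
  from s have "\<exists>p. (\<forall>T\<in>M. p T \<in> local_space \<Omega>m \<Omega>p (path_image \<gamma>) \<beta>m \<beta>p T \<and> (AE x in lebesgue_on T. s x = p T x)) \<and>
      (\<forall>A \<in> (\<Union>T\<in>M. vertices T). \<forall>T\<in>M. \<forall>T'\<in>M. A \<in> T \<and> A \<in> T' \<longrightarrow> p T A = p T' A)"
    unfolding ife_space_def mem_Collect_eq by (rule conjunct2)
  then obtain p where p0: "(\<forall>T\<in>M. p T \<in> local_space \<Omega>m \<Omega>p (path_image \<gamma>) \<beta>m \<beta>p T \<and> (AE x in lebesgue_on T. s x = p T x)) \<and>
      (\<forall>A \<in> (\<Union>T\<in>M. vertices T). \<forall>T\<in>M. \<forall>T'\<in>M. A \<in> T \<and> A \<in> T' \<longrightarrow> p T A = p T' A)" ..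
  have p: "p T \<in> local_space \<Omega>m \<Omega>p (path_image \<gamma>) \<beta>m \<beta>p T" "AE x in lebesgue_on T. s x = p T x" if "T \<in> M" for T
    using bspec[OF conjunct1[OF p0] that] by (rule conjunct1, rule conjunct2)
  have nodes: "p T A = p T' A" if "A \<in> vertices T" "T \<in> M" "T' \<in> M" "A \<in> T" "A \<in> T'" for A T T'
  proof -
    have "A \<in> (\<Union>T\<in>M. vertices T)" using that by blast
    from bspec[OF bspec[OF bspec[OF conjunct2[OF p0] this] that(2)] that(3)] show ?thesis using that by simp
  qed
  \<comment> \<open>The four coefficients are packed into one tuple, so that a single choice serves
    all elements.\<close>
  have "\<exists>q. p T = bilin (fst q) (fst (snd q)) (fst (snd (snd q))) (snd (snd (snd q))) \<and>
      (triangle T \<longrightarrow> snd (snd (snd q)) = 0)" if "T \<in> N" for T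
  proof -
    have T: "T \<in> M" "T \<inter> path_image \<gamma> = {}" using that away unfolding N_def by auto
    obtain a b c d where "p T = bilin a b c d" "triangle T \<longrightarrow> d = 0"
      by (rule local_space_bilin[OF p(1)[OF T(1)] T(2)]) (rule that)
    then show ?thesis by (intro exI[of _ "(a, b, c, d)"]) simp
  qed
  then obtain q where q: "\<And>T. T \<in> N \<Longrightarrow> p T = bilin (fst (q T)) (fst (snd (q T))) (fst (snd (snd (q T)))) (snd (snd (snd (q T)))) \<and>
      (triangle T \<longrightarrow> snd (snd (snd (q T))) = 0)" by metis
  define a b c d where "a T = fst (q T)" and "b T = fst (snd (q T))" and "c T = fst (snd (snd (q T)))" and "d T = snd (snd (snd (q T)))" for T
  have bil: "p T = bilin (a T) (b T) (c T) (d T)" "triangle T \<Longrightarrow> d T = 0" if "T \<in> N" for T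
    using q[OF that] by (simp_all add: a_def b_def c_def d_def)
  obtain Ts where Ts: "set Ts = N" using fin finite_list[of N] unfolding N_def by auto
  define p' where "p' i T = bilin_dir (axis i 1) (a T) (b T) (d T)" for i T
  have NM: "T \<in> M" if "T \<in> N" for T using that by (simp add: N_def)
  have cons: "p T y = p T' y" if "T \<in> set Ts" "T' \<in> set Ts" "y \<in> U" "y \<in> T" "y \<in> T'" for T T' y
  proof (rule mesh_conforming[where p=p, OF M NM NM bil(1) bil(1) bil(2) bil(2)])
    show "p T A = p T' A" if "A \<in> vertices T" "A \<in> T" "A \<in> T'" for A
      using nodes[of A T T'] that \<open>T \<in> set Ts\<close> \<open>T' \<in> set Ts\<close> Ts NM by simp
  qed (use that Ts in auto)
  have clT: "closed T \<and> convex T" if "T \<in> set Ts" for T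
    using mesh_element[OF M NM] that Ts by (auto simp: compact_imp_closed)
  have cp: "continuous_on UNIV (p T)" "continuous_on UNIV (p' i T)" if "T \<in> set Ts" for i T
    using bil(1) that Ts by (auto simp: bilin_continuous bilin_dir_continuous p'_def)
  have pU: "weak_diff U (axis i 1) (\<lambda>x. indicator U x *\<^sub>R piecewise Ts p x) (\<lambda>x. indicator U x *\<^sub>R piecewise Ts (p' i) x)" for i
  proof (rule weak_diff_piecewise[OF U(1) bU _ clT cp(1) cp(2) _ cons])
    show "U \<subseteq> \<Union>(set Ts)" using UN Ts by simp
    show "((\<lambda>s. p T (y + s *\<^sub>R axis i 1)) has_vector_derivative p' i T (y + s *\<^sub>R axis i 1)) (at s)" if "T \<in> set Ts" for T y s
      using bil(1)[of T] that Ts by (simp add: p'_def bilin_derivative)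
  qed
  define u where "u x = indicator U x *\<^sub>R w' x + indicator U x *\<^sub>R piecewise Ts p x" for x
  define g where "g i x = indicator U x *\<^sub>R h i x + indicator U x *\<^sub>R piecewise Ts (p' i) x" for i x
  have l2p: "l2 (\<lambda>x. indicator U x *\<^sub>R piecewise Ts f x)" if cf: "\<And>T. T \<in> set Ts \<Longrightarrow> continuous_on UNIV (f T)" for f
  proof -
    obtain B where B: "\<And>y. y \<in> closure U \<Longrightarrow> cmod (piecewise Ts f y) \<le> B"
      using piecewise_bounded[of Ts f "closure U"] cf bU by (metis compact_closure)
    show ?thesis
    proof (rule l2_bounded_indicator[OF _ Um bU])
      show "piecewise Ts f \<in> borel_measurable borel" using clT cf by (intro piecewise_measurable) auto
      show "cmod (piecewise Ts f x) \<le> B" if "x \<in> U" for x using B that closure_subset[of U] by blast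
    qed
  qed
  have "AE x in lborel. x \<in> U \<longrightarrow> v x = u x"
  proof -
    have "AE x in lebesgue. \<forall>T\<in>N. x \<in> T \<longrightarrow> s x = p T x"
    proof (rule AE_finite_allI)
      show "finite N" using fin by (simp add: N_def)
      fix T assume "T \<in> N"
      then have "AE x in lebesgue_on T. s x = p T x" "T \<in> sets lebesgue"
        using p(2) NM mesh_element(1)[OF M NM] by (auto simp: lmeasurable_compact fmeasurableD)
      then show "AE x in lebesgue. x \<in> T \<longrightarrow> s x = p T x" by (simp add: AE_restrict_space_iff)
    qed
    then have "AE x in lborel. \<forall>T\<in>N. x \<in> T \<longrightarrow> s x = p T x" by (simp add: AE_completion_iff)
    with w'(4) show ?thesis
    proof eventually_elim
      case (elim x)
      show ?case
      proof
        assume x: "x \<in> U"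
        then have "x \<in> \<Union>(set Ts)" using UN Ts by blast
        then obtain T where T: "T \<in> set Ts" "x \<in> T" "\<And>f. piecewise Ts f x = f T x"
          by (rule piecewise_select) (rule that)
        have "w x = w' x" "s x = p T x" using elim x \<Omega>0(1) T Ts by blast+
        then show "v x = u x" using x T(3)[of p] by (simp add: vws u_def)
      qed
    qed
  qed
  moreover have "weak_diff U (axis i 1) u (g i)" for i
    using weak_diff_add[OF wU[of i] pU[of i]] unfolding u_def g_def .
  moreover have "l2 u" unfolding u_def using cp by (intro l2_add l2_indicator[OF w'(1)] l2p) auto
  moreover have "l2 (g i)" for i unfolding g_def using cp by (intro l2_add l2_indicator[OF h(1)] l2p) auto
  ultimately show ?thesis using that[of u g] by (simp add: u_def g_def)
qed


section \<open>Energy bounds\<close>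

text \<open>
  The boundary trace is not known to be measurable, so \<open>nn_integral_sum\<close> cannot be used to split
  its integral over pieces of a side.
\<close>
lemma nn_integral_cover_le:
  assumes fin: "finite I" and A: "\<And>i. i \<in> I \<Longrightarrow> A i \<in> sets M"
    and cov: "\<And>x. x \<in> space M \<Longrightarrow> f x \<noteq> 0 \<Longrightarrow> \<exists>i\<in>I. x \<in> A i"
  shows "(\<integral>\<^sup>+x. f x \<partial>M) \<le> (\<Sum>i\<in>I. \<integral>\<^sup>+x. indicator (A i) x * f x \<partial>M)"
  unfolding nn_integral_def[of M f]
proof (rule SUP_least, clarify)
  \<comment> \<open>A simple function below \<open>f\<close> is measurable and can be split; the
    bound passes to the supremum.\<close>
  fix g assume g: "simple_function M g" "g \<le> f"
  then have [measurable]: "g \<in> borel_measurable M" by (simp add: borel_measurable_simple_function)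
  have "integral\<^sup>S M g = (\<integral>\<^sup>+x. g x \<partial>M)" using g by (simp add: nn_integral_eq_simple_integral)
  also have "\<dots> \<le> (\<integral>\<^sup>+x. (\<Sum>i\<in>I. indicator (A i) x * g x) \<partial>M)"
  proof (rule nn_integral_mono)
    fix x assume x: "x \<in> space M"
    show "g x \<le> (\<Sum>i\<in>I. indicator (A i) x * g x)"
    proof (cases "f x = 0")
      case True
      then show ?thesis using g(2) by (metis le_funD le_zero_eq zero_le)
    next
      case False
      then obtain i where i: "i \<in> I" "x \<in> A i" using cov x by blast
      have "g x = indicator (A i) x * g x" using i by simp
      also have "\<dots> \<le> (\<Sum>i\<in>I. indicator (A i) x * g x)" by (rule member_le_sum) (use i fin in auto)
      finally show ?thesis .
    qed
  qed
  also have "\<dots> = (\<Sum>i\<in>I. \<integral>\<^sup>+x. indicator (A i) x * g x \<partial>M)"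
    using A by (intro nn_integral_sum) auto
  also have "\<dots> \<le> (\<Sum>i\<in>I. \<integral>\<^sup>+x. indicator (A i) x * f x \<partial>M)"
    using g(2) by (intro sum_mono nn_integral_mono mult_left_mono) (auto simp: le_fun_def)
  finally show "integral\<^sup>S M g \<le> (\<Sum>i\<in>I. \<integral>\<^sup>+x. indicator (A i) x * f x \<partial>M)" .
qed

lemma AE_mesh_interior:
  assumes M: "mesh \<Omega> M" and U: "U \<subseteq> \<Omega>"
  shows "AE x in lborel. x \<in> U \<longrightarrow> (\<exists>T\<in>{T\<in>M. T \<inter> U \<noteq> {}}. x \<in> interior T)"
proof -
  have fin: "finite M" and UM: "\<Union>M = closure \<Omega>" using M by (auto simp: mesh_def)
  have "AE x in lebesgue. \<forall>T\<in>M. x \<notin> frontier T"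
  proof (rule AE_finite_allI[OF fin])
    fix T assume "T \<in> M"
    then have "negligible (frontier T)" using mesh_element[OF M] negligible_convex_frontier by blast
    then show "AE x in lebesgue. x \<notin> frontier T" by (intro AE_not_in) (simp add: negligible_iff_null_sets)
  qed
  then have "AE x in lborel. \<forall>T\<in>M. x \<notin> frontier T" by (simp add: AE_completion_iff)
  then show ?thesis
  proof eventually_elim
    case (elim x)
    show ?case
    proof
      assume x: "x \<in> U"
      then obtain T where T: "T \<in> M" "x \<in> T" using U UM closure_subset[of \<Omega>] by blast
      then have "x \<in> interior T" using elim closure_subset[of T] by (auto simp: frontier_def)
      then show "\<exists>T\<in>{T\<in>M. T \<inter> U \<noteq> {}}. x \<in> interior T" using T x by blast
    qed
  qed
qed

lemma nn_integral_mesh_le: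
  fixes f :: "real^2 \<Rightarrow> ennreal"
  assumes M: "mesh \<Omega> M" and U: "open U" "U \<subseteq> \<Omega>"
    and [measurable]: "f \<in> borel_measurable borel" and f0: "\<And>x. x \<notin> U \<Longrightarrow> f x = 0"
  shows "(\<integral>\<^sup>+x. f x \<partial>lborel) \<le> (\<Sum>T\<in>{T\<in>M. T \<inter> U \<noteq> {}}. \<integral>\<^sup>+x. f x * indicator (U \<inter> interior T) x \<partial>lborel)"
proof -
  let ?N = "{T\<in>M. T \<inter> U \<noteq> {}}"
  have fin: "finite ?N" using M by (auto simp: mesh_def)
  have [measurable]: "U \<inter> interior T \<in> sets borel" for T using U by auto
  have "(\<integral>\<^sup>+x. f x \<partial>lborel) \<le> (\<integral>\<^sup>+x. (\<Sum>T\<in>?N. f x * indicator (U \<inter> interior T) x) \<partial>lborel)"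
  proof (rule nn_integral_mono_AE)
    show "AE x in lborel. f x \<le> (\<Sum>T\<in>?N. f x * indicator (U \<inter> interior T) x)"
      using AE_mesh_interior[OF M U(2)]
    proof eventually_elim
      case (elim x)
      show ?case
      proof (cases "x \<in> U")
        case True
        then obtain T where T: "T \<in> ?N" "x \<in> interior T" using elim by blast
        have "f x = f x * indicator (U \<inter> interior T) x" using T True by simp
        also have "\<dots> \<le> (\<Sum>T\<in>?N. f x * indicator (U \<inter> interior T) x)"
          by (rule member_le_sum[OF T(1)]) (use fin in auto)
        finally show ?thesis .
      qed (simp add: f0)
    qed
  qed
  also have "\<dots> = (\<Sum>T\<in>?N. \<integral>\<^sup>+x. f x * indicator (U \<inter> interior T) x \<partial>lborel)"
    by (rule nn_integral_sum) measurable
  finally show ?thesis .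
qed

text \<open>The interiors of the elements are pairwise disjoint subsets of \<Omega>, so at each
  point at most one indicator is nonzero.\<close>

lemma sum_L2_norm_le:
  assumes P: "polygonal_domain \<Omega> S" and M: "mesh \<Omega> M" and R: "regular_mesh \<sigma> \<kappa> M" and v: "sq_integrable \<Omega> v"
  shows "(\<Sum>T\<in>M. (L2_norm (interior T) v)\<^sup>2) \<le> (L2_norm \<Omega> v)\<^sup>2"
proof -
  have \<Omega>: "open \<Omega>" "bounded \<Omega>" using P by (auto simp: polygonal_domain_def)
  have fin: "finite M" using M by (simp add: mesh_def)
  have \<Omega>m: "\<Omega> \<in> sets borel" using \<Omega> by auto
  obtain v' where v': "l2 v'" "integrable lborel v'" "\<And>x. x \<notin> \<Omega> \<Longrightarrow> v' x = 0" "AE x in lborel. x \<in> \<Omega> \<longrightarrow> v x = v' x"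
    by (rule l2_representative[OF v \<Omega>m \<Omega>(2)]) (rule that)
  have [measurable]: "v' \<in> borel_measurable borel" using v'(2) by simp
  have sub: "interior T \<subseteq> \<Omega>" if "T \<in> M" for T by (rule mesh_interior_subset[OF P M that])
  have eq: "(\<integral>\<^sup>+x. esq (v' x) * indicator W x \<partial>lborel) = ennreal ((L2_norm W v)\<^sup>2)"
    if "W \<subseteq> \<Omega>" "open W" for W
  proof -
    have "sq_integrable W v"
      by (rule sq_integrable_AE[OF v'(1)]) (use that v'(4) in \<open>auto elim!: eventually_mono\<close>)
    have "(\<integral>\<^sup>+x. esq (v' x) * indicator W x \<partial>lborel) = (\<integral>\<^sup>+x. esq (v x) * indicator W x \<partial>lborel)"
    proof (rule nn_integral_cong_AE)
      show "AE x in lborel. esq (v' x) * indicator W x = esq (v x) * indicator W x"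
        using v'(4) by eventually_elim (use that in \<open>auto simp: indicator_def\<close>)
    qed
    also have "\<dots> = ennreal ((L2_norm W v)\<^sup>2)"
      by (rule nn_integral_L2_norm[OF \<open>sq_integrable W v\<close>]) (use that in auto)
    finally show ?thesis .
  qed
  have "ennreal (\<Sum>T\<in>M. (L2_norm (interior T) v)\<^sup>2) = (\<Sum>T\<in>M. \<integral>\<^sup>+x. esq (v' x) * indicator (interior T) x \<partial>lborel)"
    using eq sub by (simp add: sum_ennreal)
  also have "\<dots> = (\<integral>\<^sup>+x. (\<Sum>T\<in>M. esq (v' x) * indicator (interior T) x) \<partial>lborel)"
    by (rule nn_integral_sum[symmetric]) auto
  also have "\<dots> \<le> (\<integral>\<^sup>+x. esq (v' x) * indicator \<Omega> x \<partial>lborel)"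
  proof (rule nn_integral_mono)
    fix x
    show "(\<Sum>T\<in>M. esq (v' x) * indicator (interior T) x) \<le> esq (v' x) * indicator \<Omega> x"
    proof (cases "\<exists>T\<in>M. x \<in> interior T")
      case True
      then obtain T where T: "T \<in> M" "x \<in> interior T" by blast
      have "x \<notin> interior T'" if "T' \<in> M" "T' \<noteq> T" for T'
        using mesh_interior_disjoint[OF M R that(1) T(1)] T(2) that interior_subset by blast
      then have "(\<Sum>T\<in>M. esq (v' x) * indicator (interior T) x) = (\<Sum>T\<in>{T}. esq (v' x) * indicator (interior T) x)"
        using T fin by (intro sum.mono_neutral_right) auto
      then show ?thesis using T sub by (auto simp: indicator_def)
    next
      case False
      then show ?thesis by (simp add: sum.neutral)
    qed
  qed
  also have "\<dots> = ennreal ((L2_norm \<Omega> v)\<^sup>2)" by (rule eq) (use \<Omega> in auto)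
  finally show ?thesis by (simp add: ennreal_le_iff)
qed

text \<open>Links the derivative on \<open>U\<close>, which may cross edges, with the broken norms.
  On \<open>U \<inter> interior T\<close> it agrees almost everywhere with
  \<open>weak_deriv (interior T) i v\<close>, by uniqueness; summing over the elements that meet
  \<open>U\<close> gives the energy bound.\<close>

lemma weak_diff_energy:
  assumes P: "polygonal_domain \<Omega> S" and I: "interface \<Omega> \<Omega>m \<Omega>p \<gamma>" and M: "mesh \<Omega> M" and R: "regular_mesh \<sigma> \<kappa> M"
    and v: "v \<in> sum_space (PH2 \<Omega>m \<Omega>p \<gamma> \<beta>m \<beta>p) (ife_space \<Omega> \<Omega>m \<Omega>p (path_image \<gamma>) \<beta>m \<beta>p M)"
    and U: "open U" "convex U" "U \<subseteq> \<Omega>" and away: "\<And>T. T \<in> M \<Longrightarrow> T \<inter> U \<noteq> {} \<Longrightarrow> T \<inter> path_image \<gamma> = {}"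
  obtains u g where "weak_diff U e u g" "AE x in lborel. x \<in> U \<longrightarrow> v x = u x"
    "(\<integral>\<^sup>+x. esq (u x) \<partial>lborel) \<le> ennreal (\<Sum>T\<in>{T\<in>M. T \<inter> U \<noteq> {}}. (L2_norm (interior T) v)\<^sup>2)"
    "(\<integral>\<^sup>+x. esq (g x) \<partial>lborel) \<le>
       ennreal ((norm e)\<^sup>2 * (\<Sum>T\<in>{T\<in>M. T \<inter> U \<noteq> {}}. (H1_seminorm (interior T) v)\<^sup>2))"
proof -
  let ?N = "{T\<in>M. T \<inter> U \<noteq> {}}"
  have bO: "bounded \<Omega>" using P by (auto simp: polygonal_domain_def)
  obtain u g where ug: "\<And>i. weak_diff U (axis i 1) u (g i)" "\<And>x. x \<notin> U \<Longrightarrow> u x = 0" "\<And>i x. x \<notin> U \<Longrightarrow> g i x = 0"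
    "l2 u" "\<And>i. l2 (g i)" "AE x in lborel. x \<in> U \<longrightarrow> v x = u x"
    by (rule weak_diff_away_from_interface[OF P I M v U away]) (assumption, assumption, rule that)
  have [measurable]: "u \<in> borel_measurable borel" "g i \<in> borel_measurable borel" for i
    using ug(4,5) by (auto simp: l2_def)
  have Um[measurable]: "U \<inter> interior T \<in> sets borel" for T using U by auto
  have loc: "(\<integral>\<^sup>+x. esq (u x) * indicator (U \<inter> interior T) x \<partial>lborel) \<le> ennreal ((L2_norm (interior T) v)\<^sup>2) \<and>
      (\<forall>i. (\<integral>\<^sup>+x. esq (g i x) * indicator (U \<inter> interior T) x \<partial>lborel) \<le>
        ennreal ((L2_norm (interior T) (weak_deriv (interior T) i v))\<^sup>2))" if T: "T \<in> ?N" for T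
  proof -
    have TM: "T \<in> M" and TU: "T \<inter> U \<noteq> {}" using T by auto
    define W where "W = interior T"
    have W: "open W" "convex W" "W \<subseteq> \<Omega>" "W \<in> sets borel"
      unfolding W_def using mesh_element[OF M TM] mesh_interior_subset[OF P M TM] by (auto intro: convex_interior)
    have bW: "bounded W" using bounded_subset[OF bO W(3)] .
    \<comment> \<open>Only \<open>T\<close> itself meets its interior, and \<open>T\<close> misses
      the interface since it meets \<open>U\<close>.\<close>
    have awayT: "T' \<inter> path_image \<gamma> = {}" if "T' \<in> M" "T' \<inter> W \<noteq> {}" for T'
      using mesh_interior_disjoint[OF M R that(1) TM] that(2) away[OF TM TU] unfolding W_def by blast
    obtain uT gT where ugT: "\<And>i. weak_diff W (axis i 1) uT (gT i)" "\<And>x. x \<notin> W \<Longrightarrow> uT x = 0" "\<And>i x. x \<notin> W \<Longrightarrow> gT i x = 0"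
      "l2 uT" "\<And>i. l2 (gT i)" "AE x in lborel. x \<in> W \<longrightarrow> v x = uT x"
      by (rule weak_diff_away_from_interface[OF P I M v W(1-3) awayT]) (assumption, assumption, rule that)
    have iT: "integrable lborel uT" "integrable lborel (gT i)" for i
      using ugT(1)[of i] unfolding weak_diff_def by blast+
    have vW: "sq_integrable W v" by (rule sq_integrable_AE[OF ugT(4) W(4) ugT(6)])
    have UW: "U \<inter> W \<subseteq> U" "U \<inter> W \<subseteq> W" "open (U \<inter> W)" using U W by auto
    have "(\<integral>\<^sup>+x. esq (u x) * indicator (U \<inter> W) x \<partial>lborel) \<le> (\<integral>\<^sup>+x. esq (v x) * indicator W x \<partial>lborel)"
    proof (rule nn_integral_mono_AE)
      show "AE x in lborel. esq (u x) * indicator (U \<inter> W) x \<le> esq (v x) * indicator W x"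
        using ug(6) by eventually_elim (auto simp: indicator_def)
    qed
    also have "\<dots> = ennreal ((L2_norm W v)\<^sup>2)" by (rule nn_integral_L2_norm[OF vW W(4)])
    finally have 1: "(\<integral>\<^sup>+x. esq (u x) * indicator (U \<inter> W) x \<partial>lborel) \<le> ennreal ((L2_norm W v)\<^sup>2)" .
    have 2: "(\<integral>\<^sup>+x. esq (g i x) * indicator (U \<inter> W) x \<partial>lborel) \<le> ennreal ((L2_norm W (weak_deriv W i v))\<^sup>2)" for i
    proof -
      have gs: "sq_integrable W (gT i)"
        using sq_integrable_borel[OF _ _ W(4)] ugT(5)[of i] by (simp add: l2_def)
      have "has_weak_deriv W i v (gT i)"
        using has_weak_deriv_iff_weak_diff[OF vW gs W(4) iT(1) ugT(6) iT(2)[of i], of i] ugT(1)[of i] by simp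
      then have "\<exists>h. sq_integrable W h \<and> has_weak_deriv W i v h" using gs by blast
      \<comment> \<open>\<open>weak_deriv\<close> is a choice; it has the defining properties
        because some weak derivative exists, namely \<open>gT i\<close>.\<close>
      then have wd: "sq_integrable W (weak_deriv W i v)" "has_weak_deriv W i v (weak_deriv W i v)"
        unfolding weak_deriv_def by (rule someI2_ex; blast)+
      obtain d where d: "l2 d" "integrable lborel d" "\<And>x. x \<notin> W \<Longrightarrow> d x = 0" "AE x in lborel. x \<in> W \<longrightarrow> weak_deriv W i v x = d x"
        by (rule l2_representative[OF wd(1) W(4) bW]) (rule that)
      have dT: "weak_diff W (axis i 1) uT d"
        using has_weak_deriv_iff_weak_diff[OF vW wd(1) W(4) iT(1) ugT(6) d(2,4)] wd(2) by simp
      have iu: "integrable lborel u" "integrable lborel (g i)" using ug(1)[of i] unfolding weak_diff_def by blast+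
      have "AE x in lborel. x \<in> U \<inter> W \<longrightarrow> g i x = d x"
      proof (rule weak_diff_unique[OF _ _ UW(3)])
        show "weak_diff (U \<inter> W) (axis i 1) u (g i)" by (rule weak_diff_restrict[OF ug(1) UW(1) iu(1) _ iu(2)]) auto
        show "weak_diff (U \<inter> W) (axis i 1) uT d" by (rule weak_diff_restrict[OF dT UW(2) iT(1) _ d(2)]) auto
        show "AE x in lborel. x \<in> U \<inter> W \<longrightarrow> u x = uT x" using ug(6) ugT(6) by eventually_elim auto
      qed
      with d(4) have ae: "AE x in lborel. x \<in> U \<inter> W \<longrightarrow> g i x = weak_deriv W i v x" by eventually_elim auto
      have "(\<integral>\<^sup>+x. esq (g i x) * indicator (U \<inter> W) x \<partial>lborel) \<le>
          (\<integral>\<^sup>+x. esq (weak_deriv W i v x) * indicator W x \<partial>lborel)"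
      proof (rule nn_integral_mono_AE)
        show "AE x in lborel. esq (g i x) * indicator (U \<inter> W) x \<le> esq (weak_deriv W i v x) * indicator W x"
          using ae by eventually_elim (auto simp: indicator_def)
      qed
      also have "\<dots> = ennreal ((L2_norm W (weak_deriv W i v))\<^sup>2)" by (rule nn_integral_L2_norm[OF wd(1) W(4)])
      finally show ?thesis .
    qed
    show ?thesis using 1 2 unfolding W_def by blast
  qed
  have "(\<integral>\<^sup>+x. esq (u x) \<partial>lborel) \<le>
      (\<Sum>T\<in>?N. \<integral>\<^sup>+x. esq (u x) * indicator (U \<inter> interior T) x \<partial>lborel)"
    by (rule nn_integral_mesh_le[OF M U(1,3)]) (simp_all add: ug(2))
  also have "\<dots> \<le> (\<Sum>T\<in>?N. ennreal ((L2_norm (interior T) v)\<^sup>2))" using loc by (intro sum_mono) blast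
  also have "\<dots> = ennreal (\<Sum>T\<in>?N. (L2_norm (interior T) v)\<^sup>2)" by (simp add: sum_ennreal)
  finally have bu: "(\<integral>\<^sup>+x. esq (u x) \<partial>lborel) \<le> ennreal (\<Sum>T\<in>?N. (L2_norm (interior T) v)\<^sup>2)" .
  define a where "a i = (\<Sum>T\<in>?N. (L2_norm (interior T) (weak_deriv (interior T) i v))\<^sup>2)" for i
  have a0: "a i \<ge> 0" for i unfolding a_def by (intro sum_nonneg) auto
  have bg: "(\<integral>\<^sup>+x. esq (g i x) \<partial>lborel) \<le> ennreal (a i)" for i
  proof -
    have "(\<integral>\<^sup>+x. esq (g i x) \<partial>lborel) \<le>
      (\<Sum>T\<in>?N. \<integral>\<^sup>+x. esq (g i x) * indicator (U \<inter> interior T) x \<partial>lborel)"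
      by (rule nn_integral_mesh_le[OF M U(1,3)]) (simp_all add: ug(3))
    also have "\<dots> \<le> (\<Sum>T\<in>?N. ennreal ((L2_norm (interior T) (weak_deriv (interior T) i v))\<^sup>2))"
      using loc by (intro sum_mono) blast
    also have "\<dots> = ennreal (a i)" by (simp add: sum_ennreal a_def)
    finally show ?thesis .
  qed
  define h where "h x = (e $ 1) *\<^sub>R g 1 x + (e $ 2) *\<^sub>R g 2 x" for x
  have wh: "weak_diff U e u h" unfolding h_def by (rule weak_diff_direction[OF ug(1) ug(1)])
  have hle: "(cmod (h x))\<^sup>2 \<le> (norm e)\<^sup>2 * ((cmod (g 1 x))\<^sup>2 + (cmod (g 2 x))\<^sup>2)" for x
  proof -
    define p q where "p = cmod (g 1 x)" and "q = cmod (g 2 x)"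
    have "cmod (h x) \<le> \<bar>e $ 1\<bar> * p + \<bar>e $ 2\<bar> * q"
      unfolding h_def p_def q_def by (rule order_trans[OF norm_triangle_ineq]) simp
    then have "(cmod (h x))\<^sup>2 \<le> (\<bar>e $ 1\<bar> * p + \<bar>e $ 2\<bar> * q)\<^sup>2" by (rule power_mono) simp
    \<comment> \<open>Cauchy-Schwarz in the plane; the difference of the two sides is the square
      mentioned in the proof.\<close>
    also have "\<dots> \<le> (\<bar>e $ 1\<bar>\<^sup>2 + \<bar>e $ 2\<bar>\<^sup>2) * (p\<^sup>2 + q\<^sup>2)"
      using zero_le_power2[of "\<bar>e $ 1\<bar> * q - \<bar>e $ 2\<bar> * p"] by (simp add: power2_eq_square algebra_simps)
    also have "\<bar>e $ 1\<bar>\<^sup>2 + \<bar>e $ 2\<bar>\<^sup>2 = (norm e)\<^sup>2"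
      unfolding power2_norm_eq_inner inner_vec_def sum_2 by (simp add: power2_eq_square)
    finally show ?thesis by (simp add: p_def q_def)
  qed
  have "(\<integral>\<^sup>+x. esq (h x) \<partial>lborel) \<le>
      (\<integral>\<^sup>+x. ennreal ((norm e)\<^sup>2) * (esq (g 1 x) + esq (g 2 x)) \<partial>lborel)"
    using ennreal_leI[OF hle] by (intro nn_integral_mono) (simp add: ennreal_mult)
  also have "\<dots> = ennreal ((norm e)\<^sup>2) * ((\<integral>\<^sup>+x. esq (g 1 x) \<partial>lborel) + (\<integral>\<^sup>+x. esq (g 2 x) \<partial>lborel))"
    by (simp add: nn_integral_cmult nn_integral_add)
  also have "\<dots> \<le> ennreal ((norm e)\<^sup>2) * (ennreal (a 1) + ennreal (a 2))"
    by (intro mult_left_mono add_mono bg) auto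
  also have "\<dots> = ennreal ((norm e)\<^sup>2 * (a 1 + a 2))" using a0 by (simp add: ennreal_mult ennreal_plus)
  also have "a 1 + a 2 = (\<Sum>T\<in>?N. (H1_seminorm (interior T) v)\<^sup>2)"
    by (simp add: a_def H1_seminorm_def sum_2 sum.distrib)
  finally have bh: "(\<integral>\<^sup>+x. esq (h x) \<partial>lborel) \<le>
       ennreal ((norm e)\<^sup>2 * (\<Sum>T\<in>?N. (H1_seminorm (interior T) v)\<^sup>2))" .
  show ?thesis by (rule that[OF wh ug(6) bu bh])
qed

text \<open>Applies \<open>trace_piece_le\<close> to the direction from the midpoint
  \<open>m\<close> of the piece to the centre of the ball. The piece is short compared with \<rho>,
  so a thin collar over it, translated by \<open>e\<close>, ends up in the ball.\<close>

lemma trace_piece_energy: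
  fixes a b :: "real^2"
  assumes P: "polygonal_domain \<Omega> S" "(a, b) \<in> S" and I: "interface \<Omega> \<Omega>m \<Omega>p \<gamma>" and M: "mesh \<Omega> M" and R: "regular_mesh \<sigma> \<kappa> M"
    and v: "v \<in> sum_space (PH2 \<Omega>m \<Omega>p \<gamma> \<beta>m \<beta>p) (ife_space \<Omega> \<Omega>m \<Omega>p (path_image \<gamma>) \<beta>m \<beta>p M)"
    and U: "open U" "convex U" "U \<subseteq> \<Omega>" and away: "\<And>T. T \<in> M \<Longrightarrow> T \<inter> U \<noteq> {} \<Longrightarrow> T \<inter> path_image \<gamma> = {}"
    and \<rho>: "0 < \<rho>" "ball x0 \<rho> \<subseteq> U"
    and \<alpha>: "0 \<le> \<alpha>" "\<alpha> < \<beta>" "\<beta> \<le> 1" "(\<beta> - \<alpha>) * dist a b \<le> \<rho> / 2"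
    and cl: "\<And>t. \<alpha> \<le> t \<Longrightarrow> t \<le> \<beta> \<Longrightarrow> linepath a b t \<in> closure U"
    and L: "\<And>x y. x \<in> closure \<Omega> \<Longrightarrow> y \<in> closure \<Omega> \<Longrightarrow> dist x y \<le> L" and l: "0 < l" "l \<le> 1"
  shows "(\<integral>\<^sup>+t. indicator {\<alpha>..\<beta>} t * ennreal ((cmod (bdry_trace \<Omega> v (linepath a b t)))\<^sup>2 * dist a b) \<partial>lborel) \<le>
    ennreal (64 / (pi * \<rho>) * ((\<Sum>T\<in>{T\<in>M. T \<inter> U \<noteq> {}}. (L2_norm (interior T) v)\<^sup>2) / l +
       l * L\<^sup>2 * (\<Sum>T\<in>{T\<in>M. T \<inter> U \<noteq> {}}. (H1_seminorm (interior T) v)\<^sup>2)))"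
proof -
  let ?N = "{T\<in>M. T \<inter> U \<noteq> {}}"
  define V where "V = (\<Sum>T\<in>?N. (L2_norm (interior T) v)\<^sup>2)"
  define E where "E = (\<Sum>T\<in>?N. (H1_seminorm (interior T) v)\<^sup>2)"
  have VE: "V \<ge> 0" "E \<ge> 0" unfolding V_def E_def by (auto intro: sum_nonneg)
  have \<Omega>: "open \<Omega>" and ab: "a \<noteq> b" using P by (auto simp: polygonal_domain_def)
  have vsq: "sq_integrable \<Omega> v" by (rule sum_space_sq_integrable[OF P(1) I v])
  obtain n where n: "norm n = 1" "n \<bullet> (b - a) = 0" "\<And>z. z \<in> U \<Longrightarrow> n \<bullet> (z - a) > 0"
    using side_normal[OF P U \<alpha>(1-3) cl] by blast
  have x0: "x0 \<in> U" using \<rho> by auto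
  have nn: "n \<bullet> n = 1" using n(1) by (simp flip: power2_norm_eq_inner)
  define m where "m = linepath a b ((\<alpha> + \<beta>) / 2)"
  define e where "e = x0 - m"
  have "m \<in> closure U" unfolding m_def by (rule cl) (use \<alpha> in auto)
  then have "norm e \<le> L" unfolding e_def dist_norm[symmetric]
    using x0 U(3) closure_mono[OF U(3)] closure_subset[of \<Omega>] by (intro L) auto
  then have eL: "(norm e)\<^sup>2 \<le> L\<^sup>2" by (intro power_mono) auto
  \<comment> \<open>The number \<open>n \<bullet> e\<close> is the height of \<open>x0\<close> over
    the side. Were it less than \<rho>, the foot of the perpendicular would be in the ball, hence in
    \<open>U\<close>, yet on the line.\<close>
  have ne: "\<rho> \<le> n \<bullet> e"
  proof (rule ccontr)
    define c where "c = n \<bullet> (x0 - a)"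
    have "n \<bullet> (m - a) = 0" unfolding m_def linepath_diff_start by (simp add: n(2))
    moreover have "e = (x0 - a) - (m - a)" by (simp add: e_def)
    ultimately have ec: "n \<bullet> e = c" unfolding c_def by (simp only: inner_diff_right)
    assume "\<not> \<rho> \<le> n \<bullet> e"
    then have "c < \<rho>" using ec by simp
    moreover have "c > 0" using n(3)[OF x0] by (simp add: c_def)
    ultimately have "x0 - c *\<^sub>R n \<in> ball x0 \<rho>" using n(1) by (simp add: dist_norm)
    then have "n \<bullet> (x0 - c *\<^sub>R n - a) > 0" using \<rho>(2) n(3) by blast
    moreover have "x0 - c *\<^sub>R n - a = (x0 - a) - c *\<^sub>R n" by simp
    ultimately have "0 < n \<bullet> (x0 - a) - c * (n \<bullet> n)" by (simp only: inner_diff_right inner_scaleR_right)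
    then show False using nn by (simp add: c_def)
  qed
  \<comment> \<open>A point of the collar is less than \<rho> / 2 from some point of the piece,
    which is at most \<rho> / 4 from \<open>m\<close>. Hence \<open>z + e\<close> is in the ball,
    and convexity of \<open>U\<close> covers smaller \<tau>.\<close>
  have shift: "z + \<tau> *\<^sub>R e \<in> U" if z: "z \<in> collar U a b \<alpha> \<beta> (\<rho> / 2)" and \<tau>: "0 \<le> \<tau>" "\<tau> \<le> 1" for z \<tau>
  proof -
    obtain t where t: "z \<in> U" "t \<in> {\<alpha>..\<beta>}" "dist (linepath a b t) z < \<rho> / 2" using z by (auto simp: collar_def)
    have "dist m (linepath a b t) = norm (linepath a b t - m)" by (simp add: dist_norm norm_minus_commute)
    also have "\<dots> = \<bar>t - (\<alpha> + \<beta>) / 2\<bar> * norm (b - a)" unfolding m_def linepath_diff by (rule norm_scaleR)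
    also have "\<dots> = \<bar>t - (\<alpha> + \<beta>) / 2\<bar> * dist a b" by (simp add: dist_norm norm_minus_commute)
    also have "\<dots> \<le> (\<beta> - \<alpha>) / 2 * dist a b"
      using t(2) by (intro mult_right_mono) (auto simp: abs_le_iff field_simps)
    also have "\<dots> \<le> \<rho> / 4" using \<alpha>(4) by simp
    finally have "dist m z < \<rho>" using dist_triangle[of m z "linepath a b t"] t(3) \<rho>(1) by simp
    then have "x0 + (z - m) \<in> ball x0 \<rho>" by (simp add: dist_norm norm_minus_commute)
    then have "x0 + (z - m) \<in> U" using \<rho>(2) by blast
    then have "(1 - \<tau>) *\<^sub>R z + \<tau> *\<^sub>R (x0 + (z - m)) \<in> U" using U(2) t(1) \<tau> by (intro convexD) auto
    then show ?thesis by (simp add: e_def algebra_simps)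
  qed
  obtain u g where w: "weak_diff U e u g" and uv: "AE x in lborel. x \<in> U \<longrightarrow> v x = u x"
    and bu: "(\<integral>\<^sup>+x. esq (u x) \<partial>lborel) \<le> ennreal V"
    and bg: "(\<integral>\<^sup>+x. esq (g x) \<partial>lborel) \<le> ennreal ((norm e)\<^sup>2 * E)"
    by (rule weak_diff_energy[OF P(1) I M R v U away])
      (assumption, assumption, (rule that; (assumption | simp only: V_def E_def)))
  have Une: "U \<noteq> {}" using x0 by blast
  have "(\<integral>\<^sup>+t. indicator {\<alpha>..\<beta>} t * ennreal ((cmod (bdry_trace \<Omega> v (linepath a b t)))\<^sup>2 * dist a b) \<partial>lborel)
    \<le> ennreal (32 / (pi * \<rho>)) * (ennreal (2 / l) * (\<integral>\<^sup>+z. esq (u z) \<partial>lborel) +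
        ennreal (2 * l) * (\<integral>\<^sup>+z. esq (g z) \<partial>lborel))"
  proof (rule trace_piece_le[OF \<Omega> vsq U(1,2) w uv ab l \<rho>(1) ne n _ shift])
    show "0 < \<rho> / 2" using \<rho> by simp
    show "\<exists>r0>0. \<forall>r. 0 < r \<and> r < r0 \<longrightarrow> ball (linepath a b t) r \<inter> \<Omega> \<subseteq> U \<and>
       pi * r\<^sup>2 / 4 \<le> measure lebesgue (ball (linepath a b t) r \<inter> \<Omega>)" if "\<alpha> < t" "t < \<beta>" for t
      by (rule side_half_disc[OF P U Une \<alpha>(1,3) cl n that])
  qed
  also have "\<dots> \<le> ennreal (32 / (pi * \<rho>)) * (ennreal (2 / l) * ennreal V + ennreal (2 * l) * ennreal (L\<^sup>2 * E))"
  proof -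
    have "ennreal ((norm e)\<^sup>2 * E) \<le> ennreal (L\<^sup>2 * E)" using eL VE by (intro ennreal_leI mult_right_mono)
    then show ?thesis using bu bg by (intro mult_left_mono add_mono) auto
  qed
  also have "\<dots> = ennreal (32 / (pi * \<rho>) * (2 / l * V + 2 * l * (L\<^sup>2 * E)))"
  proof -
    have *: "0 \<le> 2 / l * V" "0 \<le> 2 * l * (L\<^sup>2 * E)" using l VE by simp_all
    have "ennreal (2 / l) * ennreal V = ennreal (2 / l * V)" "ennreal (2 * l) * ennreal (L\<^sup>2 * E) = ennreal (2 * l * (L\<^sup>2 * E))"
      using l VE by (intro ennreal_mult[symmetric]; simp)+
    moreover have "ennreal (32 / (pi * \<rho>)) * ennreal (2 / l * V + 2 * l * (L\<^sup>2 * E)) = ennreal (32 / (pi * \<rho>) * (2 / l * V + 2 * l * (L\<^sup>2 * E)))"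
      using * \<rho>(1) by (intro ennreal_mult[symmetric]) (auto intro: add_nonneg_nonneg)
    ultimately show ?thesis using * by (simp only: ennreal_plus[symmetric])
  qed
  also have "32 / (pi * \<rho>) * (2 / l * V + 2 * l * (L\<^sup>2 * E)) = 64 / (pi * \<rho>) * (V / l + l * L\<^sup>2 * E)"
    by (simp add: algebra_simps)
  finally show ?thesis by (simp add: V_def E_def)
qed


section \<open>Fine and coarse meshes\<close>

abbreviation part :: "nat \<Rightarrow> nat \<Rightarrow> real set" where
  "part i n \<equiv> {real i / real n..(real i + 1) / real n}"

lemma unit_interval_cover:
  assumes "0 \<le> t" "t \<le> 1" "0 < n"
  shows "\<exists>i<n. real i / real n \<le> t \<and> t \<le> (real i + 1) / real n"
\<comment> \<open>At \<open>t = 1\<close> the floor would give the index \<open>n\<close>; this end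
  point goes to the last piece.\<close>
proof (cases "t = 1")
  case True
  then show ?thesis using assms by (intro exI[of _ "n - 1"]) (auto simp: of_nat_diff)
next
  case False
  define i where "i = nat \<lfloor>t * real n\<rfloor>"
  have tn: "0 \<le> t * real n" "t * real n < real n" using assms False by auto
  have i: "real i \<le> t * real n" "t * real n < real i + 1"
    unfolding i_def using tn by (auto simp: of_nat_nat)
  then have "i < n" using tn by linarith
  then show ?thesis using i assms by (intro exI[of _ i]) (auto simp: field_simps)
qed

lemma nn_integral_unit_pieces:
  assumes n: "0 < n"
  shows "(\<integral>\<^sup>+t. indicator {0..1} t * f t \<partial>lborel) \<le>
    (\<Sum>i<n. \<integral>\<^sup>+t. indicator (part i n) t * f t \<partial>lborel)"
proof -
  have "(\<integral>\<^sup>+t. indicator {0..1} t * f t \<partial>lborel) \<le>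
    (\<Sum>i<n. \<integral>\<^sup>+t. indicator (part i n) t * (indicator {0..1} t * f t) \<partial>lborel)"
  proof (rule nn_integral_cover_le)
    fix t :: real assume "indicator {0..1} t * f t \<noteq> 0"
    then have "0 \<le> t" "t \<le> 1" by (auto simp: indicator_def split: if_splits)
    then show "\<exists>i\<in>{..<n}. t \<in> part i n"
      using unit_interval_cover[OF _ _ n, of t] by auto
  qed auto
  also have "\<dots> \<le> (\<Sum>i<n. \<integral>\<^sup>+t. indicator (part i n) t * f t \<partial>lborel)"
    by (intro sum_mono nn_integral_mono mult_left_mono) (auto simp: indicator_def)
  finally show ?thesis .
qed

lemma piece_bounds:
  assumes "i < n"
  shows "0 \<le> real i / real n" "real i / real n < (real i + 1) / real n" "(real i + 1) / real n \<le> 1"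
    "(real i + 1) / real n - real i / real n = 1 / real n"
  using assms by (auto simp: field_simps)

lemma ex_pieces:
  fixes D r :: real
  assumes "r > 0"
  obtains n where "0 < n" "1 / real n * D \<le> r"
proof -
  obtain n where n: "D / r < real n" using reals_Archimedean2 by blast
  have "D / r \<le> real (Suc n)" using n by simp
  then have "D \<le> r * real (Suc n)" using assms by (simp add: divide_le_eq mult.commute)
  then have "1 / real (Suc n) * D \<le> r" by (simp add: divide_le_eq)
  then show ?thesis using that[of "Suc n"] by simp
qed

lemma linepath_segment_subset:
  assumes "convex T" "linepath a b \<alpha> \<in> T" "linepath a b \<beta> \<in> T"
  shows "closed_segment (linepath a b \<alpha>) (linepath a b \<beta>) \<subseteq> T"
  using assms by (simp add: closed_segment_subset)

text \<open>Fixes everything the constants may depend on. The results below first provide the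
  constant and then quantify over the mesh, the function and the length \<open>l\<close>.\<close>

locale ife_setting =
  fixes \<Omega> \<Omega>m \<Omega>p :: "(real^2) set" and S :: "((real^2) \<times> (real^2)) set" and \<gamma> :: "real \<Rightarrow> real^2"
    and \<beta>m \<beta>p \<sigma> \<kappa> :: real
  assumes P: "polygonal_domain \<Omega> S" and I: "interface \<Omega> \<Omega>m \<Omega>p \<gamma>"
begin

definition good_mesh :: "(real^2) set set \<Rightarrow> bool" where
  "good_mesh M \<longleftrightarrow> mesh \<Omega> M \<and> regular_mesh \<sigma> \<kappa> M \<and> admissible_mesh \<Omega> (path_image \<gamma>) M"

definition trial_space :: "(real^2) set set \<Rightarrow> (real^2 \<Rightarrow> complex) set" where
  "trial_space M = sum_space (PH2 \<Omega>m \<Omega>p \<gamma> \<beta>m \<beta>p) (ife_space \<Omega> \<Omega>m \<Omega>p (path_image \<gamma>) \<beta>m \<beta>p M)"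

definition mass :: "(real^2) set set \<Rightarrow> (real^2 \<Rightarrow> complex) \<Rightarrow> real" where
  "mass M v = (\<Sum>T\<in>M. (L2_norm (interior T) v)\<^sup>2)"

definition energy :: "(real^2) set set \<Rightarrow> (real^2 \<Rightarrow> complex) \<Rightarrow> real" where
  "energy M v = (\<Sum>T\<in>M. (H1_seminorm (interior T) v)\<^sup>2)"

definition side_integral :: "(real^2) \<times> (real^2) \<Rightarrow> (real^2 \<Rightarrow> complex) \<Rightarrow> real set \<Rightarrow> ennreal" where
  "side_integral p v A = (\<integral>\<^sup>+t. indicator A t *
     ennreal ((cmod (bdry_trace \<Omega> v (linepath (fst p) (snd p) t)))\<^sup>2 * dist (fst p) (snd p)) \<partial>lborel)"

lemma good_meshD:
  assumes "good_mesh M"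
  shows "mesh \<Omega> M" "regular_mesh \<sigma> \<kappa> M" "admissible_mesh \<Omega> (path_image \<gamma>) M" "finite M"
  using assms by (auto simp: good_mesh_def mesh_def)

lemma mass_nonneg: "0 \<le> mass M v" and energy_nonneg: "0 \<le> energy M v"
  unfolding mass_def energy_def by (auto intro: sum_nonneg)

lemma diameter_le_mesh_size:
  assumes "good_mesh M" "T \<in> M"
  shows "diameter T \<le> mesh_size M"
  unfolding mesh_size_def using good_meshD(4)[OF assms(1)] assms(2) by (intro Max_ge) auto

text \<open>The triangle \<open>U\<close> over the side, the ball in it and the number of pieces are
  chosen before the mesh, so the constant is uniform.\<close>

lemma side_bound_fine:
  assumes ab: "(a, b) \<in> S" and \<delta>: "0 < \<delta>" "\<And>x y. x \<in> frontier \<Omega> \<Longrightarrow> y \<in> path_image \<gamma> \<Longrightarrow> \<delta> \<le> dist x y"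
    and L: "\<And>x y. x \<in> closure \<Omega> \<Longrightarrow> y \<in> closure \<Omega> \<Longrightarrow> dist x y \<le> L"
  shows "\<exists>C\<ge>0. \<forall>M v l. good_mesh M \<and> mesh_size M < \<delta> / 2 \<and> v \<in> trial_space M \<and> 0 < l \<and> l \<le> 1 \<longrightarrow>
    side_integral (a, b) v {0..1} \<le> ennreal (C * (mass M v / l + l * L\<^sup>2 * energy M v))"
proof -
  obtain U where U: "open U" "convex U" "U \<noteq> {}" "U \<subseteq> \<Omega>" and cl: "\<And>t. 0 \<le> t \<Longrightarrow> t \<le> 1 \<Longrightarrow> linepath a b t \<in> closure U"
    and near: "\<And>y. y \<in> U \<Longrightarrow> \<exists>x\<in>frontier \<Omega>. dist x y < \<delta> / 2"
    using side_triangle[OF P ab, of "\<delta> / 2"] \<delta>(1) by auto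
  obtain x0 \<rho> where \<rho>: "0 < \<rho>" "ball x0 \<rho> \<subseteq> U" using U by (meson all_not_in_conv open_contains_ball)
  obtain n where n: "0 < n" "1 / real n * dist a b \<le> \<rho> / 2" using ex_pieces[of "\<rho> / 2" "dist a b"] \<rho>(1) by auto
  define C where "C = real n * (64 / (pi * \<rho>))"
  have C: "C \<ge> 0" using \<rho> by (simp add: C_def)
  have "side_integral (a, b) v {0..1} \<le> ennreal (C * (mass M v / l + l * L\<^sup>2 * energy M v))"
    if M: "good_mesh M" and h: "mesh_size M < \<delta> / 2" and v: "v \<in> trial_space M" and l: "0 < l" "l \<le> 1" for M v l
  proof -
    note M' = good_meshD[OF M]
    \<comment> \<open>A point of \<open>U\<close> is within \<delta> / 2 of the frontier and the
      element has diameter below \<delta> / 2; an interface point in it would be closer than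
      \<delta> to the frontier.\<close>
    have away: "T \<inter> path_image \<gamma> = {}" if T: "T \<in> M" "T \<inter> U \<noteq> {}" for T
    proof (rule ccontr)
      assume "T \<inter> path_image \<gamma> \<noteq> {}"
      then obtain z where z: "z \<in> T" "z \<in> path_image \<gamma>" by blast
      obtain y where y: "y \<in> T" "y \<in> U" using T by blast
      obtain x where x: "x \<in> frontier \<Omega>" "dist x y < \<delta> / 2" using near[OF y(2)] by blast
      have "dist y z \<le> diameter T"
        using mesh_element(1)[OF M'(1) T(1)] y z by (intro diameter_bounded_bound compact_imp_bounded)
      then have "dist y z < \<delta> / 2" using diameter_le_mesh_size[OF M T(1)] h by linarith
      then have "dist x z < \<delta>" using x(2) dist_triangle[of x z y] by linarith
      then show False using \<delta>(2)[OF x(1) z(2)] by linarith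
    qed
    let ?N = "{T\<in>M. T \<inter> U \<noteq> {}}"
    have N: "(\<Sum>T\<in>?N. (L2_norm (interior T) v)\<^sup>2) \<le> mass M v" "(\<Sum>T\<in>?N. (H1_seminorm (interior T) v)\<^sup>2) \<le> energy M v"
      unfolding mass_def energy_def using M'(4) by (auto intro!: sum_mono2)
    have piece: "side_integral (a, b) v (part i n) \<le>
       ennreal (64 / (pi * \<rho>) * (mass M v / l + l * L\<^sup>2 * energy M v))" if i: "i < n" for i
    proof -
      note pb = piece_bounds[OF i]
      have "side_integral (a, b) v (part i n) \<le>
        ennreal (64 / (pi * \<rho>) * ((\<Sum>T\<in>?N. (L2_norm (interior T) v)\<^sup>2) / l +
         l * L\<^sup>2 * (\<Sum>T\<in>?N. (H1_seminorm (interior T) v)\<^sup>2)))"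
        unfolding side_integral_def fst_conv snd_conv
      proof (rule trace_piece_energy[OF P ab I M'(1,2) v[unfolded trial_space_def] U(1,2,4) away \<rho> pb(1,2,3) _ _ L l])
        show "((real i + 1) / real n - real i / real n) * dist a b \<le> \<rho> / 2" unfolding pb(4) by (rule n(2))
        show "linepath a b t \<in> closure U" if "real i / real n \<le> t" "t \<le> (real i + 1) / real n" for t
          using that pb by (intro cl) linarith+
      qed
      also have "\<dots> \<le> ennreal (64 / (pi * \<rho>) * (mass M v / l + l * L\<^sup>2 * energy M v))"
        using N \<rho>(1) l by (intro ennreal_leI mult_left_mono add_mono divide_right_mono) auto
      finally show ?thesis .
    qed
    have "side_integral (a, b) v {0..1} \<le> (\<Sum>i<n. side_integral (a, b) v (part i n))"
      unfolding side_integral_def by (rule nn_integral_unit_pieces[OF n(1)])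
    also have "\<dots> \<le> (\<Sum>i<n. ennreal (64 / (pi * \<rho>) * (mass M v / l + l * L\<^sup>2 * energy M v)))"
      by (intro sum_mono piece) simp
    also have "\<dots> = ennreal (C * (mass M v / l + l * L\<^sup>2 * energy M v))"
      using \<rho>(1) l mass_nonneg[of M v] energy_nonneg[of M v]
      by (simp add: sum_ennreal C_def mult.assoc del: sum_constant) (simp add: mult.assoc)
    finally show ?thesis .
  qed
  then show ?thesis using C by blast
qed

text \<open>The side is cut by the elements as well. An element containing a nondegenerate part of
  it is a boundary element, hence free of the interface, and its own interior serves as
  \<open>U\<close>. Its inscribed ball has a radius bounded below, since regularity makes every
  element comparable to the mesh size.\<close>

lemma side_bound_coarse:
  assumes ab: "(a, b) \<in> S" and \<delta>: "0 < \<delta>"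
    and L: "\<And>x y. x \<in> closure \<Omega> \<Longrightarrow> y \<in> closure \<Omega> \<Longrightarrow> dist x y \<le> L"
  shows "\<exists>C\<ge>0. \<forall>M v l. good_mesh M \<and> \<delta> / 2 \<le> mesh_size M \<and> v \<in> trial_space M \<and> 0 < l \<and> l \<le> 1 \<longrightarrow>
    side_integral (a, b) v {0..1} \<le> ennreal (C * (mass M v / l + l * L\<^sup>2 * energy M v))"
proof -
  have anb: "a \<noteq> b" and \<Omega>: "open \<Omega>" using P ab by (auto simp: polygonal_domain_def)
  \<comment> \<open>If \<open>r\<close> is the radius of the ball inscribed in an element, then
    \<delta> / 2 \<le> \<open>mesh_size M\<close> \<le> \<kappa> diam \<le> \<kappa> \<sigma> r
    \<le> k r, so r is at least \<delta> / (2 k). The maximum with 1 keeps the divisor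
    positive.\<close>
  define k where "k = max (\<kappa> * \<sigma>) 1"
  define \<rho> where "\<rho> = \<delta> / (2 * k)"
  have k: "k \<ge> 1" "\<kappa> * \<sigma> \<le> k" by (auto simp: k_def)
  have \<rho>: "\<rho> > 0" using \<delta> k by (simp add: \<rho>_def)
  obtain n where n: "0 < n" "1 / real n * dist a b \<le> \<rho> / 2" using ex_pieces[of "\<rho> / 2" "dist a b"] \<rho> by auto
  define C where "C = real n * (64 / (pi * \<rho>))"
  have C: "C \<ge> 0" using \<rho> by (simp add: C_def)
  have "side_integral (a, b) v {0..1} \<le> ennreal (C * (mass M v / l + l * L\<^sup>2 * energy M v))"
    if M: "good_mesh M" and h: "\<delta> / 2 \<le> mesh_size M" and v: "v \<in> trial_space M" and l: "0 < l" "l \<le> 1" for M v l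
  proof -
    note M' = good_meshD[OF M]
    define K where "K T = 64 / (pi * \<rho>) * ((L2_norm (interior T) v)\<^sup>2 / l + l * L\<^sup>2 * (H1_seminorm (interior T) v)\<^sup>2)" for T
    have K0: "0 \<le> K T" for T unfolding K_def using \<rho> l by (intro mult_nonneg_nonneg add_nonneg_nonneg) auto
    have elem: "side_integral (a, b) v {t \<in> (part i n). linepath a b t \<in> T} \<le> ennreal (K T)"
      if i: "i < n" and T: "T \<in> M" for i T
    proof -
      note pb = piece_bounds[OF i]
      have T': "compact T" "convex T" by (rule mesh_element[OF M'(1) T])+
      \<comment> \<open>A compact convex set of parameters, hence a closed interval, possibly empty
        or a single point; in these cases the integral is 0.\<close>
      define A where "A = {t \<in> (part i n). linepath a b t \<in> T}"
      have Aeq: "A = part i n \<inter> linepath a b -` T" by (auto simp: A_def)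
      have "compact A" unfolding Aeq using T'(1)
        by (intro compact_Int_closed closed_vimage) (auto simp: compact_imp_closed intro!: continuous_on_linepath)
      moreover have "convex A"
      proof (rule convexI)
        fix x y u w :: real assume h: "x \<in> A" "y \<in> A" "0 \<le> u" "0 \<le> w" "u + w = 1"
        have "u *\<^sub>R linepath a b x + w *\<^sub>R linepath a b y \<in> T" using T'(2) h by (intro convexD) (auto simp: A_def)
        moreover have "u *\<^sub>R linepath a b x + w *\<^sub>R linepath a b y = linepath a b (u * x + w * y)"
        proof -
          have w: "w = 1 - u" using h(5) by linarith
          show ?thesis unfolding w by (simp add: linepath_def algebra_simps)
        qed
        moreover have "u *\<^sub>R x + w *\<^sub>R y \<in> part i n"
          using h by (intro convexD[of "part i n"]) (auto simp: A_def)
        ultimately show "u *\<^sub>R x + w *\<^sub>R y \<in> A" by (simp add: A_def)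
      qed
      ultimately obtain \<alpha> \<beta> where A: "A = {\<alpha>..\<beta>}" using connected_compact_interval_1 convex_connected by blast
      show ?thesis
      proof (cases "\<alpha> < \<beta>")
        case False
        then have "A \<subseteq> {\<alpha>}" using A by auto
        have "side_integral (a, b) v A \<le> (\<integral>\<^sup>+t. indicator {\<alpha>} t *
            ennreal ((cmod (bdry_trace \<Omega> v (linepath a b \<alpha>)))\<^sup>2 * dist a b) \<partial>lborel)"
          unfolding side_integral_def fst_conv snd_conv
          using \<open>A \<subseteq> {\<alpha>}\<close> by (intro nn_integral_mono) (auto simp: indicator_def)
        also have "\<dots> = 0" by (simp add: nn_integral_multc)
        finally show ?thesis by (simp add: A_def)
      next
        case True
        have AT: "linepath a b t \<in> T" "real i / real n \<le> t" "t \<le> (real i + 1) / real n" if "\<alpha> \<le> t" "t \<le> \<beta>" for t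
        proof -
          have "t \<in> A" using A that by simp
          then show "linepath a b t \<in> T" "real i / real n \<le> t" "t \<le> (real i + 1) / real n" by (auto simp: A_def)
        qed
        have \<alpha>\<beta>: "0 \<le> \<alpha>" "\<beta> \<le> 1" "\<beta> - \<alpha> \<le> 1 / real n"
          using AT(2)[of \<alpha>] AT(3)[of \<beta>] True pb by linarith+
        have sub: "closed_segment (linepath a b \<alpha>) (linepath a b \<beta>) \<subseteq> T"
          using AT True T' by (intro linepath_segment_subset) auto
        have subf: "closed_segment (linepath a b \<alpha>) (linepath a b \<beta>) \<subseteq> frontier \<Omega>"
        proof -
          have "closed_segment a b \<subseteq> frontier \<Omega>" using P ab unfolding polygonal_domain_def by auto
          moreover have "linepath a b \<alpha> \<in> closed_segment a b" "linepath a b \<beta> \<in> closed_segment a b"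
            using \<alpha>\<beta> True by (auto intro!: linepath_in_path)
          ultimately show ?thesis using closed_segment_subset[OF _ _ convex_closed_segment] by blast
        qed
        have "closed_segment (linepath a b \<alpha>) (linepath a b \<beta>) \<subseteq> frontier T"
          using sub subf mesh_interior_subset[OF P M'(1) T] frontier_disjoint_open[OF \<Omega>] closure_subset[of T]
          unfolding frontier_def[of T] by blast
        moreover have "linepath a b \<alpha> \<noteq> linepath a b \<beta>"
        proof
          assume "linepath a b \<alpha> = linepath a b \<beta>"
          then have "(\<alpha> - \<beta>) *\<^sub>R (b - a) = 0" using linepath_diff[of a b \<alpha> \<beta>] by simp
          then show False using True anb by simp
        qed
        ultimately have "boundary_element \<Omega> T" using subf unfolding boundary_element_def by blast
        then have T\<gamma>: "T \<inter> path_image \<gamma> = {}" using M'(3) T unfolding admissible_mesh_def by blast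
        \<comment> \<open>With \<open>U = interior T\<close> the sums in the energy bound reduce to
          the single term for \<open>T\<close>, so adding up over the mesh counts every element once
          per piece.\<close>
        have only: "{T'\<in>M. T' \<inter> interior T \<noteq> {}} = {T}"
          using mesh_interior_disjoint[OF M'(1,2) _ T] T regular_mesh_interior[OF M'(2) T] interior_subset by blast
        obtain x r where xr: "0 < r" "cball x r \<subseteq> T" "diameter T \<le> \<sigma> * r" "mesh_size M \<le> \<kappa> * diameter T"
          using M'(2) T unfolding regular_mesh_def by blast
        have d0: "0 \<le> diameter T" using T'(1) by (simp add: diameter_ge_0 compact_imp_bounded)
        have "0 < \<kappa> * diameter T" using h xr(4) \<delta> by linarith
        then have "0 < \<kappa>" using d0 by (simp add: zero_less_mult_iff)
        have "mesh_size M \<le> \<kappa> * (\<sigma> * r)"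
          using xr(4) mult_left_mono[OF xr(3), of \<kappa>] \<open>0 < \<kappa>\<close> by linarith
        also have "\<dots> \<le> k * r" using k(2) xr(1) by (simp add: mult.assoc[symmetric] mult_right_mono)
        finally have "\<delta> \<le> r * (2 * k)" using h by (simp add: mult_ac)
        then have "\<rho> \<le> r" unfolding \<rho>_def using k(1) by (simp add: divide_le_eq)
        then have "ball x \<rho> \<subseteq> ball x r" by (rule subset_ball)
        also have "\<dots> \<subseteq> interior T" using xr(2) ball_subset_cball by (intro interior_maximal) (auto intro: order_trans)
        finally have ball: "ball x \<rho> \<subseteq> interior T" .
        have clT: "closure (interior T) = T"
          using convex_closure_interior[OF T'(2) regular_mesh_interior[OF M'(2) T]] T'(1) by (simp add: compact_imp_closed)
        have "side_integral (a, b) v {\<alpha>..\<beta>} \<le>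
          ennreal (64 / (pi * \<rho>) * ((\<Sum>T\<in>{T'\<in>M. T' \<inter> interior T \<noteq> {}}. (L2_norm (interior T) v)\<^sup>2) / l +
           l * L\<^sup>2 * (\<Sum>T\<in>{T'\<in>M. T' \<inter> interior T \<noteq> {}}. (H1_seminorm (interior T) v)\<^sup>2)))"
          unfolding side_integral_def fst_conv snd_conv
        proof (rule trace_piece_energy[OF P ab I M'(1,2) v[unfolded trial_space_def] open_interior convex_interior[OF T'(2)]
              mesh_interior_subset[OF P M'(1) T] _ \<rho> ball \<alpha>\<beta>(1) True \<alpha>\<beta>(2) _ _ L l])
          show "T' \<inter> path_image \<gamma> = {}" if "T' \<in> M" "T' \<inter> interior T \<noteq> {}" for T'
            using that only T\<gamma> by blast
          show "(\<beta> - \<alpha>) * dist a b \<le> \<rho> / 2"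
            by (rule order_trans[OF mult_right_mono[OF \<alpha>\<beta>(3) zero_le_dist] n(2)])
          show "linepath a b t \<in> closure (interior T)" if "\<alpha> \<le> t" "t \<le> \<beta>" for t
            unfolding clT by (rule AT(1)[OF that])
        qed
        then show ?thesis unfolding only A_def[symmetric] A by (simp add: K_def)
      qed
    qed
    have piece: "side_integral (a, b) v (part i n) \<le> ennreal (\<Sum>T\<in>M. K T)" if i: "i < n" for i
    proof -
      let ?J = "part i n"
      define f where "f t = ennreal ((cmod (bdry_trace \<Omega> v (linepath a b t)))\<^sup>2 * dist a b)" for t
      have "(\<integral>\<^sup>+t. indicator ?J t * f t \<partial>lborel) \<le>
          (\<Sum>T\<in>M. \<integral>\<^sup>+t. indicator {t \<in> ?J. linepath a b t \<in> T} t * (indicator ?J t * f t) \<partial>lborel)"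
      proof (rule nn_integral_cover_le[OF M'(4)])
        fix T assume "T \<in> M"
        then have [measurable]: "T \<in> sets borel" using mesh_element(1)[OF M'(1)] by (auto simp: compact_imp_closed)
        show "{t \<in> ?J. linepath a b t \<in> T} \<in> sets lborel" unfolding linepath_def by measurable
      next
        fix t assume "indicator ?J t * f t \<noteq> 0"
        then have t: "t \<in> ?J" by (auto simp: indicator_def split: if_splits)
        then have "real i / real n \<le> t" "t \<le> (real i + 1) / real n" by auto
        then have "0 \<le> t" "t \<le> 1" using piece_bounds(1,3)[OF i] by linarith+
        then have "linepath a b t \<in> frontier \<Omega>" by (rule side_in_frontier[OF P ab])
        then have "linepath a b t \<in> \<Union>M" using M'(1) by (auto simp: mesh_def frontier_def)
        then show "\<exists>T\<in>M. t \<in> {t \<in> ?J. linepath a b t \<in> T}" using t by blast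
      qed
      also have "\<dots> \<le> (\<Sum>T\<in>M. side_integral (a, b) v {t \<in> ?J. linepath a b t \<in> T})"
        unfolding side_integral_def fst_conv snd_conv f_def[symmetric]
        by (intro sum_mono nn_integral_mono mult_left_mono) (auto simp: indicator_def)
      also have "\<dots> \<le> (\<Sum>T\<in>M. ennreal (K T))" by (intro sum_mono elem i)
      also have "\<dots> = ennreal (\<Sum>T\<in>M. K T)" using K0 by (simp add: sum_ennreal)
      finally show ?thesis by (simp add: side_integral_def f_def)
    qed
    have "side_integral (a, b) v {0..1} \<le> (\<Sum>i<n. side_integral (a, b) v (part i n))"
      unfolding side_integral_def by (rule nn_integral_unit_pieces[OF n(1)])
    also have "\<dots> \<le> (\<Sum>i<n. ennreal (\<Sum>T\<in>M. K T))" by (intro sum_mono piece) simp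
    also have "\<dots> = ennreal (\<Sum>i<n. \<Sum>T\<in>M. K T)" using K0 by (intro sum_ennreal) (simp add: sum_nonneg)
    also have "(\<Sum>i<n. \<Sum>T\<in>M. K T) = C * (mass M v / l + l * L\<^sup>2 * energy M v)"
      by (simp add: K_def C_def mass_def energy_def sum_distrib_left sum.distrib sum_divide_distrib
          distrib_left mult.assoc)
    finally show ?thesis .
  qed
  then show ?thesis using C by blast
qed

lemma ex_separation: "\<exists>\<delta>>0. \<forall>x\<in>frontier \<Omega>. \<forall>y\<in>path_image \<gamma>. \<delta> \<le> dist x y"
proof (rule separate_compact_closed)
  have "bounded \<Omega>" "open \<Omega>" using P by (auto simp: polygonal_domain_def)
  then show "compact (frontier \<Omega>)" by (simp add: compact_frontier_bounded)
  have "path \<gamma>" "path_image \<gamma> \<subseteq> \<Omega>" using I by (auto simp: interface_def simple_path_imp_path)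
  then show "closed (path_image \<gamma>)" "frontier \<Omega> \<inter> path_image \<gamma> = {}"
    using frontier_disjoint_open[OF \<open>open \<Omega>\<close>] by (auto simp: closed_path_image)
qed

lemma side_bound:
  assumes p: "p \<in> S"
  shows "\<exists>C\<ge>0. \<forall>M v l. good_mesh M \<and> v \<in> trial_space M \<and> 0 < l \<and> l \<le> 1 \<longrightarrow>
    side_integral p v {0..1} \<le> ennreal (C * (mass M v / l + l * energy M v))"
proof -
  obtain a b where ab: "p = (a, b)" "(a, b) \<in> S" using p by (cases p) auto
  obtain \<delta> where \<delta>: "0 < \<delta>" "\<And>x y. x \<in> frontier \<Omega> \<Longrightarrow> y \<in> path_image \<gamma> \<Longrightarrow> \<delta> \<le> dist x y"
    using ex_separation by blast
  define L where "L = diameter (closure \<Omega>)"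
  have "bounded \<Omega>" using P unfolding polygonal_domain_def by blast
  then have "bounded (closure \<Omega>)" by (rule bounded_closure)
  then have L: "dist x y \<le> L" if "x \<in> closure \<Omega>" "y \<in> closure \<Omega>" for x y
    unfolding L_def using that by (intro diameter_bounded_bound)
  obtain C1 where C1: "C1 \<ge> 0" "\<And>M v l. good_mesh M \<Longrightarrow> mesh_size M < \<delta> / 2 \<Longrightarrow> v \<in> trial_space M \<Longrightarrow> 0 < l \<Longrightarrow> l \<le> 1 \<Longrightarrow>
    side_integral (a, b) v {0..1} \<le> ennreal (C1 * (mass M v / l + l * L\<^sup>2 * energy M v))"
    using side_bound_fine[OF ab(2) \<delta> L] by blast
  obtain C2 where C2: "C2 \<ge> 0" "\<And>M v l. good_mesh M \<Longrightarrow> \<delta> / 2 \<le> mesh_size M \<Longrightarrow> v \<in> trial_space M \<Longrightarrow> 0 < l \<Longrightarrow> l \<le> 1 \<Longrightarrow>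
    side_integral (a, b) v {0..1} \<le> ennreal (C2 * (mass M v / l + l * L\<^sup>2 * energy M v))"
    using side_bound_coarse[OF ab(2) \<delta>(1) L] by blast
  \<comment> \<open>The sum dominates the constants of both mesh regimes, and 1 + L^2 absorbs the
    factor in front of the energy.\<close>
  define C where "C = (C1 + C2) * (1 + L\<^sup>2)"
  have "side_integral p v {0..1} \<le> ennreal (C * (mass M v / l + l * energy M v))"
    if M: "good_mesh M" "v \<in> trial_space M" and l: "0 < l" "l \<le> 1" for M v l
  proof -
    define X where "X = mass M v / l + l * energy M v"
    define Y where "Y = mass M v / l + l * L\<^sup>2 * energy M v"
    have p: "0 \<le> mass M v / l" "0 \<le> l * energy M v" using l mass_nonneg[of M v] energy_nonneg[of M v] by simp_all
    have "Y \<le> (1 + L\<^sup>2) * X"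
    proof -
      have "(1 + L\<^sup>2) * X = Y + (L\<^sup>2 * (mass M v / l) + l * energy M v)" by (simp add: X_def Y_def algebra_simps)
      moreover have "0 \<le> L\<^sup>2 * (mass M v / l)" using p(1) by (intro mult_nonneg_nonneg) auto
      ultimately show ?thesis using p(2) by linarith
    qed
    moreover have "0 \<le> Y" unfolding Y_def using l p(1) energy_nonneg[of M v] by (intro add_nonneg_nonneg mult_nonneg_nonneg) auto
    ultimately have CY: "C1 * Y \<le> C * X" "C2 * Y \<le> C * X"
      using C1(1) C2(1) mult_mono[of C1 "C1 + C2" Y "(1 + L\<^sup>2) * X"] mult_mono[of C2 "C1 + C2" Y "(1 + L\<^sup>2) * X"]
      by (simp_all add: C_def mult.assoc)
    show ?thesis
    proof (cases "mesh_size M < \<delta> / 2")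
      case True
      show ?thesis
        using order_trans[OF C1(2)[OF M(1) True M(2) l] ennreal_leI] CY(1) by (simp add: ab X_def Y_def)
    next
      case False
      then show ?thesis
        using order_trans[OF C2(2)[OF M(1) _ M(2) l] ennreal_leI] CY(2) by (simp add: ab X_def Y_def)
    qed
  qed
  moreover have "C \<ge> 0" using C1 C2 by (simp add: C_def)
  ultimately show ?thesis by blast
qed

lemma boundary_bound:
  "\<exists>C\<ge>0. \<forall>M v l. good_mesh M \<and> v \<in> trial_space M \<and> 0 < l \<and> l \<le> 1 \<longrightarrow>
    bdry_L2_norm_sq S (bdry_trace \<Omega> v) \<le> ennreal (C * (mass M v / l + l * energy M v))"
proof -
  have fin: "finite S" using P by (simp add: polygonal_domain_def)
  obtain c where c: "\<And>p. p \<in> S \<Longrightarrow> c p \<ge> 0" "\<And>p M v l. p \<in> S \<Longrightarrow> good_mesh M \<Longrightarrow> v \<in> trial_space M \<Longrightarrow> 0 < l \<Longrightarrow> l \<le> 1 \<Longrightarrow>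
    side_integral p v {0..1} \<le> ennreal (c p * (mass M v / l + l * energy M v))"
    using side_bound by metis
  have "bdry_L2_norm_sq S (bdry_trace \<Omega> v) \<le> ennreal ((\<Sum>p\<in>S. c p) * (mass M v / l + l * energy M v))"
    if M: "good_mesh M" "v \<in> trial_space M" and l: "0 < l" "l \<le> 1" for M v l
  proof -
    have X0: "0 \<le> mass M v / l + l * energy M v" using l mass_nonneg[of M v] energy_nonneg[of M v] by simp
    have "bdry_L2_norm_sq S (bdry_trace \<Omega> v) = (\<Sum>p\<in>S. side_integral p v {0..1})"
      unfolding bdry_L2_norm_sq_def side_integral_def
      by (intro sum.cong) (auto simp: nn_integral_restrict_space nn_integral_completion mult.commute)
    also have "\<dots> \<le> (\<Sum>p\<in>S. ennreal (c p * (mass M v / l + l * energy M v)))"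
      by (intro sum_mono c(2) M l)
    also have "\<dots> = ennreal (\<Sum>p\<in>S. c p * (mass M v / l + l * energy M v))"
      using c(1) X0 by (intro sum_ennreal) simp
    finally show ?thesis by (simp add: sum_distrib_right)
  qed
  moreover have "(\<Sum>p\<in>S. c p) \<ge> 0" using c(1) by (intro sum_nonneg)
  ultimately show ?thesis by blast
qed

end

text \<open>The right side is smallest at l = p / q, where both terms equal p q. If this exceeds 1,
  take l = 1; if p = 0, let l tend to 0.\<close>

lemma optimise_length:
  fixes B :: ennreal and C p q :: real
  assumes C: "0 \<le> C" and pq: "0 \<le> p" "0 \<le> q"
    and B: "\<And>l. 0 < l \<Longrightarrow> l \<le> 1 \<Longrightarrow> B \<le> ennreal (C * (p\<^sup>2 / l + l * q\<^sup>2))"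
  shows "B \<le> ennreal (2 * C * p * max p q)"
proof -
  consider "q \<le> p" | "0 < p" "p < q" | "p = 0" using pq by linarith
  then show ?thesis
  proof cases
    case 1
    have "B \<le> ennreal (C * (p\<^sup>2 / 1 + 1 * q\<^sup>2))" by (rule B) auto
    also have "\<dots> \<le> ennreal (C * (p\<^sup>2 + p\<^sup>2))"
      using 1 pq C by (intro ennreal_leI mult_left_mono) (auto intro: power_mono)
    also have "C * (p\<^sup>2 + p\<^sup>2) = 2 * C * p * max p q" using 1 by (simp add: power2_eq_square)
    finally show ?thesis .
  next
    case 2
    have "B \<le> ennreal (C * (p\<^sup>2 / (p / q) + p / q * q\<^sup>2))" using 2 by (intro B) auto
    also have "C * (p\<^sup>2 / (p / q) + p / q * q\<^sup>2) = 2 * C * p * max p q" using 2 by (simp add: power2_eq_square field_simps)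
    finally show ?thesis .
  next
    case 3
    have "B \<le> ennreal e" if e: "e > 0" for e
    proof -
      \<comment> \<open>Makes C l q^2 at most \<open>e\<close>; the added 1 keeps the denominator
        positive when C q^2 is 0.\<close>
      define l where "l = min 1 (e / (C * q\<^sup>2 + 1))"
      have Cq: "0 \<le> C * q\<^sup>2" using C by simp
      have l: "0 < l" "l \<le> 1" using e Cq by (auto simp: l_def intro!: divide_pos_pos)
      have "l \<le> e / (C * q\<^sup>2 + 1)" by (simp add: l_def)
      then have "l * (C * q\<^sup>2 + 1) \<le> e" using Cq by (simp only: pos_le_divide_eq add_nonneg_pos zero_less_one)
      then have "C * (p\<^sup>2 / l + l * q\<^sup>2) \<le> e" using 3 l by (simp add: algebra_simps)
      then show ?thesis using B[OF l] ennreal_leI order_trans by blast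
    qed
    then have "B \<le> 0" using ennreal_le_epsilon[of 0 B] by simp
    then show ?thesis by simp
  qed
qed

theorem theorem3p1:
  fixes \<Omega> \<Omega>m \<Omega>p :: "(real^2) set"
    and S :: "((real^2) \<times> (real^2)) set"
    and \<gamma> :: "real \<Rightarrow> real^2"
    and \<beta>m \<beta>p \<sigma> \<kappa> :: real
  assumes "polygonal_domain \<Omega> S"
    and "interface \<Omega> \<Omega>m \<Omega>p \<gamma>"
    and "\<beta>m > 0" and "\<beta>p > 0"
  shows "\<exists>C>0. \<forall>M.
    mesh \<Omega> M \<and> regular_mesh \<sigma> \<kappa> M \<and> admissible_mesh \<Omega> (path_image \<gamma>) M \<longrightarrow>
    (\<forall>v \<in> sum_space (PH2 \<Omega>m \<Omega>p \<gamma> \<beta>m \<beta>p)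
                    (ife_space \<Omega> \<Omega>m \<Omega>p (path_image \<gamma>) \<beta>m \<beta>p M).
       bdry_L2_norm_sq S (bdry_trace \<Omega> v) \<le>
         ennreal (C * (L2_norm \<Omega> v + mesh_size M * broken_H1_seminorm M v) * broken_H1_norm M v))"
proof -
  interpret ife_setting \<Omega> \<Omega>m \<Omega>p S \<gamma> \<beta>m \<beta>p \<sigma> \<kappa> by unfold_locales (rule assms)+
  obtain C where C: "C \<ge> 0" and bound: "\<And>M v l. good_mesh M \<Longrightarrow> v \<in> trial_space M \<Longrightarrow> 0 < l \<Longrightarrow> l \<le> 1 \<Longrightarrow>
      bdry_L2_norm_sq S (bdry_trace \<Omega> v) \<le> ennreal (C * (mass M v / l + l * energy M v))"
    using boundary_bound by blast
  \<comment> \<open>\<open>2 * C + 1\<close> rather than \<open>2 * C\<close>, because the constant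
    has to be positive and \<open>C\<close> may be 0.\<close>
  have "bdry_L2_norm_sq S (bdry_trace \<Omega> v) \<le>
      ennreal ((2 * C + 1) * (L2_norm \<Omega> v + mesh_size M * broken_H1_seminorm M v) * broken_H1_norm M v)"
    if M: "good_mesh M" and v: "v \<in> trial_space M" for M v
  proof -
    note M' = good_meshD[OF M]
    define p q where "p = sqrt (mass M v)" and "q = sqrt (energy M v)"
    have pq: "0 \<le> p" "0 \<le> q" "p\<^sup>2 = mass M v" "q\<^sup>2 = energy M v"
      using mass_nonneg[of M v] energy_nonneg[of M v] by (simp_all add: p_def q_def)
    have q: "broken_H1_seminorm M v = q" by (simp add: broken_H1_seminorm_def q_def energy_def)
    have "(\<Sum>T\<in>M. (H1_norm (interior T) v)\<^sup>2) = mass M v + energy M v"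
      by (simp add: H1_norm_def mass_def energy_def sum.distrib)
    then have N: "broken_H1_norm M v = sqrt (p\<^sup>2 + q\<^sup>2)" by (simp add: broken_H1_norm_def pq)
    have Npq: "max p q \<le> broken_H1_norm M v" 
      unfolding N by (intro max.boundedI real_sqrt_sum_squares_ge1 real_sqrt_sum_squares_ge2)
    have vsq: "sq_integrable \<Omega> v"
      by (rule sum_space_sq_integrable[OF P I v[unfolded trial_space_def]])
    have L0: "0 \<le> L2_norm \<Omega> v" by (simp add: L2_norm_def integral_nonneg_AE)
    have "mass M v \<le> (L2_norm \<Omega> v)\<^sup>2"
      unfolding mass_def by (rule sum_L2_norm_le[OF P M'(1,2) vsq])
    then have pL: "p \<le> L2_norm \<Omega> v" unfolding p_def using L0 by (simp add: real_le_lsqrt)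
    \<comment> \<open>\<open>mesh_size\<close> is a maximum over the mesh; that it is nonnegative is
      seen from any one element.\<close>
    have "M \<noteq> {}" using M'(1) P by (auto simp: mesh_def polygonal_domain_def)
    then obtain T where T: "T \<in> M" by blast
    have "0 \<le> diameter T" using mesh_element(1)[OF M'(1) T] by (simp add: diameter_ge_0 compact_imp_bounded)
    then have h0: "0 \<le> mesh_size M" using diameter_le_mesh_size[OF M T] by linarith
    have "bdry_L2_norm_sq S (bdry_trace \<Omega> v) \<le> ennreal (2 * C * p * max p q)"
      by (rule optimise_length[OF C pq(1,2)]) (simp add: pq bound[OF M v])
    \<comment> \<open>\<open>p\<close> is at most the norm over \<Omega>, to which a nonnegative
      term is added, and \<open>max p q\<close> is at most the broken norm, whose square is p^2 +
      q^2.\<close>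
    also have "2 * C * p * max p q \<le> (2 * C + 1) * (L2_norm \<Omega> v + mesh_size M * broken_H1_seminorm M v) * broken_H1_norm M v"
      using C pL Npq h0 pq L0 unfolding q
      by (intro mult_mono) (auto intro!: mult_nonneg_nonneg add_nonneg_nonneg add_increasing2 simp: le_max_iff_disj)
    finally show ?thesis by (simp add: ennreal_leI)
  qed
  then show ?thesis using C unfolding good_mesh_def trial_space_def by (intro exI[of _ "2 * C + 1"]) auto
qed

end
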